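(* Let $(W_t)_{t\ge 0}$ be a standard Brownian motion with $W_0=0$. Let $b:(0,\infty)\to\mathbb{R}$ be continuous with $b(0)\le 0$ (where $b(0):=\lim_{t\downarrow 0}b(t)$, the value $-\infty$ being allowed), let $\tau=\inf\{t>0:\ W_t\le b(t)\}$, and assume $P(\tau=0)=0$; if $b(0)=-\infty$, assume also that $b$ is monotone increasing on $(0,\epsilon]$ for some $\epsilon>0$. Let $F(t)=P(\tau\le t)$. Let $0<\delta\le\infty$ and let $u:(0,\delta)\times\mathbb{R}\to[0,\infty)$, $(s,x)\mapsto u(s,x)$, be a continuous non-negative function satisfying $u_s=\frac12 u_{xx}$ on $(0,\delta)\times\mathbb{R}$ and $\lim_{(s,x)\to(0,e)}u(s,x)=0$ for all $e<0$. Then for every $0<t<\delta$ and every $y<b(t)$, $$u(t,y)=\int_0^t u\big(t-s,\,y-b(s)\big)\,F(ds).$$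
   Context: By a classical theorem of Widder, the functions $u$ in the claim are exactly the (continuous, finite) functions of the form $u(s,x)=\int_0^\infty \frac{1}{\sqrt{s}}\,\phi\!\left(\frac{x-\theta}{\sqrt{s}}\right)Q(d\theta)$ with $Q$ a positive $\sigma$-finite measure on $[0,\infty)$ and $\phi$ the standard normal density. The integral is a Lebesgue–Stieltjes integral with respect to $F$; the integrand at $s=t$ is read as its limit $0$ (note $y-b(t)<0$). *)

theory Defs
  imports "HOL-Probability.Probability"
begin

locale standard_brownian_motion = prob_space M
  for M :: "'a measure" and W :: "real \<Rightarrow> 'a \<Rightarrow> real" +
  assumes measurable_W: "\<And>t. 0 \<le> t \<Longrightarrow> W t \<in> borel_measurable M"
    and start_zero: "\<And>\<omega>. \<omega> \<in> space M \<Longrightarrow> W 0 \<omega> = 0"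
    and continuous_paths: "\<And>\<omega>. \<omega> \<in> space M \<Longrightarrow> continuous_on {0..} (\<lambda>t. W t \<omega>)"
    and normal_increments: "\<And>s t. 0 \<le> s \<Longrightarrow> s < t \<Longrightarrow>
      distributed M lborel (\<lambda>\<omega>. W t \<omega> - W s \<omega>) (normal_density 0 (sqrt (t - s)))"
    and independent_increments: "\<And>(r :: nat \<Rightarrow> real) n. 0 \<le> r 0 \<Longrightarrow> (\<And>i. i < n \<Longrightarrow> r i < r (Suc i)) \<Longrightarrow>
      indep_vars (\<lambda>_. borel) (\<lambda>i \<omega>. W (r (Suc i)) \<omega> - W (r i) \<omega>) {..<n}"

text \<open>The value is \<open>\<infinity>\<close> if the boundary is never reached.\<close>

definition passage_time :: "(real \<Rightarrow> 'a \<Rightarrow> real) \<Rightarrow> (real \<Rightarrow> real) \<Rightarrow> 'a \<Rightarrow> ereal" where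
  "passage_time W b \<omega> = Inf {ereal t | t. 0 < t \<and> W t \<omega> \<le> b t}"

definition passage_cdf :: "'a measure \<Rightarrow> (real \<Rightarrow> 'a \<Rightarrow> real) \<Rightarrow> (real \<Rightarrow> real) \<Rightarrow> real \<Rightarrow> real" where
  "passage_cdf M W b t = measure M {\<omega> \<in> space M. passage_time W b \<omega> \<le> ereal t}"

definition time_strip :: "ereal \<Rightarrow> (real \<times> real) set" where
  "time_strip \<delta> = {(s, x). 0 < s \<and> ereal s < \<delta>}"

definition solves_heat_equation :: "ereal \<Rightarrow> (real \<Rightarrow> real \<Rightarrow> real) \<Rightarrow> bool" where
  "solves_heat_equation \<delta> u \<longleftrightarrow>
    (\<forall>(s, x) \<in> time_strip \<delta>.
      (\<lambda>r. u r x) field_differentiable at s \<and>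
      u s field_differentiable at x \<and>
      deriv (u s) field_differentiable at x \<and>
      deriv (\<lambda>r. u r x) s = 1 / 2 * deriv (deriv (u s)) x)"

end

theory Submission
  imports Defs
begin

text \<open>
  A non-negative solution \<open>u\<close> of the heat equation is propagated by the Gaussian kernel:
  \<open>u s = P (s - \<epsilon>) (u \<epsilon>)\<close> for \<open>0 < \<epsilon> \<le> s\<close> (Widder). Only pointwise derivatives are needed. The maximum
  principle on large boxes, with the growing barrier \<open>exp (x\<^sup>2 / (2 (T - s))) / sqrt (T - s)\<close>
  absorbing the lateral boundary, first gives \<open>P (s - \<epsilon>) (u \<epsilon>) \<le> u s\<close>. This bounds the averages of
  \<open>u s\<close> over unit intervals by the barrier; the averages are locally uniform limits of sums of translates of \<open>u\<close>, so
  they obey the maximum principle as well, which yields the reverse inequality for the averages and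
  hence equality.

  Consequently \<open>u (t - s) (y - W s)\<close> is a martingale for \<open>s \<le> t - \<epsilon>\<close>. Stopping it at the passage time
  \<open>\<tau>\<close>, where \<open>W = b\<close>, expresses \<open>u t y\<close> as the expectation of \<open>u (t - \<tau>) (y - b \<tau>)\<close> on
  \<open>\<tau> \<le> t - \<epsilon>\<close> plus the expectation of \<open>u \<epsilon> (y - W (t - \<epsilon>))\<close> on \<open>\<tau> > t - \<epsilon>\<close>. On the latter event
  \<open>y - W (t - \<epsilon>)\<close> is bounded away from \<open>0\<close> from above, and since \<open>u\<close> vanishes initially on the
  negative half line, this term tends to \<open>0\<close> as \<open>\<epsilon> \<rightarrow> 0\<close>.
\<close>

text \<open>Positivity is the control at spatial infinity; without it Tychonoff's null solutions
  would defeat uniqueness. Its decisive use: on the lateral sides of a box \<open>v\<close> may be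
  dropped from \<open>heat f - v\<close>, and the resulting lower bound shows that
  \<open>v s\<close> is integrable against a Gaussian. This limits the mass of \<open>v s\<close> on
  unit intervals but not its values at points, which is why the reverse comparison is run for
  averages. Differentiating an average under the integral sign would need locally bounded
  derivatives, and pointwise differentiability supplies none. Riemann sums avoid this: a finite sum
  of translates solves the equation exactly, and the maximum principle tolerates a uniform error.

  The probabilistic half uses neither a filtration nor the strong Markov property. Whether
  \<open>b\<close> is hit before a given time is a monotone limit of events in finitely many
  increments, so independence of one later increment is enough. The start is at \<epsilon> and not
  at 0 because \<open>u\<close> need not extend continuously to time 0, where its data may be a
  measure.\<close>

section \<open>The maximum principle for the heat equation\<close>


text \<open>The equation at a single point, without continuity of any derivative: the first space
  derivative exists along the whole line, the other two derivatives only at \<open>(s, x)\<close>.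
  An argument at a maximum needs no more, and the property passes to translates and finite linear
  combinations.\<close>

definition heat_at :: "(real \<Rightarrow> real \<Rightarrow> real) \<Rightarrow> real \<Rightarrow> real \<Rightarrow> bool" where
  "heat_at w s x \<longleftrightarrow> (\<exists>w' D. (\<forall>z. (w s has_real_derivative w' z) (at z)) \<and>
     (w' has_real_derivative D) (at x) \<and> ((\<lambda>r. w r x) has_real_derivative D / 2) (at s))"

lemma heat_atI:
  assumes "\<And>z. (w s has_real_derivative w' z) (at z)" "(w' has_real_derivative D) (at x)"
    "((\<lambda>r. w r x) has_real_derivative D / 2) (at s)"
  shows "heat_at w s x"
  unfolding heat_at_def using assms by blast

lemma heat_at_add:
  assumes "heat_at v s x" "heat_at w s x"
  shows "heat_at (\<lambda>s x. v s x + w s x) s x"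
proof -
  obtain v' D where 1: "\<forall>z. (v s has_real_derivative v' z) (at z)" "(v' has_real_derivative D) (at x)"
     "((\<lambda>r. v r x) has_real_derivative D / 2) (at s)" using assms(1) unfolding heat_at_def by blast
  obtain w' E where 2: "\<forall>z. (w s has_real_derivative w' z) (at z)" "(w' has_real_derivative E) (at x)"
     "((\<lambda>r. w r x) has_real_derivative E / 2) (at s)" using assms(2) unfolding heat_at_def by blast
  have "((\<lambda>x. v s x + w s x) has_real_derivative v' z + w' z) (at z)" for z
    using 1(1) 2(1) by (auto intro: derivative_intros)
  moreover have "((\<lambda>x. v' x + w' x) has_real_derivative D + E) (at x)"
    using 1(2) 2(2) by (auto intro: derivative_intros)
  moreover have "((\<lambda>r. v r x + w r x) has_real_derivative (D + E) / 2) (at s)"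
    using DERIV_add[OF 1(3) 2(3)] by (simp add: add_divide_distrib)
  ultimately show ?thesis by (rule heat_atI)
qed

lemma heat_at_cmult:
  assumes "heat_at v s x"
  shows "heat_at (\<lambda>s x. c * v s x) s x"
proof -
  obtain v' D where 1: "\<forall>z. (v s has_real_derivative v' z) (at z)" "(v' has_real_derivative D) (at x)"
     "((\<lambda>r. v r x) has_real_derivative D / 2) (at s)" using assms(1) unfolding heat_at_def by blast
  have "((\<lambda>x. c * v s x) has_real_derivative c * v' z) (at z)" for z
    using 1(1) by (auto intro: DERIV_cmult)
  moreover have "((\<lambda>x. c * v' x) has_real_derivative c * D) (at x)"
    using 1(2) by (auto intro: DERIV_cmult)
  moreover have "((\<lambda>r. c * v r x) has_real_derivative (c * D) / 2) (at s)"
    using DERIV_cmult[OF 1(3), of c] by simp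
  ultimately show ?thesis by (rule heat_atI)
qed

lemma heat_at_diff:
  assumes "heat_at v s x" "heat_at w s x"
  shows "heat_at (\<lambda>s x. v s x - w s x) s x"
  using heat_at_add[OF assms(1) heat_at_cmult[OF assms(2), of "-1"]] by simp

lemma heat_at_sum:
  assumes "finite I" "\<And>i. i \<in> I \<Longrightarrow> heat_at (v i) s x"
  shows "heat_at (\<lambda>s x. \<Sum>i\<in>I. v i s x) s x"
  using assms
proof (induction I rule: finite_induct)
  case empty
  show ?case unfolding heat_at_def by (intro exI[of _ "\<lambda>_. 0"] exI[of _ 0]) auto
next
  case (insert i I)
  then show ?case using heat_at_add[of "v i" s x "\<lambda>s x. \<Sum>i\<in>I. v i s x"] by simp
qed

lemma heat_at_translate:
  assumes "heat_at v (s + a) (x + c)"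
  shows "heat_at (\<lambda>s x. v (s + a) (x + c)) s x"
proof -
  obtain v' D where 1: "\<forall>z. (v (s+a) has_real_derivative v' z) (at z)" "(v' has_real_derivative D) (at (x+c))"
     "((\<lambda>r. v r (x+c)) has_real_derivative D / 2) (at (s+a))" using assms(1) unfolding heat_at_def by blast
  have "((\<lambda>x. v (s+a) (x+c)) has_real_derivative v' (z+c)) (at z)" for z
    using 1(1) DERIV_shift[of "v (s+a)" "v' (z+c)" z c] by simp
  moreover have "((\<lambda>x. v' (x+c)) has_real_derivative D) (at x)"
    using 1(2) DERIV_shift[of v' D x c] by simp
  moreover have "((\<lambda>r. v (r+a) (x+c)) has_real_derivative D / 2) (at s)"
    using 1(3) DERIV_shift[of "\<lambda>r. v r (x+c)" "D/2" s a] by simp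
  ultimately show ?thesis by (rule heat_atI)
qed

text \<open>\<open>f'\<close> need not be differentiable away from \<open>x\<close>. If
  \<open>D\<close> were positive, \<open>f'\<close> would be positive immediately to the right of
  its zero \<open>x\<close>, and the mean value theorem would make \<open>f\<close> exceed the
  maximum there.\<close>

lemma second_derivative_at_local_max:
  fixes f :: "real \<Rightarrow> real"
  assumes f: "\<And>z. (f has_real_derivative f' z) (at z)" and f': "(f' has_real_derivative D) (at x)"
    and d: "0 < d" and max: "\<And>z. \<bar>x - z\<bar> < d \<Longrightarrow> f z \<le> f x"
  shows "D \<le> 0"
proof (rule ccontr)
  assume "\<not> D \<le> 0"
  hence "0 < D" by simp
  from DERIV_pos_inc_right[OF f' this] obtain e where e: "e > 0" "\<And>h. 0 < h \<Longrightarrow> h < e \<Longrightarrow> f' x < f' (x + h)" by blast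
  have z: "f' x = 0" using DERIV_local_max[OF f d] max by blast
  define h where "h = min d e / 2"
  have h: "0 < h" "h < d" "h < e" using d e(1) by (auto simp: h_def)
  obtain z where z': "x < z" "z < x + h" "f (x + h) - f x = (x + h - x) * f' z"
    using MVT2[of x "x+h" f f'] f h(1) by auto
  have "f' z > 0" using e(2)[of "z - x"] z' z h by auto
  hence "f (x+h) > f x" using z'(3) mult_pos_pos[OF h(1), of "f' z"] by auto
  moreover have "f (x+h) \<le> f x" by (rule max) (use h in auto)
  ultimately show False by simp
qed

text \<open>At a maximum of \<open>w - \<eta> * s\<close> off the initial and lateral boundary the
  second space derivative is at most 0, so by the equation the time derivative is at most
  \<open>-\<eta>\<close>; slightly earlier the function would be larger.\<close>

lemma heat_max_principle:
  fixes w :: "real \<Rightarrow> real \<Rightarrow> real"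
  assumes cont: "continuous_on ({0..T} \<times> {-R..R}) (\<lambda>(s,x). w s x)"
    and heat: "\<And>s x. 0 < s \<Longrightarrow> s \<le> T \<Longrightarrow> -R < x \<Longrightarrow> x < R \<Longrightarrow> heat_at w s x"
    and init: "\<And>x. \<bar>x\<bar> \<le> R \<Longrightarrow> w 0 x \<le> C"
    and side: "\<And>s. 0 \<le> s \<Longrightarrow> s \<le> T \<Longrightarrow> w s R \<le> C \<and> w s (-R) \<le> C"
    and s: "0 \<le> s" "s \<le> T" and x: "\<bar>x\<bar> \<le> R"
  shows "w s x \<le> C"
proof (rule ccontr)
  assume "\<not> w s x \<le> C"
  hence pos: "w s x > C" by simp
  \<comment> \<open>The factor 1/2 keeps the maximum of the perturbed function above
    \<open>C\<close>; \<open>T + 1\<close> avoids a division by 0 when \<open>T = 0\<close>.\<close>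
  define \<eta> where "\<eta> = (w s x - C) / (2 * (T + 1))"
  have T: "0 \<le> T" using s by simp
  have \<eta>: "0 < \<eta>" using pos T by (simp add: \<eta>_def)
  have \<eta>T: "\<eta> * T < w s x - C"
  proof -
    have "\<eta> * T \<le> \<eta> * (T + 1)" using \<eta> by simp
    also have "\<dots> = (w s x - C) / 2" using T by (simp add: \<eta>_def field_simps)
    also have "\<dots> < w s x - C" using pos by simp
    finally show ?thesis .
  qed
  let ?B = "{0..T} \<times> {-R..R}"
  let ?g = "\<lambda>p. (case p of (s,x) \<Rightarrow> w s x) - \<eta> * fst p"
  have "compact ?B" by (intro compact_Times compact_Icc)
  moreover have "?B \<noteq> {}" using s x by auto
  moreover have "continuous_on ?B ?g" using cont by (intro continuous_intros) 
  ultimately obtain p where p: "p \<in> ?B" "\<And>q. q \<in> ?B \<Longrightarrow> ?g q \<le> ?g p"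
    using continuous_attains_sup[of ?B ?g] by blast
  obtain s0 x0 where p0: "p = (s0,x0)" by (cases p)
  have b: "0 \<le> s0" "s0 \<le> T" "-R \<le> x0" "x0 \<le> R" using p(1) p0 by auto
  have max: "w r z - \<eta> * r \<le> w s0 x0 - \<eta> * s0" if "0 \<le> r" "r \<le> T" "-R \<le> z" "z \<le> R" for r z
    using p(2)[of "(r,z)"] that p0 by auto
  have "w s x - \<eta> * s \<le> w s0 x0 - \<eta> * s0" using max s x by auto
  moreover have "\<eta> * s \<le> \<eta> * T" using \<eta> s by simp
  moreover have "0 \<le> \<eta> * s0" using \<eta> b by simp
  ultimately have gt: "w s0 x0 > C" using \<eta>T by linarith
  have "s0 \<noteq> 0" using init[of x0] gt b by (auto simp: abs_le_iff)
  hence s0: "0 < s0" using b by simp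
  have x0: "-R < x0" "x0 < R"
    using side[of s0] gt b by (metis less_eq_real_def not_le)+
  obtain w' D where w': "\<forall>z. (w s0 has_real_derivative w' z) (at z)"
     "(w' has_real_derivative D) (at x0)" "((\<lambda>r. w r x0) has_real_derivative D / 2) (at s0)"
    using heat[OF s0 b(2) x0] unfolding heat_at_def by blast
  have "D \<le> 0"
  proof (rule second_derivative_at_local_max)
    show "(w s0 has_real_derivative w' z) (at z)" for z using w'(1) by simp
    show "(w' has_real_derivative D) (at x0)" by fact
    show "0 < min (x0 + R) (R - x0)" using x0 by simp
    show "w s0 z \<le> w s0 x0" if "\<bar>x0 - z\<bar> < min (x0 + R) (R - x0)" for z
      using max[of s0 z] b that by auto
  qed
  hence neg: "D/2 - \<eta> < 0" using \<eta> by simp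
  have d: "((\<lambda>r. w r x0 - \<eta> * r) has_real_derivative D / 2 - \<eta>) (at s0)"
    using w'(3) by (auto intro!: derivative_eq_intros)
  \<comment> \<open>Only earlier times are compared, so a maximum at the final time
    \<open>s0 = T\<close> is covered.\<close>
  from DERIV_neg_dec_left[OF d neg] obtain e where e: "e > 0"
    "\<And>h. 0 < h \<Longrightarrow> h < e \<Longrightarrow> w s0 x0 - \<eta> * s0 < w (s0 - h) x0 - \<eta> * (s0 - h)" by blast
  define h where "h = min s0 e / 2"
  have h: "0 < h" "h < s0" "h < e" using s0 e by (auto simp: h_def)
  show False using e(2)[of h] max[of "s0 - h" x0] h b by auto
qed

text \<open>Up to a constant factor this is the heat kernel continued to the negative time
  \<open>s - \<tau>\<close>: still a solution, but growing like a Gaussian in \<open>x\<close> and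
  exploding as \<open>s\<close> approaches \<tau>.\<close>

definition heat_barrier :: "real \<Rightarrow> real \<Rightarrow> real \<Rightarrow> real" where
  "heat_barrier \<tau> s x = exp (x\<^sup>2 / (2 * (\<tau> - s))) / sqrt (\<tau> - s)"

lemma heat_at_barrier:
  assumes "s < \<tau>"
  shows "heat_at (heat_barrier \<tau>) s x"
proof -
  let ?c = "\<tau> - s"
  have c: "?c > 0" using assms by simp
  have 1: "(heat_barrier \<tau> s has_real_derivative z / ?c * heat_barrier \<tau> s z) (at z)" for z
  proof -
    have "((\<lambda>x. exp (x\<^sup>2 / (2 * ?c)) / sqrt ?c) has_real_derivative exp (z\<^sup>2 / (2 * ?c)) * (2 * z / (2 * ?c)) / sqrt ?c) (at z)"
      by (intro DERIV_cdivide DERIV_fun_exp) (auto intro!: derivative_eq_intros)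
    moreover have "2 * z / (2 * ?c) = z / ?c" by (rule mult_divide_mult_cancel_left) simp
    ultimately have "((\<lambda>x. exp (x\<^sup>2 / (2 * ?c)) / sqrt ?c) has_real_derivative exp (z\<^sup>2 / (2 * ?c)) * (z / ?c) / sqrt ?c) (at z)"
      by (simp only:)
    thus ?thesis unfolding heat_barrier_def by (simp only: mult.commute times_divide_eq_right times_divide_eq_left)
  qed
  moreover
  have "((\<lambda>z. z / ?c * heat_barrier \<tau> s z) has_real_derivative 1 / ?c * heat_barrier \<tau> s x + (x / ?c * heat_barrier \<tau> s x) * (x / ?c)) (at x)"
    by (intro DERIV_mult 1 DERIV_cdivide DERIV_ident)
  hence "((\<lambda>z. z / ?c * heat_barrier \<tau> s z) has_real_derivative (1 / ?c + x\<^sup>2 / ?c\<^sup>2) * heat_barrier \<tau> s x) (at x)"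
    by (simp add: algebra_simps power2_eq_square)
  moreover have "((\<lambda>r. heat_barrier \<tau> r x) has_real_derivative ((1 / ?c + x\<^sup>2 / ?c\<^sup>2) * heat_barrier \<tau> s x) / 2) (at s)"
  proof -
    have sq: "sqrt ?c * sqrt ?c = ?c" using c by simp
    have "((\<lambda>r. heat_barrier \<tau> r x) has_real_derivative
      ((exp (x\<^sup>2 / (2 * ?c)) * (x\<^sup>2 * 2 / (2 * ?c)\<^sup>2)) * sqrt ?c - exp (x\<^sup>2 / (2 * ?c)) * (- (inverse (sqrt ?c) / 2))) / (sqrt ?c * sqrt ?c)) (at s)"
      unfolding heat_barrier_def
      apply (rule DERIV_divide)
      subgoal using c by (auto intro!: derivative_eq_intros simp: power2_eq_square)
      subgoal using c by (auto intro!: derivative_eq_intros)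
      subgoal using c by simp
      done
    moreover have "((exp (x\<^sup>2 / (2 * ?c)) * (x\<^sup>2 * 2 / (2 * ?c)\<^sup>2)) * sqrt ?c - exp (x\<^sup>2 / (2 * ?c)) * (- (inverse (sqrt ?c) / 2))) / (sqrt ?c * sqrt ?c)
      = ((1 / ?c + x\<^sup>2 / ?c\<^sup>2) * heat_barrier \<tau> s x) / 2"
    proof -
      define q where "q = sqrt ?c"
      have q: "q > 0" "?c = q\<^sup>2" using c by (auto simp: q_def)
      show ?thesis unfolding heat_barrier_def q_def[symmetric] unfolding q(2) 
        using q(1) by (simp add: divide_simps) (simp add: eval_nat_numeral algebra_simps)
    qed
    ultimately show ?thesis by (simp only:)
  qed
  ultimately show ?thesis by (rule heat_atI)
qed

lemma heat_barrier_nonneg: "s < \<tau> \<Longrightarrow> 0 \<le> heat_barrier \<tau> s x"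
  by (simp add: heat_barrier_def)

lemma heat_barrier_even: "heat_barrier \<tau> s (- x) = heat_barrier \<tau> s x"
  by (simp add: heat_barrier_def)

lemma continuous_on_heat_barrier:
  assumes "T < \<tau>"
  shows "continuous_on ({0..T} \<times> X) (\<lambda>(s,x). heat_barrier \<tau> s x)"
  unfolding heat_barrier_def case_prod_unfold using assms
  by (intro continuous_intros) auto


section \<open>The heat semigroup\<close>

text \<open>Integrating over a standard normal variable instead of the kernel of variance
  \<open>s\<close> keeps the formula meaningful at \<open>s = 0\<close>, where it returns
  \<open>f\<close>, and makes joint continuity there a matter of dominated convergence.\<close>

definition heat :: "(real \<Rightarrow> real) \<Rightarrow> real \<Rightarrow> real \<Rightarrow> real" where
  "heat f s x = (\<integral>z. f (x - sqrt s * z) * std_normal_density z \<partial>lborel)"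

text \<open>An extended-valued version for non-negative unbounded data, whose integrability is a
  conclusion of the comparison below and not a hypothesis.\<close>

definition heat_nn :: "(real \<Rightarrow> real) \<Rightarrow> real \<Rightarrow> real \<Rightarrow> ennreal" where
  "heat_nn f s x = (\<integral>\<^sup>+z. ennreal (f (x - sqrt s * z) * std_normal_density z) \<partial>lborel)"

lemma integrable_std_normal_density: "integrable lborel std_normal_density"
  by (rule integrable_normal_density) simp

lemma heat_integrable:
  assumes [measurable]: "f \<in> borel_measurable borel" and B: "\<And>z. \<bar>f z\<bar> \<le> B"
  shows "integrable lborel (\<lambda>z. f (x - sqrt s * z) * std_normal_density z)"
proof (rule Bochner_Integration.integrable_bound)
  show "integrable lborel (\<lambda>z. B * std_normal_density z)"
    using integrable_std_normal_density by simp
  show "AE z in lborel. norm (f (x - sqrt s * z) * std_normal_density z) \<le> norm (B * std_normal_density z)"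
    using B by (intro AE_I2) (auto simp: abs_mult intro!: mult_mono order_trans[OF B abs_ge_self])
qed measurable

lemma heat_nn_eq_heat:
  assumes f: "f \<in> borel_measurable borel" "\<And>z. 0 \<le> f z" "\<And>z. f z \<le> B"
  shows "heat_nn f s x = ennreal (heat f s x)"
  unfolding heat_nn_def heat_def
  by (rule nn_integral_eq_integral[OF heat_integrable[where B=B]]) (use f in auto)

lemma heat_nonneg: "(\<And>z. 0 \<le> f z) \<Longrightarrow> 0 \<le> heat f s x"
  unfolding heat_def by (intro Bochner_Integration.integral_nonneg) auto

lemma heat_le:
  assumes f: "f \<in> borel_measurable borel" "\<And>z. 0 \<le> f z" "\<And>z. f z \<le> B"
  shows "heat f s x \<le> B"
proof -
  have "heat f s x \<le> (\<integral>z. B * std_normal_density z \<partial>lborel)"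
    unfolding heat_def
    by (rule integral_mono[OF heat_integrable[where B=B]])
       (use f integrable_std_normal_density in \<open>auto intro!: mult_right_mono\<close>)
  also have "\<dots> = B" by (simp add: integral_normal_density)
  finally show ?thesis .
qed

lemma heat_0: "heat f 0 x = f x"
  unfolding heat_def by (simp add: integral_normal_density)

lemma normal_density_affine:
  assumes "0 < \<sigma>"
  shows "\<sigma> * normal_density x \<sigma> (x + (- \<sigma>) * z) = std_normal_density z"
  using assms by (simp add: normal_density_def real_sqrt_mult power_mult_distrib field_simps)

lemma normal_density_swap: "normal_density x \<sigma> z = normal_density z \<sigma> x"
  by (simp add: normal_density_def power2_commute)

lemma heat_nn_density:
  assumes s: "0 < s" and [measurable]: "f \<in> borel_measurable borel"
  shows "heat_nn f s x = (\<integral>\<^sup>+z. ennreal (f z * normal_density x (sqrt s) z) \<partial>lborel)"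
proof -
  have "(\<integral>\<^sup>+z. ennreal (f z * normal_density x (sqrt s) z) \<partial>lborel)
    = ennreal \<bar>- sqrt s\<bar> * (\<integral>\<^sup>+z. ennreal (f (x + (- sqrt s) * z) * normal_density x (sqrt s) (x + (- sqrt s) * z)) \<partial>lborel)"
    by (rule nn_integral_real_affine) (use s in auto)
  also have "\<dots> = (\<integral>\<^sup>+z. ennreal \<bar>- sqrt s\<bar> * ennreal (f (x + (- sqrt s) * z) * normal_density x (sqrt s) (x + (- sqrt s) * z)) \<partial>lborel)"
    by (rule nn_integral_cmult[symmetric]) measurable
  also have "\<dots> = heat_nn f s x"
    unfolding heat_nn_def
  proof (rule nn_integral_cong)
    fix z :: real
    have "sqrt s * (f (x + (- sqrt s) * z) * normal_density x (sqrt s) (x + (- sqrt s) * z)) = f (x - sqrt s * z) * std_normal_density z"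
      using normal_density_affine[of "sqrt s" x z] s by (simp add: mult.left_commute)
    thus "ennreal \<bar>- sqrt s\<bar> * ennreal (f (x + (- sqrt s) * z) * normal_density x (sqrt s) (x + (- sqrt s) * z)) = ennreal (f (x - sqrt s * z) * std_normal_density z)"
      using s by (simp only: ennreal_mult'[symmetric] abs_minus_cancel abs_of_pos real_sqrt_gt_zero real_sqrt_ge_zero less_imp_le abs_ge_zero)
  qed
  finally show ?thesis by simp
qed

lemma heat_density:
  assumes s: "0 < s"
  shows "heat f s x = (\<integral>z. f z * normal_density x (sqrt s) z \<partial>lborel)"
proof -
  have "(\<integral>z. f z * normal_density x (sqrt s) z \<partial>lborel)
    = \<bar>- sqrt s\<bar> *\<^sub>R (\<integral>z. f (x + (- sqrt s) * z) * normal_density x (sqrt s) (x + (- sqrt s) * z) \<partial>lborel)"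
    by (rule lborel_integral_real_affine) (use s in auto)
  also have "\<dots> = (\<integral>z. sqrt s * (f (x + (- sqrt s) * z) * normal_density x (sqrt s) (x + (- sqrt s) * z)) \<partial>lborel)"
    using s by simp
  also have "\<dots> = heat f s x"
    unfolding heat_def
    using normal_density_affine[of "sqrt s" x] s by (intro Bochner_Integration.integral_cong) (auto simp: mult.left_commute)
  finally show ?thesis by simp
qed

text \<open>Dominated convergence with majorant \<open>B * std_normal_density\<close>. The case
  \<open>s = 0\<close> matters: it supplies the initial face of the box in the maximum principle and
  later the end point of the stopping argument.\<close>

lemma continuous_on_heat:
  fixes f :: "real \<Rightarrow> real"
  assumes f: "continuous_on UNIV f" and B: "\<And>z. \<bar>f z\<bar> \<le> B"
  shows "continuous_on A (\<lambda>(s,x). heat f s x)"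
proof -
  have [measurable]: "f \<in> borel_measurable borel" using f by (rule borel_measurable_continuous_onI)
  have "continuous_on UNIV (\<lambda>p. heat f (fst p) (snd p))"
    unfolding continuous_on_sequentially comp_def
  proof (intro ballI allI impI, elim conjE)
    fix p :: "nat \<Rightarrow> real \<times> real" and q assume lim: "p \<longlonglongrightarrow> q"
    show "(\<lambda>n. heat f (fst (p n)) (snd (p n))) \<longlonglongrightarrow> heat f (fst q) (snd q)"
      unfolding heat_def
    proof (rule integral_dominated_convergence[where w="\<lambda>z. B * std_normal_density z"])
      show "integrable lborel (\<lambda>z. B * std_normal_density z)"
        using integrable_std_normal_density by simp
      show "AE z in lborel. (\<lambda>n. f (snd (p n) - sqrt (fst (p n)) * z) * std_normal_density z) \<longlonglongrightarrow> f (snd q - sqrt (fst q) * z) * std_normal_density z"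
      proof (intro AE_I2 tendsto_mult tendsto_const)
        fix z :: real
        have "isCont f (snd q - sqrt (fst q) * z)" using f by (simp add: continuous_on_eq_continuous_at)
        thus "(\<lambda>n. f (snd (p n) - sqrt (fst (p n)) * z)) \<longlonglongrightarrow> f (snd q - sqrt (fst q) * z)"
          by (rule isCont_tendsto_compose) (intro tendsto_intros lim)
      qed
      show "AE z in lborel. norm (f (snd (p n) - sqrt (fst (p n)) * z) * std_normal_density z) \<le> B * std_normal_density z" for n
        using B by (intro AE_I2) (auto simp: abs_mult intro!: mult_right_mono)
    qed measurable
  qed
  thus ?thesis by (auto simp: case_prod_unfold intro: continuous_on_subset)
qed

lemma heat_kernel_derivs:
  fixes s x z :: real
  assumes s: "0 < s"
  shows "((\<lambda>x. normal_density z (sqrt s) x) has_real_derivative - (x - z) / s * normal_density z (sqrt s) x) (at x)"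
    and "((\<lambda>x. - (x - z) / s * normal_density z (sqrt s) x) has_real_derivative ((x - z)\<^sup>2 / s\<^sup>2 - 1 / s) * normal_density z (sqrt s) x) (at x)"
    and "((\<lambda>s. normal_density z (sqrt s) x) has_real_derivative ((x - z)\<^sup>2 / s\<^sup>2 - 1 / s) / 2 * normal_density z (sqrt s) x) (at s)"
proof -
  show 1: "((\<lambda>x. normal_density z (sqrt s) x) has_real_derivative - (x - z) / s * normal_density z (sqrt s) x) (at x)" for x
  proof -
    have "((\<lambda>x. 1 / sqrt (2 * pi * s) * exp (- (x - z)\<^sup>2 / (2 * s))) has_real_derivative
        1 / sqrt (2 * pi * s) * (exp (- (x - z)\<^sup>2 / (2 * s)) * (- (x - z) / s))) (at x)"
      by (intro DERIV_cmult DERIV_fun_exp) (use s in \<open>auto intro!: derivative_eq_intros simp: field_simps\<close>)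
    thus ?thesis using s by (simp add: normal_density_def mult_ac)
  qed
  have "((\<lambda>x. - (x - z) / s * normal_density z (sqrt s) x) has_real_derivative
     (- 1 / s) * normal_density z (sqrt s) x + (- (x - z) / s * normal_density z (sqrt s) x) * (- (x - z) / s)) (at x)"
    by (intro DERIV_mult 1) (use s in \<open>auto intro!: derivative_eq_intros simp: field_simps\<close>)
  thus "((\<lambda>x. - (x - z) / s * normal_density z (sqrt s) x) has_real_derivative ((x - z)\<^sup>2 / s\<^sup>2 - 1 / s) * normal_density z (sqrt s) x) (at x)"
    by (rule back_subst[where P="\<lambda>D. (_ has_real_derivative D) _"]) (simp add: algebra_simps power2_eq_square diff_divide_distrib add_divide_distrib)
  have "((\<lambda>s. exp (- (x - z)\<^sup>2 / (2 * s)) / sqrt (2 * pi * s)) has_real_derivative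
      ((exp (- (x - z)\<^sup>2 / (2 * s)) * ((x - z)\<^sup>2 / (2 * s\<^sup>2))) * sqrt (2 * pi * s) - exp (- (x - z)\<^sup>2 / (2 * s)) * (pi * inverse (sqrt (2 * pi * s)))) / (sqrt (2 * pi * s) * sqrt (2 * pi * s))) (at s)"
    apply (rule DERIV_divide)
    subgoal by (intro DERIV_fun_exp) (use s in \<open>auto intro!: derivative_eq_intros simp: field_simps power2_eq_square\<close>)
    subgoal using mult_pos_pos[OF pi_gt_zero s] by (auto intro!: derivative_eq_intros simp: field_simps)
    subgoal using s by simp
    done
  moreover have "((exp (- (x - z)\<^sup>2 / (2 * s)) * ((x - z)\<^sup>2 / (2 * s\<^sup>2))) * sqrt (2 * pi * s) - exp (- (x - z)\<^sup>2 / (2 * s)) * (pi * inverse (sqrt (2 * pi * s)))) / (sqrt (2 * pi * s) * sqrt (2 * pi * s))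
     = ((x - z)\<^sup>2 / s\<^sup>2 - 1 / s) / 2 * (exp (- (x - z)\<^sup>2 / (2 * s)) / sqrt (2 * pi * s))"
  proof -
    define E where "E = exp (- (x - z)\<^sup>2 / (2 * s))"
    define q where "q = sqrt (2 * pi * s)"
    have q: "q > 0" "q * q = 2 * pi * s" using s by (auto simp: q_def)
    have "(E * ((x - z)\<^sup>2 / (2 * s\<^sup>2)) * q - E * (pi * inverse q)) / (q * q) = E / q * ((x - z)\<^sup>2 / (2 * s\<^sup>2) - pi / (q * q))"
      using q(1) by (simp add: field_simps)
    also have "\<dots> = E / q * ((x - z)\<^sup>2 / (2 * s\<^sup>2) - 1 / (2 * s))" unfolding q(2) using s by simp
    also have "\<dots> = ((x - z)\<^sup>2 / s\<^sup>2 - 1 / s) / 2 * (E / q)" using s by (simp add: field_simps)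
    finally show ?thesis unfolding E_def q_def .
  qed
  ultimately have 3: "((\<lambda>s. exp (- (x - z)\<^sup>2 / (2 * s)) / sqrt (2 * pi * s)) has_real_derivative
      ((x - z)\<^sup>2 / s\<^sup>2 - 1 / s) / 2 * (exp (- (x - z)\<^sup>2 / (2 * s)) / sqrt (2 * pi * s))) (at s)" by simp
  show "((\<lambda>s. normal_density z (sqrt s) x) has_real_derivative ((x - z)\<^sup>2 / s\<^sup>2 - 1 / s) / 2 * normal_density z (sqrt s) x) (at s)"
  proof (rule has_field_derivative_transform_within_open[where S="{0<..}"])
    show "((\<lambda>s. exp (- (x - z)\<^sup>2 / (2 * s)) / sqrt (2 * pi * s)) has_real_derivative ((x - z)\<^sup>2 / s\<^sup>2 - 1 / s) / 2 * normal_density z (sqrt s) x) (at s)"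
      using 3 s by (simp add: normal_density_def)
  qed (use s in \<open>auto simp: normal_density_def\<close>)
qed

lemma continuous_on_normal_density:
  assumes "\<And>p. p \<in> A \<Longrightarrow> 0 < c p" "continuous_on A a" "continuous_on A c" "continuous_on A g"
  shows "continuous_on A (\<lambda>p. normal_density (a p) (sqrt (c p)) (g p))"
  unfolding normal_density_def using assms
  by (intro continuous_intros) (force simp: less_imp_neq)+

text \<open>Compact support turns the convolution into an integral over a fixed compact interval,
  where the Leibniz rule needs only continuity of the differentiated integrand. Unbounded data are
  reached later by cutting off.\<close>

lemma heat_at_heat:
  fixes f :: "real \<Rightarrow> real"
  assumes f: "continuous_on UNIV f" and supp: "\<And>z. R < \<bar>z\<bar> \<Longrightarrow> f z = 0" and s: "0 < s"
  shows "heat_at (heat f) s x"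
proof -
  let ?k = "\<lambda>s x z. normal_density z (sqrt s) x"
  have f': "continuous_on A f" for A using f by (rule continuous_on_subset) simp
  have f2: "continuous_on A (\<lambda>p. f (snd p))" for A :: "(real \<times> real) set"
    by (intro continuous_on_compose2[OF f]) (auto intro!: continuous_intros)
  have eq: "heat f r y = integral (cbox (-R) R) (\<lambda>z. f z * ?k r y z)" if "0 < r" for r y
  proof -
    have "heat f r y = (\<integral>z. f z * ?k r y z \<partial>lborel)"
      unfolding heat_density[OF that] by (simp add: normal_density_swap)
    also have "\<dots> = (LINT z:cbox (-R) R|lborel. f z * ?k r y z)"
      unfolding set_lebesgue_integral_def
    proof (intro Bochner_Integration.integral_cong refl)
      show "f z * ?k r y z = indicator (cbox (-R) R) z *\<^sub>R (f z * ?k r y z)" for z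
        using supp[of z] by (cases "R < \<bar>z\<bar>") (auto simp: indicator_def)
    qed
    also have "\<dots> = integral (cbox (-R) R) (\<lambda>z. f z * ?k r y z)"
    proof (intro set_borel_integral_eq_integral(2))
      show "set_integrable lborel (cbox (-R) R) (\<lambda>z. f z * ?k r y z)"
        unfolding set_integrable_def
        by (rule borel_integrable_compact) (use that in \<open>auto intro!: continuous_intros f' continuous_on_normal_density\<close>)
    qed
    finally show ?thesis .
  qed
  note ci = continuous_intros f' f2 continuous_on_normal_density
  have int: "(\<lambda>z. f z * (g z * ?k r y z)) integrable_on cbox (-R) R" if "0 < r" "continuous_on UNIV g" for r y g
    using that by (intro integrable_continuous continuous_intros f' continuous_on_normal_density)
      (auto intro: continuous_on_subset)
  show ?thesis
  proof (rule heat_atI)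
    fix z :: real
    have "((\<lambda>y. integral (cbox (-R) R) (\<lambda>w. f w * ?k s y w)) has_real_derivative
        integral (cbox (-R) R) (\<lambda>w. f w * (- (z - w) / s * ?k s z w))) (at z within UNIV)"
    proof (rule leibniz_rule_field_derivative)
      show "((\<lambda>y. f w * ?k s y w) has_real_derivative f w * (- (y - w) / s * ?k s y w)) (at y)" for y w
        by (intro DERIV_cmult heat_kernel_derivs s)
      show "(\<lambda>w. f w * ?k s y w) integrable_on cbox (-R) R" for y
        using int[OF s, of "\<lambda>_. 1"] by simp
      show "continuous_on (UNIV \<times> cbox (- R) R) (\<lambda>(y, w). f w * (- (y - w) / s * ?k s y w))"
        unfolding case_prod_unfold by (intro ci) (use s in auto)
    qed auto
    moreover have "heat f s = (\<lambda>y. integral (cbox (-R) R) (\<lambda>w. f w * ?k s y w))"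
      using eq[OF s] by blast
    ultimately show "(heat f s has_real_derivative integral (cbox (-R) R) (\<lambda>w. f w * (- (z - w) / s * ?k s z w))) (at z)"
      by simp
  next
    show "((\<lambda>z. integral (cbox (-R) R) (\<lambda>w. f w * (- (z - w) / s * ?k s z w))) has_real_derivative
        integral (cbox (-R) R) (\<lambda>w. f w * (((x - w)\<^sup>2 / s\<^sup>2 - 1 / s) * ?k s x w))) (at x)"
    proof (rule leibniz_rule_field_derivative[where U=UNIV])
      show "((\<lambda>y. f w * (- (y - w) / s * ?k s y w)) has_real_derivative f w * (((y - w)\<^sup>2 / s\<^sup>2 - 1 / s) * ?k s y w)) (at y)" for y w
        by (intro DERIV_cmult heat_kernel_derivs s)
      show "(\<lambda>w. f w * (- (y - w) / s * ?k s y w)) integrable_on cbox (-R) R" for y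
        by (intro int s continuous_intros) (use s in auto)
      show "continuous_on (UNIV \<times> cbox (- R) R) (\<lambda>(y, w). f w * (((y - w)\<^sup>2 / s\<^sup>2 - 1 / s) * ?k s y w))"
        unfolding case_prod_unfold by (intro ci) (use s in auto)
    qed auto
  next
    have "((\<lambda>r. integral (cbox (-R) R) (\<lambda>w. f w * ?k r x w)) has_real_derivative
        integral (cbox (-R) R) (\<lambda>w. f w * (((x - w)\<^sup>2 / s\<^sup>2 - 1 / s) / 2 * ?k s x w))) (at s within {0<..})"
    proof (rule leibniz_rule_field_derivative)
      show "((\<lambda>r. f w * ?k r x w) has_real_derivative f w * (((x - w)\<^sup>2 / r\<^sup>2 - 1 / r) / 2 * ?k r x w)) (at r within {0<..})"
        if "r \<in> {0<..}" for r w
        by (intro DERIV_cmult has_field_derivative_at_within[OF heat_kernel_derivs(3)]) (use that in auto)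
      show "(\<lambda>w. f w * ?k r x w) integrable_on cbox (-R) R" if "r \<in> {0<..}" for r
        using int[of r "\<lambda>_. 1"] that by simp
      show "continuous_on ({0<..} \<times> cbox (- R) R) (\<lambda>(r, w). f w * (((x - w)\<^sup>2 / r\<^sup>2 - 1 / r) / 2 * ?k r x w))"
        unfolding case_prod_unfold by (intro ci) auto
    qed (use s in auto)
    moreover have "integral (cbox (-R) R) (\<lambda>w. f w * (((x - w)\<^sup>2 / s\<^sup>2 - 1 / s) / 2 * ?k s x w))
      = integral (cbox (-R) R) (\<lambda>w. f w * (((x - w)\<^sup>2 / s\<^sup>2 - 1 / s) * ?k s x w)) / 2"
      by (subst integral_divide[symmetric]) (simp only: times_divide_eq_left times_divide_eq_right)
    ultimately have "((\<lambda>r. integral (cbox (-R) R) (\<lambda>w. f w * ?k r x w)) has_real_derivative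
        integral (cbox (-R) R) (\<lambda>w. f w * (((x - w)\<^sup>2 / s\<^sup>2 - 1 / s) * ?k s x w)) / 2) (at s)"
      using s by (simp only: at_within_open[of s "{0<..}"] greaterThan_iff open_greaterThan)
    thus "((\<lambda>r. heat f r x) has_real_derivative integral (cbox (-R) R) (\<lambda>w. f w * (((x - w)\<^sup>2 / s\<^sup>2 - 1 / s) * ?k s x w)) / 2) (at s)"
      by (rule has_field_derivative_transform_within_open[where S="{0<..}"]) (use s eq in auto)
  qed
qed


section \<open>Non-negative solutions\<close>

text \<open>The time interval is closed so that boxes are compact. Initial values are attained
  continuously but the equation is asked only for \<open>s > 0\<close>; at \<open>s = T\<close> the
  time derivative is still two-sided.\<close>

definition positive_caloric :: "real \<Rightarrow> (real \<Rightarrow> real \<Rightarrow> real) \<Rightarrow> bool" where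
  "positive_caloric T v \<longleftrightarrow> continuous_on ({0..T} \<times> UNIV) (\<lambda>(s,x). v s x) \<and>
     (\<forall>s x. 0 \<le> s \<longrightarrow> s \<le> T \<longrightarrow> 0 \<le> v s x) \<and>
     (\<forall>s x. 0 < s \<longrightarrow> s \<le> T \<longrightarrow> heat_at v s x)"

lemma positive_caloric_continuous:
  assumes "positive_caloric T v" "0 \<le> s" "s \<le> T"
  shows "continuous_on A (v s)"
proof -
  have "continuous_on ({0..T} \<times> UNIV) (\<lambda>(s,x). v s x)" using assms by (simp add: positive_caloric_def)
  hence "continuous_on A (\<lambda>x. (\<lambda>(s,x). v s x) (s,x))"
    by (rule continuous_on_compose2) (use assms in \<open>auto intro!: continuous_intros\<close>)
  thus ?thesis by simp
qed

lemma positive_caloric_measurable: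
  assumes "positive_caloric T v" "0 \<le> s" "s \<le> T"
  shows "v s \<in> borel_measurable borel"
  using positive_caloric_continuous[OF assms] by (rule borel_measurable_continuous_onI)

lemma positive_caloric_shift:
  assumes v: "positive_caloric T v" and a: "0 \<le> a" "a \<le> T"
  shows "positive_caloric (T - a) (\<lambda>s. v (s + a))"
proof -
  have "continuous_on ({0..T} \<times> UNIV) (\<lambda>(s,x). v s x)" using v by (simp add: positive_caloric_def)
  hence "continuous_on ({0..T-a} \<times> UNIV) (\<lambda>p. (\<lambda>(s,x). v s x) (fst p + a, snd p))"
    by (rule continuous_on_compose2) (use a in \<open>auto intro!: continuous_intros\<close>)
  moreover have "heat_at (\<lambda>s. v (s + a)) s x" if "0 < s" "s \<le> T - a" for s x
    using heat_at_translate[of v s a x 0] v that a by (simp add: positive_caloric_def)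
  ultimately show ?thesis using v a by (simp add: positive_caloric_def case_prod_unfold)
qed

definition cutoff :: "real \<Rightarrow> real \<Rightarrow> real" where
  "cutoff R x = max 0 (min 1 (R + 1 - \<bar>x\<bar>))"

lemma cutoff_props:
  "0 \<le> cutoff R x" "cutoff R x \<le> 1" "\<bar>x\<bar> \<le> R \<Longrightarrow> cutoff R x = 1" "R + 1 < \<bar>x\<bar> \<Longrightarrow> cutoff R x = 0"
  "R \<le> R' \<Longrightarrow> cutoff R x \<le> cutoff R' x"
  by (auto simp: cutoff_def)

lemma continuous_on_cutoff: "continuous_on A (cutoff R)"
  unfolding cutoff_def by (intro continuous_intros)

lemma continuous_compact_support_bounded:
  fixes f :: "real \<Rightarrow> real"
  assumes f: "continuous_on UNIV f" and supp: "\<And>z. R < \<bar>z\<bar> \<Longrightarrow> f z = 0"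
  obtains M where "0 < M" "\<And>z. \<bar>f z\<bar> \<le> M"
proof -
  have "bounded (f ` {-R..R})"
    by (intro compact_imp_bounded compact_continuous_image continuous_on_subset[OF f] compact_Icc) auto
  then obtain M where M: "M > 0" "\<And>y. y \<in> f ` {-R..R} \<Longrightarrow> norm y \<le> M"
    by (auto simp: bounded_pos)
  have "\<bar>f z\<bar> \<le> M" for z
  proof (cases "R < \<bar>z\<bar>")
    case False
    hence "z \<in> {-R..R}" by auto
    thus ?thesis using M(2)[of "f z"] by simp
  qed (use M supp in auto)
  thus ?thesis using that M by blast
qed

text \<open>The linear term is there because the growth bound for averages contains
  \<open>(R + 1)\<^sup>2\<close>.\<close>

lemma gaussian_decay:
  fixes c d :: real
  assumes "0 < c"
  shows "((\<lambda>R. exp (d * R - c * R\<^sup>2)) \<longlongrightarrow> 0) at_top"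
proof -
  have "filterlim (\<lambda>R. (c * R - d) * R) at_top at_top"
    by (rule filterlim_at_top_mult_at_top)
       (use assms in \<open>auto intro!: filterlim_tendsto_add_at_top[OF tendsto_const, of _ _ "-d", simplified] filterlim_tendsto_pos_mult_at_top[OF tendsto_const] filterlim_ident\<close>)
  hence "filterlim (\<lambda>R. - ((c * R - d) * R)) at_bot at_top"
    by (simp add: filterlim_uminus_at_top)
  hence "((\<lambda>R. exp (- ((c * R - d) * R))) \<longlongrightarrow> 0) at_top"
    by (rule filterlim_compose[OF exp_at_bot])
  thus ?thesis by (simp add: algebra_simps power2_eq_square)
qed

text \<open>On the sides of the box \<open>heat f\<close> is at most \<open>M\<close>, and
  \<open>v\<close> is simply discarded by its sign. A barrier multiple that exceeds \<open>M\<close>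
  at \<open>x = R\<close> but tends to 0 at every fixed \<open>x\<close> finishes the comparison as
  \<open>R\<close> grows.\<close>

lemma heat_le_positive_caloric:
  assumes v: "positive_caloric T v" and T: "0 < T"
    and f: "continuous_on UNIV f" "\<And>z. R0 < \<bar>z\<bar> \<Longrightarrow> f z = 0" "\<And>z. 0 \<le> f z" "\<And>z. f z \<le> v 0 z"
  shows "heat f T x \<le> v T x"
proof -
  obtain M where M: "0 < M" "\<And>z. \<bar>f z\<bar> \<le> M" using continuous_compact_support_bounded[OF f(1,2)] by blast
  have meas: "f \<in> borel_measurable borel" using f(1) by (rule borel_measurable_continuous_onI)
  define G where "G = heat_barrier (T + 1)"
  \<comment> \<open>This is \<open>M / G 0 R\<close>. Since \<open>G s R\<close> increases with
    \<open>s\<close>, \<open>\<eta> R * G s R\<close> is at least \<open>M\<close> at all times. The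
    summand \<open>0 * R\<close> only fits the shape of \<open>gaussian_decay\<close>.\<close>
  define \<eta> where "\<eta> = (\<lambda>R. M * sqrt (T + 1) * exp (0 * R - 1 / (2 * (T + 1)) * R\<^sup>2))"
  have fin: "heat f T x - v T x - \<eta> R * G T x \<le> 0" if R: "\<bar>x\<bar> \<le> R" for R
  proof (rule heat_max_principle[where w="\<lambda>s x. heat f s x - v s x - \<eta> R * G s x" and R=R and T=T])
    have cv: "continuous_on ({0..T} \<times> {-R..R}) (\<lambda>(s,x). v s x)"
      using v unfolding positive_caloric_def by (auto elim: continuous_on_subset)
    have "continuous_on ({0..T} \<times> {-R..R}) (\<lambda>p. (\<lambda>(s,x). heat f s x) p - (\<lambda>(s,x). v s x) p - \<eta> R * (\<lambda>(s,x). G s x) p)"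
      unfolding G_def
      by (intro continuous_on_diff continuous_on_mult continuous_on_const cv continuous_on_heat[OF f(1) M(2)] continuous_on_heat_barrier) simp
    thus "continuous_on ({0..T} \<times> {-R..R}) (\<lambda>(s, x). heat f s x - v s x - \<eta> R * G s x)"
      by (simp add: case_prod_unfold)
    show "heat_at (\<lambda>s x. heat f s x - v s x - \<eta> R * G s x) s x" if "0 < s" "s \<le> T" for s x
      unfolding G_def
      by (intro heat_at_diff heat_at_cmult heat_at_heat[OF f(1,2)] heat_at_barrier)
         (use v that in \<open>auto simp: positive_caloric_def\<close>)
    have \<eta>0: "0 \<le> \<eta> R" using M T by (simp add: \<eta>_def)
    show "heat f 0 x - v 0 x - \<eta> R * G 0 x \<le> 0" for x
      using f(4)[of x] mult_nonneg_nonneg[OF \<eta>0 heat_barrier_nonneg[of 0 "T+1" x]] T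
      unfolding heat_0 G_def by linarith
    show "heat f s R - v s R - \<eta> R * G s R \<le> 0 \<and> heat f s (- R) - v s (- R) - \<eta> R * G s (- R) \<le> 0"
      if "0 \<le> s" "s \<le> T" for s
    proof -
      have le: "heat f s z \<le> M" for z using heat_le[OF meas f(3), of M] M(2) by (meson abs_le_D1)
      have v0: "0 \<le> v s z" for z using v that by (auto simp: positive_caloric_def)
      have "M \<le> \<eta> R * G s R"
      proof -
        have "1 = exp (0 * R - 1 / (2 * (T + 1)) * R\<^sup>2) * exp (R\<^sup>2 / (2 * (T + 1)))"
          by (simp add: exp_add[symmetric])
        also have "\<dots> \<le> exp (0 * R - 1 / (2 * (T + 1)) * R\<^sup>2) * exp (R\<^sup>2 / (2 * (T + 1 - s)))"
          using that by (intro mult_left_mono) (auto intro!: divide_left_mono)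
        also have "\<dots> \<le> exp (0 * R - 1 / (2 * (T + 1)) * R\<^sup>2) * exp (R\<^sup>2 / (2 * (T + 1 - s))) * (sqrt (T + 1) / sqrt (T + 1 - s))"
        proof -
          have "1 \<le> sqrt (T + 1) / sqrt (T + 1 - s)" using that T by simp
          thus ?thesis by (metis exp_ge_zero mult_left_mono mult.right_neutral mult_nonneg_nonneg)
        qed
        finally have "M * 1 \<le> M * (exp (0 * R - 1 / (2 * (T + 1)) * R\<^sup>2) * exp (R\<^sup>2 / (2 * (T + 1 - s))) * (sqrt (T + 1) / sqrt (T + 1 - s)))"
          using M by (intro mult_left_mono) auto
        thus ?thesis unfolding \<eta>_def G_def heat_barrier_def by (simp add: mult_ac)
      qed
      thus ?thesis using le[of R] le[of "-R"] v0[of R] v0[of "-R"] by (auto simp: G_def heat_barrier_even)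
    qed
  qed (use T R in auto)
  have "((\<lambda>R. heat f T x - v T x - \<eta> R * G T x) \<longlongrightarrow> heat f T x - v T x - (M * sqrt (T + 1) * 0) * G T x) at_top"
    unfolding \<eta>_def by (intro tendsto_intros gaussian_decay) (use T in auto)
  hence "heat f T x - v T x - (M * sqrt (T + 1) * 0) * G T x \<le> 0"
    by (rule tendsto_upperbound) (use fin in \<open>auto simp: eventually_at_top_linorder intro!: exI[of _ "\<bar>x\<bar>"]\<close>)
  thus ?thesis by simp
qed

lemma heat_nn_mono:
  "(\<And>z. f z \<le> g z) \<Longrightarrow> heat_nn f s x \<le> heat_nn g s x"
  unfolding heat_nn_def by (intro nn_integral_mono ennreal_leI mult_right_mono) auto

lemma heat_nn_SUP:
  fixes f :: "nat \<Rightarrow> real \<Rightarrow> real"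
  assumes [measurable]: "\<And>n. f n \<in> borel_measurable borel"
    and mono: "\<And>n z. f n z \<le> f (Suc n) z" and lim: "\<And>z. (\<lambda>n. f n z) \<longlonglongrightarrow> g z"
  shows "heat_nn g s x = (SUP n. heat_nn (f n) s x)"
proof -
  have "heat_nn g s x = (\<integral>\<^sup>+z. (SUP n. ennreal (f n (x - sqrt s * z) * std_normal_density z)) \<partial>lborel)"
    unfolding heat_nn_def
  proof (intro nn_integral_cong)
    fix z :: real
    have "(\<lambda>n. ennreal (f n (x - sqrt s * z) * std_normal_density z)) \<longlonglongrightarrow> ennreal (g (x - sqrt s * z) * std_normal_density z)"
      by (intro tendsto_intros lim)
    moreover have "(\<lambda>n. ennreal (f n (x - sqrt s * z) * std_normal_density z)) \<longlonglongrightarrow> (SUP n. ennreal (f n (x - sqrt s * z) * std_normal_density z))"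
      by (intro LIMSEQ_SUP incseq_SucI ennreal_leI mult_right_mono mono) auto
    ultimately show "ennreal (g (x - sqrt s * z) * std_normal_density z) = (SUP n. ennreal (f n (x - sqrt s * z) * std_normal_density z))"
      by (rule LIMSEQ_unique)
  qed
  also have "\<dots> = (SUP n. heat_nn (f n) s x)"
    unfolding heat_nn_def
    by (intro nn_integral_monotone_convergence_SUP incseq_SucI le_funI ennreal_leI mult_right_mono mono) auto
  finally show ?thesis .
qed

text \<open>Monotone convergence over cutoffs of \<open>v 0\<close>. The finiteness of the left side
  is the growth information on which everything below rests.\<close>

lemma positive_caloric_lower:
  assumes v: "positive_caloric T v" and T: "0 < T"
  shows "heat_nn (v 0) T x \<le> ennreal (v T x)"
proof -
  have [measurable]: "v 0 \<in> borel_measurable borel" using positive_caloric_measurable[OF v] T by simp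
  have [measurable]: "cutoff n \<in> borel_measurable borel" for n
    by (rule borel_measurable_continuous_onI[OF continuous_on_cutoff])
  have v0: "0 \<le> v 0 z" for z using v T by (auto simp: positive_caloric_def)
  have "heat_nn (v 0) T x = (SUP n. heat_nn (\<lambda>z. v 0 z * cutoff (real n) z) T x)"
  proof (rule heat_nn_SUP)
    show "v 0 z * cutoff (real n) z \<le> v 0 z * cutoff (real (Suc n)) z" for n z
      by (intro mult_left_mono v0 cutoff_props) simp
    have "eventually (\<lambda>n. cutoff (real n) z = 1) sequentially" for z
      using eventually_ge_at_top[of "nat \<lceil>\<bar>z\<bar>\<rceil>"]
      by eventually_elim (simp add: cutoff_props(3) nat_ceiling_le_eq)
    hence "(\<lambda>n. cutoff (real n) z) \<longlonglongrightarrow> 1" for z by (rule tendsto_eventually)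
    thus "(\<lambda>n. v 0 z * cutoff (real n) z) \<longlonglongrightarrow> v 0 z" for z
      using tendsto_mult[OF tendsto_const, of "\<lambda>n. cutoff (real n) z" 1 sequentially "v 0 z"] by simp
  qed measurable
  also have "\<dots> \<le> ennreal (v T x)"
  proof (rule SUP_least)
    fix n :: nat
    let ?f = "\<lambda>z. v 0 z * cutoff (real n) z"
    have c: "continuous_on UNIV ?f"
      using positive_caloric_continuous[OF v, of 0] T by (intro continuous_on_mult continuous_on_cutoff) auto
    have s: "?f z = 0" if "real n + 1 < \<bar>z\<bar>" for z using cutoff_props(4) that by simp
    obtain M where M: "\<And>z. \<bar>?f z\<bar> \<le> M" using continuous_compact_support_bounded[OF c s] by blast
    have nn: "0 \<le> ?f z" for z using v0 cutoff_props by simp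
    have "heat_nn ?f T x = ennreal (heat ?f T x)"
      by (rule heat_nn_eq_heat[where B=M]) (use M nn in \<open>auto intro: order_trans[OF abs_ge_self]\<close>)
    also have "\<dots> \<le> ennreal (v T x)"
      by (intro ennreal_leI heat_le_positive_caloric[OF v T c s nn])
         (use v0 cutoff_props(2) in \<open>auto intro: mult_left_le\<close>)
    finally show "heat_nn ?f T x \<le> ennreal (v T x)" .
  qed
  finally show ?thesis .
qed


subsection \<open>Moving averages\<close>

text \<open>The error is stated through a bound on the oscillation, so that uniform continuity in
  both variables yields one \<open>n\<close> for all times and all points of a box.\<close>

lemma riemann_sum_error:
  fixes g :: "real \<Rightarrow> real"
  assumes g: "continuous_on {0..1} g" and n: "0 < n"
    and osc: "\<And>z z'. z \<in> {0..1} \<Longrightarrow> z' \<in> {0..1} \<Longrightarrow> \<bar>z - z'\<bar> \<le> 1 / real n \<Longrightarrow> \<bar>g z - g z'\<bar> \<le> e"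
  shows "\<bar>(\<Sum>i<n. 1 / real n * g (real i / real n)) - integral {0..1} g\<bar> \<le> e"
proof -
  have int: "g integrable_on {a..b}" if "0 \<le> a" "b \<le> 1" for a b
    using that by (intro integrable_continuous_real continuous_on_subset[OF g]) auto
  have "\<bar>(\<Sum>i<m. 1 / real n * g (real i / real n)) - integral {0..real m / real n} g\<bar> \<le> e * (real m / real n)" if "m \<le> n" for m
    using that
  proof (induction m)
    case 0
    show ?case by simp
  next
    case (Suc m)
    let ?a = "real m / real n" and ?b = "real (Suc m) / real n"
    have ab: "0 \<le> ?a" "?a \<le> ?b" "?b \<le> 1" "?b - ?a = 1 / real n" using Suc.prems n by (auto simp: field_simps)
    have comb: "integral {0..?a} g + integral {?a..?b} g = integral {0..?b} g"
      using ab by (intro Henstock_Kurzweil_Integration.integral_combine int) auto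
    have "norm (integral {?a..?b} (\<lambda>z. g ?a - g z)) \<le> e * (?b - ?a)"
    proof (rule integral_bound)
      show "continuous_on {?a..?b} (\<lambda>z. g ?a - g z)" using ab by (intro continuous_intros continuous_on_subset[OF g]) auto
      show "norm (g ?a - g z) \<le> e" if "z \<in> {?a..?b}" for z
        unfolding real_norm_def by (rule osc) (use ab that order_trans[OF ab(1), of z] in auto)
    qed (use ab in auto)
    moreover have "integral {?a..?b} (\<lambda>z. g ?a - g z) = 1 / real n * g ?a - integral {?a..?b} g"
      using ab by (subst Henstock_Kurzweil_Integration.integral_diff) (auto intro!: int)
    ultimately have "\<bar>1 / real n * g ?a - integral {?a..?b} g\<bar> \<le> e * (1 / real n)"
      unfolding ab(4) by (simp only: real_norm_def)
    moreover have "\<bar>(\<Sum>i<m. 1 / real n * g (real i / real n)) - integral {0..?a} g\<bar> \<le> e * ?a" using Suc by simp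
    moreover have "e * ?b = e * ?a + e * (1 / real n)" by (simp add: add_divide_distrib algebra_simps)
    ultimately show ?case using comb unfolding sum.lessThan_Suc by linarith
  qed
  from this[of n] n show ?thesis by simp
qed

definition moving_avg :: "(real \<Rightarrow> real) \<Rightarrow> real \<Rightarrow> real" where
  "moving_avg f x = integral {0..1} (\<lambda>z. f (x + z))"

lemma continuous_on_moving_avg:
  assumes f: "continuous_on UNIV f"
  shows "continuous_on UNIV (moving_avg f)"
proof -
  have "continuous_on (UNIV \<times> cbox 0 1) (\<lambda>(x,z). f (x + z))"
    unfolding case_prod_unfold by (rule continuous_on_compose2[OF f]) (auto intro!: continuous_intros)
  from integral_continuous_on_param[OF this] show ?thesis unfolding moving_avg_def by simp
qed

lemma moving_avg_nn:
  assumes f: "continuous_on UNIV f" "\<And>z. 0 \<le> f z"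
  shows "ennreal (moving_avg f x) = (\<integral>\<^sup>+z. ennreal (indicator {0..1} z * f (x + z)) \<partial>lborel)"
    and "0 \<le> moving_avg f x"
proof -
  have [measurable]: "f \<in> borel_measurable borel" using f(1) by (rule borel_measurable_continuous_onI)
  have "continuous_on {0..1} (\<lambda>z. f (x + z))" by (rule continuous_on_compose2[OF f(1)]) (auto intro!: continuous_intros)
  hence "((\<lambda>z. f (x + z)) has_integral moving_avg f x) {0..1}"
    unfolding moving_avg_def by (intro integrable_integral integrable_continuous_real)
  hence "((\<lambda>z. if z \<in> {0..1} then f (x + z) else 0) has_integral moving_avg f x) UNIV"
    by (simp only: has_integral_restrict_UNIV)
  moreover have "(\<lambda>z. if z \<in> {0..1} then f (x + z) else 0) = (\<lambda>z. indicator {0..1} z * f (x + z))"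
    by (auto simp: indicator_def)
  ultimately have h: "((\<lambda>z. indicator {0..1} z * f (x + z)) has_integral moving_avg f x) UNIV" by simp
  show "0 \<le> moving_avg f x" using h by (rule has_integral_nonneg) (use f(2) in auto)
  show "ennreal (moving_avg f x) = (\<integral>\<^sup>+z. ennreal (indicator {0..1} z * f (x + z)) \<partial>lborel)"
    using h by (intro nn_integral_has_integral_lborel[symmetric]) (use f(2) in auto)
qed

lemma riemann_sum_moving_avg:
  assumes v: "positive_caloric T v" and e: "0 < e"
  obtains n where "0 < n" "\<And>s x. 0 \<le> s \<Longrightarrow> s \<le> T \<Longrightarrow> \<bar>x\<bar> \<le> R \<Longrightarrow>
    \<bar>(\<Sum>i<n. 1 / real n * v s (x + real i / real n)) - moving_avg (v s) x\<bar> \<le> e"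
proof -
  \<comment> \<open>Widened by 1 because the average at \<open>x\<close> looks as far as
    \<open>x + 1\<close>.\<close>
  let ?K = "{0..T} \<times> {-R-1..R+1}"
  have "continuous_on ?K (\<lambda>(s,x). v s x)"
    using v unfolding positive_caloric_def by (auto elim: continuous_on_subset)
  hence "uniformly_continuous_on ?K (\<lambda>(s,x). v s x)"
    by (intro compact_uniformly_continuous compact_Times compact_Icc)
  then obtain d where d: "d > 0" "\<And>p q. p \<in> ?K \<Longrightarrow> q \<in> ?K \<Longrightarrow> dist q p < d \<Longrightarrow> dist ((\<lambda>(s,x). v s x) q) ((\<lambda>(s,x). v s x) p) < e"
    using e unfolding uniformly_continuous_on_def by metis
  obtain n where n: "0 < n" "1 / real n < d" using d(1) by (metis nat_approx_posE of_nat_Suc zero_less_Suc)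
  show ?thesis
  proof (rule that[OF n(1)])
    fix s x assume s: "0 \<le> s" "s \<le> T" and x: "\<bar>x\<bar> \<le> R"
    show "\<bar>(\<Sum>i<n. 1 / real n * v s (x + real i / real n)) - moving_avg (v s) x\<bar> \<le> e"
      unfolding moving_avg_def
    proof (rule riemann_sum_error[OF _ n(1), of "\<lambda>z. v s (x + z)"])
      show "continuous_on {0..1} (\<lambda>z. v s (x + z))"
        by (rule continuous_on_compose2[OF positive_caloric_continuous[OF v s, of UNIV]]) (auto intro!: continuous_intros)
      fix z z' :: real assume z: "z \<in> {0..1}" "z' \<in> {0..1}" "\<bar>z - z'\<bar> \<le> 1 / real n"
      have "dist ((\<lambda>(s,x). v s x) (s, x + z)) ((\<lambda>(s,x). v s x) (s, x + z')) < e"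
        by (rule d(2)) (use s x z n in \<open>auto simp: dist_Pair_Pair dist_real_def abs_le_iff\<close>)
      thus "\<bar>v s (x + z) - v s (x + z')\<bar> \<le> e" by (simp add: dist_real_def)
    qed
  qed
qed

text \<open>\<open>v T 0\<close> bounds the Gaussian integral of \<open>v s\<close> centred at 0. On
  the window \<open>[x, x + 1]\<close> the kernel is at least its value \<open>c\<close> at
  \<open>R + 1\<close>, so the average is at most \<open>v T 0 / c\<close>.\<close>

lemma moving_avg_growth:
  assumes v: "positive_caloric T v" and s: "0 \<le> s" "s < T" and x: "\<bar>x\<bar> \<le> R"
  shows "moving_avg (v s) x \<le> v T 0 * sqrt (2 * pi * (T - s)) * exp ((R + 1)\<^sup>2 / (2 * (T - s)))"
proof -
  have [measurable]: "v s \<in> borel_measurable borel" using positive_caloric_measurable[OF v] s by simp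
  have v0: "0 \<le> v s z" for z using v s by (auto simp: positive_caloric_def)
  have cv: "continuous_on UNIV (v s)" using positive_caloric_continuous[OF v, of s] s by simp
  have vT: "0 \<le> v T 0" using v s by (auto simp: positive_caloric_def)
  let ?\<sigma> = "sqrt (T - s)"
  define c where "c = normal_density 0 ?\<sigma> (R + 1)"
  have c: "0 < c" using s by (simp add: c_def normal_density_pos)
  have low: "heat_nn (v s) (T - s) 0 \<le> ennreal (v T 0)"
    using positive_caloric_lower[OF positive_caloric_shift[OF v s(1)], of 0] s by simp
  have "ennreal c * ennreal (moving_avg (v s) x) = (\<integral>\<^sup>+z. ennreal c * ennreal (indicator {0..1} z * v s (x + z)) \<partial>lborel)"
    unfolding moving_avg_nn(1)[OF cv v0] by (rule nn_integral_cmult[symmetric]) measurable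
  also have "\<dots> \<le> (\<integral>\<^sup>+z. ennreal (v s (x + 1 * z) * normal_density 0 ?\<sigma> (x + 1 * z)) \<partial>lborel)"
  proof (rule nn_integral_mono)
    fix z :: real
    have "c * (indicator {0..1} z * v s (x + z)) \<le> v s (x + 1 * z) * normal_density 0 ?\<sigma> (x + 1 * z)"
    proof (cases "z \<in> {0..1}")
      case True
      hence "\<bar>x + z\<bar> \<le> R + 1" using x by (auto simp: abs_le_iff)
      hence "(x + z)\<^sup>2 \<le> (R + 1)\<^sup>2" using x by (simp add: abs_le_square_iff[symmetric])
      hence "c \<le> normal_density 0 ?\<sigma> (x + z)" unfolding c_def normal_density_def using s
        by (auto intro!: divide_right_mono mult_left_mono)
      thus ?thesis using True mult_right_mono[OF _ v0[of "x+z"]] by (simp add: mult.commute[of "v s (x+z)"])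
    qed (use v0 in auto)
    thus "ennreal c * ennreal (indicator {0..1} z * v s (x + z)) \<le> ennreal (v s (x + 1 * z) * normal_density 0 ?\<sigma> (x + 1 * z))"
      using c by (simp add: ennreal_mult'[symmetric] ennreal_leI)
  qed
  also have "\<dots> = (\<integral>\<^sup>+z. ennreal (v s z * normal_density 0 ?\<sigma> z) \<partial>lborel)"
    by (subst nn_integral_real_affine[where c=1 and t=x]) auto
  also have "\<dots> = heat_nn (v s) (T - s) 0" using heat_nn_density[of "T - s" "v s" 0] s by simp
  finally have "ennreal (c * moving_avg (v s) x) \<le> ennreal (v T 0)" using low c by (simp add: ennreal_mult' order_trans)
  hence "c * moving_avg (v s) x \<le> v T 0" using vT by simp
  hence "moving_avg (v s) x \<le> v T 0 / c" using c by (simp add: field_simps)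
  also have "\<dots> = v T 0 * sqrt (2 * pi * (T - s)) * exp ((R + 1)\<^sup>2 / (2 * (T - s)))"
    unfolding c_def normal_density_def using s by (simp add: exp_minus field_simps)
  finally show ?thesis .
qed

text \<open>Because \<tau> is smaller than \<open>T\<close>, the exponent
  \<open>1 / (2 * (\<tau> - s))\<close> of the barrier beats \<open>1 / (2 * (T - s))\<close> by at
  least \<open>(T - \<tau>) / (2 * \<tau> * T)\<close>, the gap at \<open>s = 0\<close>. This
  quadratic gain absorbs the linear term from \<open>(R + 1)\<^sup>2\<close>, uniformly for
  \<open>s\<close> up to \<open>t\<close>.\<close>

lemma barrier_growth:
  fixes s t T \<tau> R K :: real
  assumes s: "0 \<le> s" "s \<le> t" and t: "t < \<tau>" "\<tau> < T" and K: "0 \<le> K" and R: "0 \<le> R"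
  shows "K * sqrt (2 * pi * (T - s)) * exp ((R + 1)\<^sup>2 / (2 * (T - s)))
    \<le> K * sqrt (2 * pi * T) * sqrt \<tau> * exp (1 / (2 * (T - t))) * exp (1 / (T - t) * R - (T - \<tau>) / (2 * \<tau> * T) * R\<^sup>2) * heat_barrier \<tau> s R"
proof -
  have "exp ((R + 1)\<^sup>2 / (2 * (T - s))) \<le> exp (1 / (2 * (T - t)) + (1 / (T - t) * R - (T - \<tau>) / (2 * \<tau> * T) * R\<^sup>2) + R\<^sup>2 / (2 * (\<tau> - s)))"
  proof (subst exp_le_cancel_iff)
    have "(R + 1)\<^sup>2 / (2 * (T - s)) = R\<^sup>2 / (2 * (T - s)) + (2 * R + 1) / (2 * (T - s))"
      by (simp add: power2_eq_square algebra_simps add_divide_distrib)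
    also have "(2 * R + 1) / (2 * (T - s)) \<le> (2 * R + 1) / (2 * (T - t))"
      using s t R by (intro divide_left_mono) auto
    also have "(2 * R + 1) / (2 * (T - t)) = 1 / (2 * (T - t)) + 1 / (T - t) * R"
      using s t by (simp add: add_divide_distrib) (simp add: divide_simps)
    also have "R\<^sup>2 / (2 * (T - s)) \<le> R\<^sup>2 / (2 * (\<tau> - s)) - (T - \<tau>) / (2 * \<tau> * T) * R\<^sup>2"
    proof -
      have "1 / (2 * (\<tau> - s)) - 1 / (2 * (T - s)) = (T - \<tau>) / (2 * ((\<tau> - s) * (T - s)))"
        using s t by (simp add: divide_simps) (simp add: algebra_simps)
      also have "\<dots> \<ge> (T - \<tau>) / (2 * (\<tau> * T))"
        using s t by (intro divide_left_mono mult_left_mono mult_mono mult_pos_pos) auto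
      finally have "(T - \<tau>) / (2 * \<tau> * T) * R\<^sup>2 \<le> (1 / (2 * (\<tau> - s)) - 1 / (2 * (T - s))) * R\<^sup>2"
        by (intro mult_right_mono) (auto simp: mult.assoc)
      thus ?thesis by (simp add: algebra_simps)
    qed
    finally show "(R + 1)\<^sup>2 / (2 * (T - s)) \<le> 1 / (2 * (T - t)) + (1 / (T - t) * R - (T - \<tau>) / (2 * \<tau> * T) * R\<^sup>2) + R\<^sup>2 / (2 * (\<tau> - s))"
      by simp
  qed
  note E = this
  have K': "K * sqrt (2 * pi * (T - s)) \<le> K * sqrt (2 * pi * T) * (sqrt \<tau> / sqrt (\<tau> - s))"
  proof -
    have "sqrt (2 * pi * (T - s)) \<le> sqrt (2 * pi * T)" using s by simp
    moreover have "1 \<le> sqrt \<tau> / sqrt (\<tau> - s)" using s t by simp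
    ultimately have "sqrt (2 * pi * (T - s)) * 1 \<le> sqrt (2 * pi * T) * (sqrt \<tau> / sqrt (\<tau> - s))"
      using s t by (intro mult_mono) auto
    from mult_left_mono[OF this K] show ?thesis by (simp only: mult.assoc mult_1_right)
  qed
  have "K * sqrt (2 * pi * (T - s)) * exp ((R + 1)\<^sup>2 / (2 * (T - s))) \<le>
     (K * sqrt (2 * pi * T) * (sqrt \<tau> / sqrt (\<tau> - s))) * exp (1 / (2 * (T - t)) + (1 / (T - t) * R - (T - \<tau>) / (2 * \<tau> * T) * R\<^sup>2) + R\<^sup>2 / (2 * (\<tau> - s)))"
    by (rule mult_mono[OF K' E]) (use K s t in auto)
  also have "\<dots> = K * sqrt (2 * pi * T) * sqrt \<tau> * exp (1 / (2 * (T - t))) * exp (1 / (T - t) * R - (T - \<tau>) / (2 * \<tau> * T) * R\<^sup>2) * heat_barrier \<tau> s R"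
    unfolding heat_barrier_def exp_add by simp
  finally show ?thesis .
qed


text \<open>Here the sign of \<open>v\<close> does not help on the sides; instead the growth bound
  for averages is beaten by the barrier. The maximum principle is applied to Riemann sums in place
  of the averages.\<close>

lemma moving_avg_upper:
  assumes v: "positive_caloric T v" and t: "0 < t" "t < T"
  shows "ennreal (moving_avg (v t) x) \<le> heat_nn (moving_avg (v 0)) t x"
proof -
  \<comment> \<open>\<open>t < \<tau>\<close> keeps the barrier finite up to time \<open>t\<close>;
    \<open>\<tau> < T\<close> makes it outgrow the averages.\<close>
  define \<tau> where "\<tau> = (t + T) / 2"
  have \<tau>: "t < \<tau>" "\<tau> < T" using t by (auto simp: \<tau>_def)
  have v0: "0 \<le> v s z" if "0 \<le> s" "s \<le> T" for s z using v that by (auto simp: positive_caloric_def)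
  have cv: "continuous_on UNIV (v s)" if "0 \<le> s" "s \<le> T" for s using positive_caloric_continuous[OF v that] .
  let ?a = "\<lambda>s. moving_avg (v s)"
  have ca: "continuous_on UNIV (?a 0)" using t by (intro continuous_on_moving_avg cv) auto
  have a0: "0 \<le> ?a s z" if "0 \<le> s" "s \<le> T" for s z by (intro moving_avg_nn cv v0 that)
  \<comment> \<open>\<open>K\<close> and \<eta> collect the factors in front of
    \<open>heat_barrier\<close> in \<open>barrier_growth\<close>, so \<open>\<eta> R * G\<close>
    dominates the averages on both sides of the box while \<open>\<eta> R\<close> tends to
    0.\<close>
  define K where "K = v T 0 * sqrt (2 * pi * T) * sqrt \<tau> * exp (1 / (2 * (T - t)))"
  define \<eta> where "\<eta> = (\<lambda>R. K * exp (1 / (T - t) * R - (T - \<tau>) / (2 * \<tau> * T) * R\<^sup>2))"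
  define G where "G = heat_barrier \<tau>"
  have vT: "0 \<le> v T 0" using v0 t by auto
  have \<eta>0: "0 \<le> \<eta> R" for R unfolding \<eta>_def K_def using vT t \<tau> by simp
  have fin: "ennreal (?a t x - \<eta> R * G t x) \<le> heat_nn (?a 0) t x" if R: "\<bar>x\<bar> \<le> R" for R
  proof -
    define f where "f = (\<lambda>z. ?a 0 z * cutoff R z)"
    have f: "continuous_on UNIV f" "\<And>z. R + 1 < \<bar>z\<bar> \<Longrightarrow> f z = 0" "\<And>z. 0 \<le> f z" "\<And>z. f z \<le> ?a 0 z"
      using ca a0[of 0] t cutoff_props unfolding f_def
      by (auto intro!: continuous_on_mult continuous_on_cutoff mult_left_le)
    obtain M where M: "0 < M" "\<And>z. \<bar>f z\<bar> \<le> M" using continuous_compact_support_bounded[OF f(1,2)] by blast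
    have meas: "f \<in> borel_measurable borel" using f(1) by (rule borel_measurable_continuous_onI)
    have "?a t x - \<eta> R * G t x \<le> heat f t x"
    proof (rule field_le_epsilon)
      fix e :: real assume "e > 0"
      hence e: "e / 2 > 0" by simp
      obtain n where n: "0 < n" "\<And>s x. 0 \<le> s \<Longrightarrow> s \<le> T \<Longrightarrow> \<bar>x\<bar> \<le> R \<Longrightarrow>
        \<bar>(\<Sum>i<n. 1 / real n * v s (x + real i / real n)) - moving_avg (v s) x\<bar> \<le> e / 2"
        using riemann_sum_moving_avg[OF v e, where R=R] by blast
      \<comment> \<open>One half of \<open>e\<close> pays for the Riemann error on the boundary of
        the box, the other for returning from \<open>A t x\<close> to the average.\<close>
      define A where "A = (\<lambda>s x. \<Sum>i<n. 1 / real n * v s (x + real i / real n))"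
      have A: "\<bar>A s z - ?a s z\<bar> \<le> e / 2" if "0 \<le> s" "s \<le> T" "\<bar>z\<bar> \<le> R" for s z
        using n(2)[OF that] by (simp add: A_def)
      have "A t x - heat f t x - \<eta> R * G t x \<le> e / 2"
      proof (rule heat_max_principle[where w="\<lambda>s x. A s x - heat f s x - \<eta> R * G s x" and R=R and T=t])
        have cA: "continuous_on ({0..t} \<times> {-R..R}) (\<lambda>p. A (fst p) (snd p))"
        proof -
          have "continuous_on ({0..T} \<times> UNIV) (\<lambda>(s,x). v s x)" using v by (simp add: positive_caloric_def)
          hence "continuous_on ({0..t} \<times> {-R..R}) (\<lambda>p. (\<lambda>(s,x). v s x) (fst p, snd p + c))" for c
            by (rule continuous_on_compose2) (use t in \<open>auto intro!: continuous_intros\<close>)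
          thus ?thesis unfolding A_def by (intro continuous_on_sum continuous_on_mult continuous_on_const) simp
        qed
        have "continuous_on ({0..t} \<times> {-R..R}) (\<lambda>p. A (fst p) (snd p) - (\<lambda>(s,x). heat f s x) p - \<eta> R * (\<lambda>(s,x). G s x) p)"
          unfolding G_def
          by (intro continuous_on_diff continuous_on_mult continuous_on_const cA continuous_on_heat[OF f(1) M(2)] continuous_on_heat_barrier \<tau>)
        thus "continuous_on ({0..t} \<times> {-R..R}) (\<lambda>(s, x). A s x - heat f s x - \<eta> R * G s x)"
          by (simp add: case_prod_unfold)
        show "heat_at (\<lambda>s x. A s x - heat f s x - \<eta> R * G s x) s x" if "0 < s" "s \<le> t" for s x
        proof -
          have "heat_at v s z" for z using v that t by (simp add: positive_caloric_def)
          hence "heat_at (\<lambda>s x. v s (x + c)) s x" for c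
            using heat_at_translate[of v s 0 x c] by simp
          thus ?thesis unfolding G_def A_def using that \<tau>
            by (intro heat_at_diff heat_at_sum heat_at_cmult heat_at_heat[OF f(1,2)] heat_at_barrier) auto
        qed
        show "A 0 x - heat f 0 x - \<eta> R * G 0 x \<le> e / 2" if "\<bar>x\<bar> \<le> R" for x
        proof -
          have "0 \<le> \<eta> R * G 0 x" using \<eta>0 heat_barrier_nonneg[of 0 \<tau> x] t \<tau> by (simp add: G_def)
          moreover have "f x = ?a 0 x" using that cutoff_props by (simp add: f_def)
          moreover have "A 0 x - ?a 0 x \<le> e / 2" using order_trans[OF abs_ge_self A[of 0 x]] that t by simp
          ultimately show ?thesis unfolding heat_0 by linarith
        qed
        show "A s R - heat f s R - \<eta> R * G s R \<le> e / 2 \<and> A s (- R) - heat f s (- R) - \<eta> R * G s (- R) \<le> e / 2"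
          if "0 \<le> s" "s \<le> t" for s
        proof -
          have R0: "0 \<le> R" using R by simp
          have "?a s z \<le> \<eta> R * G s R" if "\<bar>z\<bar> \<le> R" for z
            using moving_avg_growth[OF v \<open>0 \<le> s\<close> _ that] barrier_growth[OF \<open>0 \<le> s\<close> \<open>s \<le> t\<close> \<tau> vT R0] \<open>s \<le> t\<close> t
            unfolding \<eta>_def K_def G_def by linarith
          hence a: "?a s R \<le> \<eta> R * G s R" "?a s (-R) \<le> \<eta> R * G s R" using R0 by auto
          have G: "G s (-R) = G s R" by (simp add: G_def heat_barrier_even)
          have "A s R - ?a s R \<le> e / 2" "A s (-R) - ?a s (-R) \<le> e / 2"
            using order_trans[OF abs_ge_self A[of s R]] order_trans[OF abs_ge_self A[of s "-R"]] that t R0 by auto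
          thus ?thesis using a heat_nonneg[of f s R, OF f(3)] heat_nonneg[of f s "-R", OF f(3)] unfolding G by linarith
        qed
      qed (use t R in auto)
      moreover have "\<bar>A t x - ?a t x\<bar> \<le> e / 2" using A[of t x] t R by simp
      ultimately show "?a t x - \<eta> R * G t x \<le> heat f t x + e" by linarith
    qed
    hence "ennreal (?a t x - \<eta> R * G t x) \<le> ennreal (heat f t x)" by (rule ennreal_leI)
    also have "\<dots> = heat_nn f t x" by (rule heat_nn_eq_heat[OF meas f(3), symmetric, of M]) (use M in \<open>auto intro: order_trans[OF abs_ge_self]\<close>)
    also have "\<dots> \<le> heat_nn (?a 0) t x" by (rule heat_nn_mono) (rule f(4))
    finally show ?thesis .
  qed
  have "((\<lambda>R. ennreal (?a t x - \<eta> R * G t x)) \<longlongrightarrow> ennreal (?a t x - (K * 0) * G t x)) at_top"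
    unfolding \<eta>_def by (intro tendsto_intros gaussian_decay) (use t \<tau> in auto)
  hence "ennreal (?a t x - (K * 0) * G t x) \<le> heat_nn (?a 0) t x"
    by (rule tendsto_upperbound) (use fin in \<open>auto simp: eventually_at_top_linorder intro!: exI[of _ "\<bar>x\<bar>"]\<close>)
  thus ?thesis by simp
qed

text \<open>By Tonelli, averaging commutes with the heat semigroup.\<close>

lemma heat_nn_moving_avg:
  assumes f: "continuous_on UNIV f" "\<And>z. 0 \<le> f z"
  shows "heat_nn (moving_avg f) t x = (\<integral>\<^sup>+w. indicator {0..1} w * heat_nn f t (x + w) \<partial>lborel)"
proof -
  have [measurable]: "f \<in> borel_measurable borel" using f(1) by (rule borel_measurable_continuous_onI)
  have "heat_nn (moving_avg f) t x
    = (\<integral>\<^sup>+z. (\<integral>\<^sup>+w. ennreal (indicator {0..1} w * f (x - sqrt t * z + w) * std_normal_density z) \<partial>lborel) \<partial>lborel)"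
    unfolding heat_nn_def
    by (intro nn_integral_cong) (auto simp: ennreal_mult'' moving_avg_nn(1)[OF f] nn_integral_multc[symmetric])
  also have "\<dots> = (\<integral>\<^sup>+w. (\<integral>\<^sup>+z. ennreal (indicator {0..1} w * f (x - sqrt t * z + w) * std_normal_density z) \<partial>lborel) \<partial>lborel)"
    by (rule lborel_pair.Fubini') measurable
  also have "\<dots> = (\<integral>\<^sup>+w. indicator {0..1} w * heat_nn f t (x + w) \<partial>lborel)"
    unfolding heat_nn_def
    by (intro nn_integral_cong) (auto simp: indicator_def algebra_simps)
  finally show ?thesis .
qed

lemma borel_measurable_heat_nn:
  assumes [measurable]: "f \<in> borel_measurable borel"
  shows "(\<lambda>x. heat_nn f t x) \<in> borel_measurable borel"
  unfolding heat_nn_def by measurable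

text \<open>Kernels at time \<open>t\<close> with centre in a bounded set lie below a multiple of
  the kernel at the later time \<open>T\<close> centred at 0. Finiteness at \<open>T\<close> thus
  provides the majorant for dominated convergence.\<close>

lemma heat_nn_tendsto:
  fixes f :: "real \<Rightarrow> real"
  assumes f[measurable]: "f \<in> borel_measurable borel" and f0: "\<And>z. 0 \<le> f z" and t: "0 < t" "t < T"
    and fin: "heat_nn f T 0 < \<infinity>" and X: "X \<longlonglongrightarrow> x"
  shows "(\<lambda>n. heat_nn f t (X n)) \<longlonglongrightarrow> heat_nn f t x"
proof -
  obtain K where K: "0 < K" "\<And>n. \<bar>X n\<bar> \<le> K" using convergent_imp_Bseq[OF convergentI[OF X]] by (auto elim: BseqE)
  \<comment> \<open>The quotient of the two normalising factors times the largest price for moving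
    the centre by at most \<open>K\<close>.\<close>
  define C where "C = sqrt (2 * pi * T) / sqrt (2 * pi * t) * exp (K\<^sup>2 / (2 * (T - t)))"
  have C0: "0 \<le> C" using t by (simp add: C_def)
  have bound: "normal_density y (sqrt t) z \<le> C * normal_density 0 (sqrt T) z" if y: "\<bar>y\<bar> \<le> K" for y z
  proof -
    have "z\<^sup>2 / T \<le> (z - y)\<^sup>2 / t + y\<^sup>2 / (T - t)"
    proof -
      \<comment> \<open>The square is the defect in the Cauchy-Schwarz inequality for
        \<open>z = (z - y) + y\<close> with weights \<open>t\<close> and
        \<open>T - t\<close>.\<close>
      have "0 \<le> ((z - y) * (T - t) - y * t)\<^sup>2 / (t * (T - t) * T)" using t by simp
      also have "\<dots> = (z - y)\<^sup>2 / t + y\<^sup>2 / (T - t) - z\<^sup>2 / T"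
        using t by (simp add: divide_simps) (simp add: power2_eq_square algebra_simps)
      finally show ?thesis by simp
    qed
    moreover have "y\<^sup>2 \<le> K\<^sup>2" using y K by (simp add: abs_le_square_iff[symmetric])
    hence "y\<^sup>2 / (T - t) \<le> K\<^sup>2 / (T - t)" using t by (simp add: divide_right_mono)
    ultimately have "z\<^sup>2 / T \<le> (z - y)\<^sup>2 / t + K\<^sup>2 / (T - t)" by linarith
    hence "- (z - y)\<^sup>2 / (2 * t) \<le> K\<^sup>2 / (2 * (T - t)) + - z\<^sup>2 / (2 * T)" 
    proof -
      have h: "a / (2 * c) = (a / c) / 2" for a c :: real by simp
      assume "z\<^sup>2 / T \<le> (z - y)\<^sup>2 / t + K\<^sup>2 / (T - t)"
      moreover have "a \<le> b + c \<Longrightarrow> - b / 2 \<le> c / 2 + - a / 2" for a b c :: real by simp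
      ultimately show ?thesis unfolding h minus_divide_left[symmetric] by blast
    qed
    hence "exp (- (z - y)\<^sup>2 / (2 * t)) \<le> exp (K\<^sup>2 / (2 * (T - t))) * exp (- z\<^sup>2 / (2 * T))"
      by (simp only: exp_add[symmetric] exp_le_cancel_iff)
    hence "1 / sqrt (2 * pi * t) * exp (- (z - y)\<^sup>2 / (2 * t)) \<le> 1 / sqrt (2 * pi * t) * (exp (K\<^sup>2 / (2 * (T - t))) * exp (- z\<^sup>2 / (2 * T)))"
      using t by (intro mult_left_mono) auto
    also have "\<dots> = C * (1 / sqrt (2 * pi * T) * exp (- z\<^sup>2 / (2 * T)))" using t unfolding C_def by simp
    finally show ?thesis using t by (simp add: normal_density_def)
  qed
  have "(\<lambda>n. \<integral>\<^sup>+z. ennreal (f z * normal_density (X n) (sqrt t) z) \<partial>lborel) \<longlonglongrightarrow> (\<integral>\<^sup>+z. ennreal (f z * normal_density x (sqrt t) z) \<partial>lborel)"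
  proof (rule nn_integral_dominated_convergence[where w="\<lambda>z. ennreal C * ennreal (f z * normal_density 0 (sqrt T) z)"])
    show "(\<integral>\<^sup>+z. ennreal C * ennreal (f z * normal_density 0 (sqrt T) z) \<partial>lborel) < \<infinity>"
      using fin t by (simp add: nn_integral_cmult heat_nn_density ennreal_mult_less_top)
    show "AE z in lborel. ennreal (f z * normal_density (X n) (sqrt t) z) \<le> ennreal C * ennreal (f z * normal_density 0 (sqrt T) z)" for n
      using mult_left_mono[OF bound[OF K(2)[of n]] f0] C0
      by (intro AE_I2) (auto simp: ennreal_mult'[symmetric] mult.left_commute intro!: ennreal_leI)
    show "AE z in lborel. (\<lambda>n. ennreal (f z * normal_density (X n) (sqrt t) z)) \<longlonglongrightarrow> ennreal (f z * normal_density x (sqrt t) z)"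
      unfolding normal_density_def by (intro AE_I2 tendsto_intros X) (use t in auto)
  qed measurable
  thus ?thesis using heat_nn_density[OF t(1) f] by simp
qed

text \<open>The right side lies pointwise below the left, while the integrals over
  \<open>[x, x + 1]\<close> compare the other way and are finite. So both agree almost everywhere on
  the window, and continuity of both sides carries the equality to its left end
  \<open>x\<close>.\<close>

theorem positive_caloric_representation:
  assumes v: "positive_caloric T v" and t: "0 < t" "t < T"
  shows "ennreal (v t x) = heat_nn (v 0) t x"
proof -
  have v0: "0 \<le> v s z" if "0 \<le> s" "s \<le> T" for s z using v that by (auto simp: positive_caloric_def)
  have cv: "continuous_on UNIV (v s)" if "0 \<le> s" "s \<le> T" for s using positive_caloric_continuous[OF v that] .
  have [measurable]: "v s \<in> borel_measurable borel" if "0 \<le> s" "s \<le> T" for s using positive_caloric_measurable[OF v that] .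
  have m0[measurable]: "v 0 \<in> borel_measurable borel" "v t \<in> borel_measurable borel" using t by auto
  note [measurable] = borel_measurable_heat_nn
  have low: "heat_nn (v 0) t z \<le> ennreal (v t z)" for z
  proof -
    have "positive_caloric t v" using v t unfolding positive_caloric_def by (auto elim: continuous_on_subset)
    thus ?thesis using positive_caloric_lower t by blast
  qed
  let ?f = "\<lambda>w. ennreal (indicator {0..1} w * v t (x + w))" and ?g = "\<lambda>w. indicator {0..1} w * heat_nn (v 0) t (x + w)"
  have le: "?g w \<le> ?f w" for w using low[of "x + w"] by (simp add: indicator_def)
  have "(\<integral>\<^sup>+w. ?f w \<partial>lborel) = ennreal (moving_avg (v t) x)"
    using moving_avg_nn(1)[OF cv[of t] v0[of t], of x] t by simp
  moreover have "\<dots> \<le> heat_nn (moving_avg (v 0)) t x" by (rule moving_avg_upper[OF v t])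
  moreover have "\<dots> = (\<integral>\<^sup>+w. ?g w \<partial>lborel)" using t by (intro heat_nn_moving_avg cv v0) auto
  ultimately have ge: "(\<integral>\<^sup>+w. ?f w \<partial>lborel) \<le> (\<integral>\<^sup>+w. ?g w \<partial>lborel)" and fin: "(\<integral>\<^sup>+w. ?f w \<partial>lborel) < \<infinity>" by auto
  have fing: "(\<integral>\<^sup>+w. ?g w \<partial>lborel) \<noteq> \<infinity>" using nn_integral_mono[of lborel ?g ?f] le fin by (metis leD linorder_not_less top.not_eq_extremum infinity_ennreal_def)
  have "(\<integral>\<^sup>+w. ?f w - ?g w \<partial>lborel) = (\<integral>\<^sup>+w. ?f w \<partial>lborel) - (\<integral>\<^sup>+w. ?g w \<partial>lborel)"
    by (rule nn_integral_diff) (use le fing in auto)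
  also have "\<dots> = 0" using ge fin by (intro diff_eq_0_ennreal) auto
  finally have "AE w in lborel. ?f w - ?g w = 0" by (subst (asm) nn_integral_0_iff_AE) auto
  hence ae: "AE w in lborel. ?f w \<le> ?g w" by eventually_elim (metis diff_gt_0_iff_gt_ennreal linorder_not_less not_gr_zero)
  \<comment> \<open>An interval is not a null set, so points of agreement accumulate at 0 from the
    right.\<close>
  have "\<exists>w. 0 < w \<and> w < 1 / real (Suc n) \<and> ?f w \<le> ?g w" for n
  proof (rule ccontr)
    assume "\<not> ?thesis"
    hence "AE w in lborel. w \<notin> {0<..<1 / real (Suc n)}" using ae by (auto elim!: eventually_mono)
    hence "emeasure lborel {0<..<1 / real (Suc n)} = 0" by (subst (asm) AE_iff_measurable[of "{0<..<1 / real (Suc n)}"]) auto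
    thus False by simp
  qed
  then obtain w where w: "\<And>n. 0 < w n" "\<And>n. w n < 1 / real (Suc n)" "\<And>n. ?f (w n) \<le> ?g (w n)" by metis
  have w1: "w n \<in> {0..1}" for n using w(1,2)[of n] by (auto simp: field_simps intro: order_trans[OF less_imp_le[OF w(2)]])
  have eq: "ennreal (v t (x + w n)) = heat_nn (v 0) t (x + w n)" for n
    using w(3)[of n] w1[of n] low[of "x + w n"] by (simp add: indicator_def)
  have "w \<longlonglongrightarrow> 0"
    by (rule tendsto_sandwich[OF _ _ tendsto_const LIMSEQ_inverse_real_of_nat])
       (use w in \<open>auto simp: inverse_eq_divide intro!: always_eventually less_imp_le\<close>)
  hence lim: "(\<lambda>n. x + w n) \<longlonglongrightarrow> x" using tendsto_add[OF tendsto_const, of w 0 sequentially x] by simp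
  have "isCont (v t) x" using cv[of t] t by (simp add: continuous_on_eq_continuous_at)
  hence "(\<lambda>n. ennreal (v t (x + w n))) \<longlonglongrightarrow> ennreal (v t x)" by (intro tendsto_intros isCont_tendsto_compose[OF _ lim])
  moreover have "(\<lambda>n. heat_nn (v 0) t (x + w n)) \<longlonglongrightarrow> heat_nn (v 0) t x"
  proof (rule heat_nn_tendsto[OF m0(1) _ t _ lim])
    have "heat_nn (v 0) T 0 \<le> ennreal (v T 0)" using positive_caloric_lower[OF v] t by simp
    thus "heat_nn (v 0) T 0 < \<infinity>" using le_less_trans by fastforce
  qed (use v0 t in auto)
  ultimately show ?thesis unfolding eq by (rule LIMSEQ_unique)
qed


section \<open>The Markov property at hitting events\<close>

context standard_brownian_motion begin

lemma nn_integral_increment: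
  assumes r: "0 \<le> r" "r < T" and g[measurable]: "g \<in> borel_measurable borel" and g0: "\<And>z. 0 \<le> g z"
  shows "(\<integral>\<^sup>+z. ennreal (g (x - z)) \<partial>distr M borel (\<lambda>\<omega>. W T \<omega> - W r \<omega>)) = heat_nn g (T - r) x"
proof -
  have d: "distr M lborel (\<lambda>\<omega>. W T \<omega> - W r \<omega>) = density lborel (normal_density 0 (sqrt (T - r)))"
    using normal_increments[OF r] by (auto simp: distributed_def)
  have "distr M borel (\<lambda>\<omega>. W T \<omega> - W r \<omega>) = distr M lborel (\<lambda>\<omega>. W T \<omega> - W r \<omega>)"
    by (rule distr_cong) auto
  hence "(\<integral>\<^sup>+z. ennreal (g (x - z)) \<partial>distr M borel (\<lambda>\<omega>. W T \<omega> - W r \<omega>)) =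
      (\<integral>\<^sup>+z. ennreal (normal_density 0 (sqrt (T - r)) z) * ennreal (g (x - z)) \<partial>lborel)"
    unfolding d by (simp add: nn_integral_density)
  also have "\<dots> = ennreal \<bar>-1\<bar> * (\<integral>\<^sup>+z. ennreal (normal_density 0 (sqrt (T - r)) (x + (-1) * z)) * ennreal (g (x - (x + (-1) * z))) \<partial>lborel)"
    by (rule nn_integral_real_affine) auto
  also have "\<dots> = (\<integral>\<^sup>+z. ennreal (g z * normal_density x (sqrt (T - r)) z) \<partial>lborel)"
    by (auto intro!: nn_integral_cong simp: normal_density_def power2_commute ennreal_mult''[symmetric] g0 mult_ac)
  also have "\<dots> = heat_nn g (T - r) x" using r by (intro heat_nn_density[symmetric]) auto
  finally show ?thesis .
qed

text \<open>The sorted times \<open>0 < S < r < T\<close> reduce the claim to the independence of the last increment.\<close>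

lemma markov_finite:
  fixes c :: "real \<Rightarrow> real"
  assumes S: "finite S" "S \<subseteq> {0<..<r}" and r: "0 < r" "r < T"
    and g[measurable]: "g \<in> borel_measurable borel" and g0: "\<And>z. 0 \<le> g z"
  shows "(\<integral>\<^sup>+\<omega>. of_bool (\<exists>q\<in>S. W q \<omega> < c q) * ennreal (g (y - W T \<omega>)) \<partial>M) =
    (\<integral>\<^sup>+\<omega>. of_bool (\<exists>q\<in>S. W q \<omega> < c q) * heat_nn g (T - r) (y - W r \<omega>) \<partial>M)"
proof -
  \<comment> \<open>Starting at 0 makes sums of increments telescope to \<open>W\<close>. With
    \<open>n = Suc (card S)\<close> the entry \<open>n\<close> is \<open>r\<close>: increments below
    \<open>n\<close> determine the event and \<open>W r\<close>, and increment \<open>n\<close> is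
    \<open>W T - W r\<close>.\<close>
  define L where "L = 0 # sorted_list_of_set S @ [r, T]"
  have srt: "sorted_wrt (<) L"
    unfolding L_def using S r by (auto simp: sorted_wrt_append)
  define n where "n = Suc (card S)"
  have len: "length L = Suc (Suc n)" using S by (simp add: L_def n_def)
  define q where "q = (\<lambda>i. L ! i)"
  have q0: "q 0 = 0" by (simp add: q_def L_def)
  have qn: "q n = r" "q (Suc n) = T" using S by (simp_all add: q_def L_def n_def nth_append)
  have inc: "q i < q (Suc i)" if "i < Suc n" for i
    unfolding q_def using sorted_wrt_nth_less[OF srt, of i "Suc i"] that len by simp
  have mono: "q i \<le> q j" if "i \<le> j" "j \<le> Suc n" for i j
    using sorted_wrt_nth_less[OF srt, of i j] that len unfolding q_def by (cases "i = j") auto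
  have idx: "\<exists>i\<le>n. x = q i" if "x \<in> S" for x
  proof -
    have "x \<in> set L" using that S by (simp add: L_def)
    then obtain i where i: "i < length L" "L ! i = x" by (auto simp: in_set_conv_nth)
    have "i \<noteq> Suc n" using i qn that S r by (auto simp: q_def)
    thus ?thesis using i len by (auto simp: q_def intro!: exI[of _ i])
  qed
  define I where "I = {i. i \<le> n \<and> q i \<in> S}"
  have finI: "finite I" by (simp add: I_def)
  let ?P = "PiM {..<n} (\<lambda>_. borel :: real measure)"
  \<comment> \<open>The event as a function of the vector of increments alone, which is the form in
    which independence applies.\<close>
  define h where "h = (\<lambda>x :: nat \<Rightarrow> real. \<exists>i\<in>I. (\<Sum>j<i. x j) < c (q i))"
  let ?Y = "\<lambda>\<omega>. \<lambda>i\<in>{..<n}. W (q (Suc i)) \<omega> - W (q i) \<omega>"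
  let ?Z = "\<lambda>\<omega>. W T \<omega> - W r \<omega>"
  have tele: "(\<Sum>j<i. ?Y \<omega> j) = W (q i) \<omega>" if "i \<le> n" "\<omega> \<in> space M" for i \<omega>
  proof -
    have "(\<Sum>j<i. ?Y \<omega> j) = (\<Sum>j<i. W (q (Suc j)) \<omega> - W (q j) \<omega>)" using that by (intro sum.cong) auto
    thus ?thesis using that start_zero sum_lessThan_telescope[of "\<lambda>j. W (q j) \<omega>" i] by (simp add: q0)
  qed
  have hY: "h (?Y \<omega>) \<longleftrightarrow> (\<exists>q\<in>S. W q \<omega> < c q)" if "\<omega> \<in> space M" for \<omega>
  proof -
    have "h (?Y \<omega>) \<longleftrightarrow> (\<exists>i\<in>I. W (q i) \<omega> < c (q i))" unfolding h_def using tele that I_def by auto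
    also have "\<dots> \<longleftrightarrow> (\<exists>q\<in>S. W q \<omega> < c q)" using idx unfolding I_def by fastforce
    finally show ?thesis .
  qed
  have comp: "(\<lambda>x. x j) \<in> borel_measurable ?P" if "j < n" for j
    using that by (intro measurable_component_singleton) auto
  have sm: "(\<lambda>x. \<Sum>j<i. x j) \<in> borel_measurable ?P" if "i \<le> n" for i
    using that by (intro borel_measurable_sum comp) auto
  define sg where "sg = (\<lambda>x :: nat \<Rightarrow> real. \<Sum>j<n. x j)"
  define pz where "pz = (\<lambda>z :: nat \<Rightarrow> real. z n)"
  have [measurable]: "sg \<in> borel_measurable ?P" unfolding sg_def by (rule sm) simp
  have hm[measurable]: "Measurable.pred ?P h"
    unfolding h_def using sm by (intro pred_intros_finite finI borel_measurable_pred_less) (auto simp: I_def)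
  \<comment> \<open>A product over one index, since splitting an independent family gives blocks in
    product spaces; \<open>pz\<close> reads off the single coordinate.\<close>
  let ?Q = "PiM {n} (\<lambda>_. borel :: real measure)"
  let ?V = "\<lambda>\<omega>. \<lambda>i\<in>{n}. W (q (Suc i)) \<omega> - W (q i) \<omega>"
  have "indep_vars (\<lambda>_. borel) (\<lambda>i \<omega>. W (q (Suc i)) \<omega> - W (q i) \<omega>) {..<Suc n}"
    by (rule independent_increments) (use inc q0 in auto)
  hence ind: "indep_var ?P ?Y ?Q ?V"
    by (rule indep_var_restrict) auto
  have Ym[measurable]: "?Y \<in> M \<rightarrow>\<^sub>M ?P" and Vm[measurable]: "?V \<in> M \<rightarrow>\<^sub>M ?Q"
    using ind by (auto dest: indep_var_rv1 indep_var_rv2)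
  have [measurable]: "?Z \<in> borel_measurable M" using measurable_W r by (intro borel_measurable_diff) auto
  have [measurable]: "pz \<in> borel_measurable ?Q" unfolding pz_def by (intro measurable_component_singleton) auto
  have pr: "distr M ?P ?Y \<Otimes>\<^sub>M distr M ?Q ?V = distr M (?P \<Otimes>\<^sub>M ?Q) (\<lambda>\<omega>. (?Y \<omega>, ?V \<omega>))"
    using ind by (simp add: indep_var_distribution_eq)
  interpret V: prob_space "distr M ?Q ?V" by (rule prob_space_distr) measurable
  have inner: "(\<integral>\<^sup>+z. ennreal (g (x - pz z)) \<partial>distr M ?Q ?V) = heat_nn g (T - r) x" for x
  proof -
    have "(\<integral>\<^sup>+z. ennreal (g (x - pz z)) \<partial>distr M ?Q ?V) = (\<integral>\<^sup>+\<omega>. ennreal (g (x - ?Z \<omega>)) \<partial>M)"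
      by (subst nn_integral_distr) (auto simp: qn pz_def)
    also have "\<dots> = (\<integral>\<^sup>+z. ennreal (g (x - z)) \<partial>distr M borel ?Z)"
      by (rule nn_integral_distr[symmetric]) auto
    finally show ?thesis using r by (simp add: nn_integral_increment g0)
  qed
  have [measurable]: "(\<lambda>x. heat_nn g (T - r) x) \<in> borel_measurable borel" by (rule borel_measurable_heat_nn) measurable
  have "(\<integral>\<^sup>+\<omega>. of_bool (\<exists>q\<in>S. W q \<omega> < c q) * ennreal (g (y - W T \<omega>)) \<partial>M)
     = (\<integral>\<^sup>+\<omega>. (\<lambda>(x,z). of_bool (h x) * ennreal (g (y - sg x - pz z))) (?Y \<omega>, ?V \<omega>) \<partial>M)"
    using hY tele[of n] qn unfolding sg_def pz_def by (intro nn_integral_cong) (simp)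
  also have "\<dots> = (\<integral>\<^sup>+p. (\<lambda>(x,z). of_bool (h x) * ennreal (g (y - sg x - pz z))) p \<partial>(distr M ?P ?Y \<Otimes>\<^sub>M distr M ?Q ?V))"
    unfolding pr by (subst nn_integral_distr) (measurable)
  also have "\<dots> = (\<integral>\<^sup>+x. (\<integral>\<^sup>+z. of_bool (h x) * ennreal (g (y - sg x - pz z)) \<partial>distr M ?Q ?V) \<partial>distr M ?P ?Y)"
    by (subst V.nn_integral_fst[symmetric]) simp_all
  also have "\<dots> = (\<integral>\<^sup>+x. of_bool (h x) * heat_nn g (T - r) (y - sg x) \<partial>distr M ?P ?Y)"
    using r by (intro nn_integral_cong) (simp add: nn_integral_cmult inner)
  also have "\<dots> = (\<integral>\<^sup>+\<omega>. of_bool (h (?Y \<omega>)) * heat_nn g (T - r) (y - sg (?Y \<omega>)) \<partial>M)"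
    by (subst nn_integral_distr) (measurable)
  also have "\<dots> = (\<integral>\<^sup>+\<omega>. of_bool (\<exists>q\<in>S. W q \<omega> < c q) * heat_nn g (T - r) (y - W r \<omega>) \<partial>M)"
    using hY tele[of n] qn unfolding sg_def pz_def by (intro nn_integral_cong) simp
  finally show ?thesis .
qed


text \<open>Actual contact instead of a condition on the infimum: the event depends on the path up
  to \<open>r\<close> only and is empty at \<open>r = 0\<close>, so a time grid may start
  there.\<close>

definition hits :: "(real \<Rightarrow> real) \<Rightarrow> real \<Rightarrow> 'a set" where
  "hits b r = {\<omega> \<in> space M. \<exists>s. 0 < s \<and> s \<le> r \<and> W s \<omega> \<le> b s}"

lemma continuous_path_minus_boundary:
  assumes "\<omega> \<in> space M" "continuous_on {0<..} b" "A \<subseteq> {0<..}"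
  shows "continuous_on A (\<lambda>s. W s \<omega> - b s)"
  by (intro continuous_on_diff continuous_on_subset[OF continuous_paths[OF assms(1)]] continuous_on_subset[OF assms(2,3)])
     (use assms(3) in auto)

text \<open>By compactness, contact means that the minimum of \<open>W - b\<close> is at most 0.
  Strict inequalities with slack \<open>1 / Suc k\<close> are open conditions, so rational interior
  times detect them even for contact at an end point.\<close>

lemma hits_interval_eq:
  assumes b: "continuous_on {0<..} b" and a: "0 < a" "a < r" and \<omega>: "\<omega> \<in> space M"
  shows "(\<exists>s\<in>{a..r}. W s \<omega> \<le> b s) \<longleftrightarrow> (\<forall>k. \<exists>q\<in>\<rat> \<inter> {a<..<r}. W q \<omega> < b q + 1 / real (Suc k))"
proof -
  have c: "continuous_on {a..r} (\<lambda>s. W s \<omega> - b s)"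
    by (rule continuous_path_minus_boundary[OF \<omega> b]) (use a in auto)
  show ?thesis
  proof
    assume "\<exists>s\<in>{a..r}. W s \<omega> \<le> b s"
    then obtain s where s: "s \<in> {a..r}" "W s \<omega> - b s \<le> 0" by auto
    show "\<forall>k. \<exists>q\<in>\<rat> \<inter> {a<..<r}. W q \<omega> < b q + 1 / real (Suc k)"
    proof
      fix k
      have "1 / real (Suc k) > 0" by simp
      then obtain d where d: "d > 0" "\<And>z. z \<in> {a..r} \<Longrightarrow> dist z s < d \<Longrightarrow> dist (W z \<omega> - b z) (W s \<omega> - b s) < 1 / real (Suc k)"
        using c s(1) unfolding continuous_on_iff by metis
      have "max a (s - d) < min r (s + d)" using a s d by auto
      then obtain q where q: "q \<in> \<rat>" "max a (s - d) < q" "q < min r (s + d)" using Rats_dense_in_real by blast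
      have "dist (W q \<omega> - b q) (W s \<omega> - b s) < 1 / real (Suc k)" by (rule d(2)) (use q in \<open>auto simp: dist_real_def\<close>)
      hence "W q \<omega> - b q < 1 / real (Suc k)" using s(2) unfolding dist_real_def by linarith
      hence "W q \<omega> < b q + 1 / real (Suc k)" by linarith
      thus "\<exists>q\<in>\<rat> \<inter> {a<..<r}. W q \<omega> < b q + 1 / real (Suc k)" using q by auto
    qed
  next
    assume H: "\<forall>k. \<exists>q\<in>\<rat> \<inter> {a<..<r}. W q \<omega> < b q + 1 / real (Suc k)"
    obtain s where s: "s \<in> {a..r}" "\<And>z. z \<in> {a..r} \<Longrightarrow> W s \<omega> - b s \<le> W z \<omega> - b z"
      using continuous_attains_inf[OF compact_Icc _ c] a by auto
    have "W s \<omega> - b s \<le> 1 / real (Suc k)" for k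
    proof -
      obtain q where "q \<in> {a<..<r}" "W q \<omega> < b q + 1 / real (Suc k)" using H by blast
      thus ?thesis using s(2)[of q] by (auto simp del: of_nat_Suc)
    qed
    hence "W s \<omega> - b s \<le> 0"
      by (intro LIMSEQ_le_const[OF LIMSEQ_inverse_real_of_nat]) (auto simp: inverse_eq_divide)
    thus "\<exists>s\<in>{a..r}. W s \<omega> \<le> b s" using s(1) by auto
  qed
qed

text \<open>Hitting events arise from events that depend on finitely many times by monotone limits.\<close>

lemma hits_approx_induct:
  assumes b: "continuous_on {0<..} b" and r: "0 < r"
    and fin: "\<And>S c. finite S \<Longrightarrow> S \<subseteq> {0<..<r} \<Longrightarrow> P {\<omega> \<in> space M. \<exists>q\<in>S. W q \<omega> < c q}"
    and inc: "\<And>A. incseq A \<Longrightarrow> (\<And>n::nat. P (A n)) \<Longrightarrow> P (\<Union>n. A n)"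
    and dec: "\<And>A. decseq A \<Longrightarrow> (\<And>n::nat. P (A n)) \<Longrightarrow> P (\<Inter>n. A n)"
  shows "P (hits b r)"
proof -
  \<comment> \<open>The shift by 2 keeps \<open>a m\<close> strictly below \<open>r\<close> already
    for \<open>m = 0\<close>.\<close>
  define a where "a = (\<lambda>m::nat. r / real (m + 2))"
  have a: "0 < a m" "a m < r" for m using r by (auto simp: a_def field_simps add_pos_nonneg)
  have a_dec: "a m \<le> a n" if "n \<le> m" for m n using r that by (auto simp: a_def intro!: divide_left_mono)
  have a0: "\<exists>m. a m \<le> s" if "0 < s" for s
  proof -
    obtain m where "r / s < real m" using reals_Archimedean2 by blast
    hence "r < real (m + 2) * s" using that by (simp add: field_simps add_strict_increasing2 mult_pos_pos)
    thus ?thesis using that by (auto intro!: exI[of _ m] simp: a_def field_simps)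
  qed
  \<comment> \<open>Three limits follow: finite to all rational times (increasing), slack to 0
    (decreasing), and lower end \<open>a m\<close> to 0 (increasing).\<close>
  let ?C = "\<lambda>m. {\<omega> \<in> space M. \<exists>s\<in>{a m..r}. W s \<omega> \<le> b s}"
  let ?D = "\<lambda>m k. {\<omega> \<in> space M. \<exists>q\<in>\<rat> \<inter> {a m<..<r}. W q \<omega> < b q + 1 / real (Suc k)}"
  have D: "P (?D m k)" for m k
  proof -
    let ?Q = "\<rat> \<inter> {a m<..<r}"
    have Q: "?Q \<noteq> {}" "countable ?Q"
      using Rats_dense_in_real[OF a(2)[of m]] by (auto intro: countable_subset[OF _ countable_rat])
    define e where "e = from_nat_into ?Q"
    have e: "range e = ?Q" unfolding e_def using Q by (rule range_from_nat_into)
    let ?E = "\<lambda>j. {\<omega> \<in> space M. \<exists>q\<in>e ` {..<j}. W q \<omega> < b q + 1 / real (Suc k)}"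
    have "P (\<Union>j. ?E j)"
    proof (rule inc)
      show "incseq ?E" by (auto simp: incseq_def)
      show "P (?E j)" for j
      proof (rule fin)
        have "e ` {..<j} \<subseteq> ?Q" using e by blast
        thus "e ` {..<j} \<subseteq> {0<..<r}" using a(1)[of m] by fastforce
      qed auto
    qed
    also have "(\<Union>j. ?E j) = ?D m k"
      unfolding e[symmetric] by auto
    finally show ?thesis .
  qed
  have C: "P (?C m)" for m
  proof -
    have "P (\<Inter>k. ?D m k)"
    proof (rule dec)
      show "decseq (?D m)"
        unfolding decseq_def
      proof (intro allI impI subsetI)
        fix k l \<omega> assume kl: "k \<le> (l::nat)" and "\<omega> \<in> ?D m l"
        then obtain q where q: "\<omega> \<in> space M" "q \<in> \<rat> \<inter> {a m<..<r}" "W q \<omega> < b q + 1 / real (Suc l)" by auto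
        have "1 / real (Suc l) \<le> 1 / real (Suc k)" using kl by (intro divide_left_mono) auto
        hence "W q \<omega> < b q + 1 / real (Suc k)" using q by linarith
        thus "\<omega> \<in> ?D m k" using q by blast
      qed
    qed (rule D)
    also have "(\<Inter>k. ?D m k) = ?C m"
      unfolding set_eq_iff mem_Collect_eq INT_iff using hits_interval_eq[OF b a] by blast
    finally show ?thesis .
  qed
  have "P (\<Union>m. ?C m)"
  proof (rule inc)
    have "{a m..r} \<subseteq> {a n..r}" if "m \<le> n" for m n using a_dec[OF that] by auto
    thus "incseq ?C" unfolding incseq_def by blast
  qed (rule C)
  also have "(\<Union>m. ?C m) = hits b r"
  proof safe
    fix \<omega> assume "\<omega> \<in> hits b r"
    then obtain s where s: "\<omega> \<in> space M" "0 < s" "s \<le> r" "W s \<omega> \<le> b s" by (auto simp: hits_def)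
    obtain m where "a m \<le> s" using a0 s by blast
    hence "\<omega> \<in> ?C m" using s by auto
    thus "\<omega> \<in> (\<Union>m. ?C m)" by blast
  next
    fix m \<omega> s assume "\<omega> \<in> space M" "s \<in> {a m..r}" "W s \<omega> \<le> b s"
    thus "\<omega> \<in> hits b r" using a(1)[of m] by (auto simp: hits_def intro!: exI[of _ s])
  qed
  finally show ?thesis .
qed

lemma hits_sets:
  assumes b: "continuous_on {0<..} b"
  shows "hits b r \<in> sets M"
proof (cases "0 < r")
  case True
  show ?thesis
  proof (rule hits_approx_induct[OF b True])
    fix S :: "real set" and c assume S: "finite S" "S \<subseteq> {0<..<r}"
    have "{\<omega> \<in> space M. \<exists>q\<in>S. W q \<omega> < c q} = (\<Union>q\<in>S. {\<omega> \<in> space M. W q \<omega> < c q})" by auto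
    also have "\<dots> \<in> sets M" using S measurable_W by (intro sets.finite_UN borel_measurable_less) auto
    finally show "{\<omega> \<in> space M. \<exists>q\<in>S. W q \<omega> < c q} \<in> sets M" .
  qed auto
next
  case False
  hence "hits b r = {}" by (auto simp: hits_def)
  thus ?thesis by simp
qed

text \<open>Both sides are measures of the same event under two densities. They agree on finite-time
  events, hence on monotone limits; the bound on \<open>g\<close> makes the measures finite, as
  decreasing limits require.\<close>

lemma markov_hits:
  assumes b: "continuous_on {0<..} b" and r: "0 < r'" "r' \<le> r" "r < T"
    and g[measurable]: "g \<in> borel_measurable borel" and g0: "\<And>z. 0 \<le> g z" and gB: "\<And>z. g z \<le> B"
  shows "emeasure (density M (\<lambda>\<omega>. ennreal (g (y - W T \<omega>)))) (hits b r') =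
    emeasure (density M (\<lambda>\<omega>. heat_nn g (T - r) (y - W r \<omega>))) (hits b r')"
proof -
  have [measurable]: "W T \<in> borel_measurable M" "W r \<in> borel_measurable M" using measurable_W r by auto
  have [measurable]: "(\<lambda>x. heat_nn g (T - r) x) \<in> borel_measurable borel" by (rule borel_measurable_heat_nn) measurable
  let ?f1 = "\<lambda>\<omega>. ennreal (g (y - W T \<omega>))" and ?f2 = "\<lambda>\<omega>. heat_nn g (T - r) (y - W r \<omega>)"
  let ?m1 = "density M ?f1" and ?m2 = "density M ?f2"
  have f1: "?f1 \<omega> \<le> ennreal B" for \<omega> using gB by (intro ennreal_leI) auto
  have f2: "?f2 \<omega> \<le> ennreal B" for \<omega>
    using heat_le[OF g g0 gB] by (subst heat_nn_eq_heat[OF g g0 gB]) (auto intro: ennreal_leI)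
  have fin: "emeasure (density M f) A \<noteq> \<infinity>" if "\<And>\<omega>. f \<omega> \<le> ennreal B" "f \<in> borel_measurable M" for A and f :: "'a \<Rightarrow> ennreal"
  proof -
    have "emeasure (density M f) A \<le> emeasure (density M f) (space (density M f))" by (rule emeasure_space)
    also have "\<dots> = (\<integral>\<^sup>+\<omega>. f \<omega> \<partial>M)" using that(2) by (simp add: emeasure_density nn_set_integral_space)
    also have "\<dots> \<le> (\<integral>\<^sup>+\<omega>. ennreal B \<partial>M)" using that by (intro nn_integral_mono) auto
    also have "\<dots> < \<infinity>" by (simp add: emeasure_space_1)
    finally show ?thesis by simp
  qed
  \<comment> \<open>Measurability is carried through the induction because continuity of measures
    along the limits needs it.\<close>
  have "hits b r' \<in> sets M \<and> emeasure ?m1 (hits b r') = emeasure ?m2 (hits b r')"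
  proof (rule hits_approx_induct[OF b r(1)])
    fix S :: "real set" and c assume S: "finite S" "S \<subseteq> {0<..<r'}"
    let ?A = "{\<omega> \<in> space M. \<exists>q\<in>S. W q \<omega> < c q}"
    have "?A = (\<Union>q\<in>S. {\<omega> \<in> space M. W q \<omega> < c q})" by auto
    also have "\<dots> \<in> sets M" using S measurable_W by (intro sets.finite_UN borel_measurable_less) auto
    finally have A: "?A \<in> sets M" .
    have "emeasure (density M f) ?A = (\<integral>\<^sup>+\<omega>. of_bool (\<exists>q\<in>S. W q \<omega> < c q) * f \<omega> \<partial>M)" if "f \<in> borel_measurable M" for f
      using A that by (auto simp: emeasure_density indicator_def intro!: nn_integral_cong)
    moreover have "S \<subseteq> {0<..<r}" using S r by fastforce
    ultimately show "?A \<in> sets M \<and> emeasure ?m1 ?A = emeasure ?m2 ?A"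
      using A markov_finite[OF S(1) _ _ r(3) g g0, of c y] r by simp
  next
    fix A :: "nat \<Rightarrow> 'a set" assume A: "incseq A" "\<And>n. A n \<in> sets M \<and> emeasure ?m1 (A n) = emeasure ?m2 (A n)"
    have "emeasure ?m1 (\<Union>n. A n) = (SUP n. emeasure ?m1 (A n))" using A by (intro SUP_emeasure_incseq[symmetric]) auto
    also have "\<dots> = (SUP n. emeasure ?m2 (A n))" using A by simp
    also have "\<dots> = emeasure ?m2 (\<Union>n. A n)" using A by (intro SUP_emeasure_incseq) auto
    finally show "(\<Union>n. A n) \<in> sets M \<and> emeasure ?m1 (\<Union>n. A n) = emeasure ?m2 (\<Union>n. A n)" using A by auto
  next
    fix A :: "nat \<Rightarrow> 'a set" assume A: "decseq A" "\<And>n. A n \<in> sets M \<and> emeasure ?m1 (A n) = emeasure ?m2 (A n)"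
    have "emeasure ?m1 (\<Inter>n. A n) = (INF n. emeasure ?m1 (A n))" using A fin[of ?f1, OF f1] fin[of ?f2, OF f2] by (intro INF_emeasure_decseq[symmetric]) auto
    also have "\<dots> = (INF n. emeasure ?m2 (A n))" using A by simp
    also have "\<dots> = emeasure ?m2 (\<Inter>n. A n)" using A fin[of ?f2, OF f2] by (intro INF_emeasure_decseq) auto
    finally show "(\<Inter>n. A n) \<in> sets M \<and> emeasure ?m1 (\<Inter>n. A n) = emeasure ?m2 (\<Inter>n. A n)" using A by auto
  qed
  thus ?thesis by simp
qed

end


context standard_brownian_motion begin

subsection \<open>The passage time\<close>

lemma passage_time_nonneg: "0 \<le> passage_time W b \<omega>"
  unfolding passage_time_def by (intro Inf_greatest) auto

text \<open>For \<open>r > 0\<close> the infimum is attained: without contact on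
  \<open>(0, r]\<close>, continuity at \<open>r\<close> excludes contact a little beyond as well. At
  0 this fails, since contacts may accumulate there.\<close>

lemma passage_time_le_iff:
  assumes b: "continuous_on {0<..} b" and \<omega>: "\<omega> \<in> space M" and r: "0 < r"
  shows "passage_time W b \<omega> \<le> ereal r \<longleftrightarrow> \<omega> \<in> hits b r"
proof
  assume "\<omega> \<in> hits b r"
  then obtain s where s: "0 < s" "s \<le> r" "W s \<omega> \<le> b s" by (auto simp: hits_def)
  have "passage_time W b \<omega> \<le> ereal s" unfolding passage_time_def using s by (intro Inf_lower) auto
  thus "passage_time W b \<omega> \<le> ereal r" using s by (metis ereal_less_eq(3) order_trans)
next
  assume le: "passage_time W b \<omega> \<le> ereal r"
  show "\<omega> \<in> hits b r"
  proof (rule ccontr)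
    assume n: "\<omega> \<notin> hits b r"
    hence gt: "b s < W s \<omega>" if "0 < s" "s \<le> r" for s using that \<omega> by (force simp: hits_def)
    have "continuous_on {0<..} (\<lambda>s. W s \<omega> - b s)" by (rule continuous_path_minus_boundary[OF \<omega> b]) auto
    hence "isCont (\<lambda>s. W s \<omega> - b s) r" using r by (simp add: continuous_on_eq_continuous_at)
    hence "eventually (\<lambda>s. 0 < W s \<omega> - b s) (at r)" using gt[OF r] by (intro order_tendstoD(1)[of _ "W r \<omega> - b r"]) (auto simp: isCont_def)
    then obtain d where d: "d > 0" "\<And>s. s \<noteq> r \<Longrightarrow> dist s r < d \<Longrightarrow> b s < W s \<omega>" by (auto simp: eventually_at)
    have "ereal (r + d) \<le> passage_time W b \<omega>"
      unfolding passage_time_def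
    proof (rule Inf_greatest, clarify)
      fix s assume s: "0 < s" "W s \<omega> \<le> b s"
      have "r < s" using gt[of s] s by force
      moreover have "\<not> dist s r < d" using d(2)[of s] s \<open>r < s\<close> by force
      ultimately show "ereal (r + d) \<le> ereal s" by (simp add: dist_real_def)
    qed
    from order_trans[OF this le] show False using d(1) by simp
  qed
qed

text \<open>A path strictly below the boundary at time \<open>s\<close> would have been below it
  slightly earlier, before the first contact.\<close>

lemma at_passage_time:
  assumes b: "continuous_on {0<..} b" and \<omega>: "\<omega> \<in> space M" and s: "0 < s" "passage_time W b \<omega> = ereal s"
  shows "W s \<omega> = b s"
proof -
  have low: "s \<le> z" if "0 < z" "W z \<omega> \<le> b z" for z
  proof -
    have "passage_time W b \<omega> \<le> ereal z" unfolding passage_time_def using that by (intro Inf_lower) auto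
    thus ?thesis using s by simp
  qed
  have "\<omega> \<in> hits b s" using passage_time_le_iff[OF b \<omega> s(1)] s(2) by simp
  then obtain z where z: "0 < z" "z \<le> s" "W z \<omega> \<le> b z" by (auto simp: hits_def)
  hence "z = s" using low by force
  hence le: "W s \<omega> \<le> b s" using z by simp
  moreover have "\<not> W s \<omega> < b s"
  proof
    assume "W s \<omega> < b s"
    have "continuous_on {0<..} (\<lambda>s. W s \<omega> - b s)" by (rule continuous_path_minus_boundary[OF \<omega> b]) auto
    hence "isCont (\<lambda>s. W s \<omega> - b s) s" using s by (simp add: continuous_on_eq_continuous_at)
    hence "eventually (\<lambda>s. W s \<omega> - b s < 0) (at s)" using \<open>W s \<omega> < b s\<close> by (intro order_tendstoD(2)[of _ "W s \<omega> - b s"]) (auto simp: isCont_def)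
    then obtain d where d: "d > 0" "\<And>z. z \<noteq> s \<Longrightarrow> dist z s < d \<Longrightarrow> W z \<omega> < b z" by (auto simp: eventually_at)
    define z where "z = s - min s d / 2"
    have "0 < z" "z < s" "dist z s < d" using s d by (auto simp: z_def dist_real_def)
    thus False using low[of z] d(2)[of z] by auto
  qed
  ultimately show ?thesis by simp
qed

lemma passage_time_measurable:
  assumes b: "continuous_on {0<..} b"
  shows "passage_time W b \<in> borel_measurable M"
  unfolding borel_measurable_iff_Iic_ereal
proof
  fix a :: ereal
  show "passage_time W b -` {..a} \<inter> space M \<in> sets M"
  proof (cases a)
    case (real r)
    consider "r < 0" | "r = 0" | "0 < r" by linarith
    thus ?thesis
    proof cases
      case 1
      have "\<not> passage_time W b \<omega> \<le> a" for \<omega>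
        using order_trans[OF passage_time_nonneg, of b \<omega> a] real 1 by (auto simp: zero_ereal_def)
      hence "passage_time W b -` {..a} \<inter> space M = {}" by auto
      thus ?thesis by simp
    next
      case 2
      \<comment> \<open>The infimum can be 0 without contact at a smallest time, so this event is
        recovered from the times \<open>1 / Suc n\<close>.\<close>
      have "passage_time W b \<omega> \<le> a \<longleftrightarrow> (\<forall>n. \<omega> \<in> hits b (1 / real (Suc n)))" if \<omega>: "\<omega> \<in> space M" for \<omega>
      proof -
        have "(\<forall>n. \<omega> \<in> hits b (1 / real (Suc n))) \<longleftrightarrow> (\<forall>n. passage_time W b \<omega> \<le> ereal (1 / real (Suc n)))"
          using passage_time_le_iff[OF b \<omega>] by simp
        also have "\<dots> \<longleftrightarrow> passage_time W b \<omega> \<le> ereal 0"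
        proof
          assume le: "\<forall>n. passage_time W b \<omega> \<le> ereal (1 / real (Suc n))"
          have "(\<lambda>n. ereal (1 / real (Suc n))) \<longlonglongrightarrow> ereal 0"
            using LIMSEQ_inverse_real_of_nat by (intro tendsto_ereal) (simp add: inverse_eq_divide)
          thus "passage_time W b \<omega> \<le> ereal 0" by (rule LIMSEQ_le_const) (use le in blast)
        next
          assume "passage_time W b \<omega> \<le> ereal 0"
          moreover have "ereal 0 \<le> ereal (1 / real (Suc n))" for n by simp
          ultimately show "\<forall>n. passage_time W b \<omega> \<le> ereal (1 / real (Suc n))" using order_trans by blast
        qed
        finally show ?thesis using real 2 by simp
      qed
      hence *: "passage_time W b \<omega> \<le> a \<longleftrightarrow> \<omega> \<in> (\<Inter>n. hits b (1 / real (Suc n)))" if "\<omega> \<in> space M" for \<omega>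
        using that by simp
      have "(\<Inter>n. hits b (1 / real (Suc n))) \<subseteq> hits b (1 / real (Suc 0))" by (rule INT_lower) simp
      also have "\<dots> \<subseteq> space M" by (rule sets.sets_into_space[OF hits_sets[OF b]])
      finally have sub: "(\<Inter>n. hits b (1 / real (Suc n))) \<subseteq> space M" .
      have "passage_time W b -` {..a} \<inter> space M = (\<Inter>n. hits b (1 / real (Suc n)))"
      proof (intro set_eqI iffI)
        show "\<omega> \<in> (\<Inter>n. hits b (1 / real (Suc n)))" if "\<omega> \<in> passage_time W b -` {..a} \<inter> space M" for \<omega>
          by (subst *[symmetric]) (use that in simp_all)
        show "\<omega> \<in> passage_time W b -` {..a} \<inter> space M" if "\<omega> \<in> (\<Inter>n. hits b (1 / real (Suc n)))" for \<omega>
          using subsetD[OF sub that] *[THEN iffD2, OF _ that] by simp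
      qed
      thus ?thesis using hits_sets[OF b] by auto
    next
      case 3
      have "passage_time W b -` {..a} \<inter> space M = hits b r"
        using passage_time_le_iff[OF b _ 3] real by (auto simp: hits_def)
      thus ?thesis using hits_sets[OF b] by simp
    qed
  next
    case PInf
    hence "passage_time W b -` {..a} \<inter> space M = space M" by auto
    thus ?thesis by simp
  next
    case MInf
    have "\<not> passage_time W b \<omega> \<le> a" for \<omega>
      using order_trans[OF passage_time_nonneg, of b \<omega> a] MInf by auto
    hence "passage_time W b -` {..a} \<inter> space M = {}" by auto
    thus ?thesis by simp
  qed
qed

text \<open>Junk value \<open>0\<close> if the boundary is never reached.\<close>

definition passage_real :: "(real \<Rightarrow> real) \<Rightarrow> 'a \<Rightarrow> real" where
  "passage_real b \<omega> = real_of_ereal (passage_time W b \<omega>)"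

lemma passage_real_measurable:
  assumes b: "continuous_on {0<..} b"
  shows "passage_real b \<in> borel_measurable M"
proof -
  note [measurable] = passage_time_measurable[OF b]
  show ?thesis unfolding passage_real_def[abs_def] by measurable
qed

lemma hits_iff_passage_real:
  assumes b: "continuous_on {0<..} b" and \<omega>: "\<omega> \<in> space M" and pos: "0 < passage_time W b \<omega>" and r: "0 \<le> r"
  shows "\<omega> \<in> hits b r \<longleftrightarrow> passage_time W b \<omega> < \<infinity> \<and> passage_real b \<omega> \<le> r"
proof (cases "r = 0")
  case True
  thus ?thesis using pos by (cases "passage_time W b \<omega>") (auto simp: hits_def passage_real_def)
next
  case False
  hence "\<omega> \<in> hits b r \<longleftrightarrow> passage_time W b \<omega> \<le> ereal r" using passage_time_le_iff[OF b \<omega>] r by simp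
  thus ?thesis using pos by (cases "passage_time W b \<omega>") (auto simp: passage_real_def)
qed

lemma passage_real_pos:
  assumes "0 < passage_time W b \<omega>" "passage_time W b \<omega> < \<infinity>"
  shows "0 < passage_real b \<omega>" "passage_time W b \<omega> = ereal (passage_real b \<omega>)"
  using assms by (cases "passage_time W b \<omega>"; auto simp: passage_real_def)+

end

section \<open>Optional stopping by discretisation of the passage time\<close>

lemma heat_nn_0: "heat_nn f 0 x = ennreal (f x)"
proof -
  have "heat_nn f 0 x = (\<integral>\<^sup>+z. ennreal (f x) * ennreal (std_normal_density z) \<partial>lborel)"
    unfolding heat_nn_def by (simp add: ennreal_mult'')
  also have "\<dots> = ennreal (f x) * (\<integral>\<^sup>+z. ennreal (std_normal_density z) \<partial>lborel)" by (rule nn_integral_cmult) measurable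
  also have "(\<integral>\<^sup>+z. ennreal (std_normal_density z) \<partial>lborel) = 1"
    using nn_integral_eq_integral[OF integrable_std_normal_density] by (simp add: integral_normal_density)
  finally show ?thesis by simp
qed

lemma borel_measurable_heat_nn_pair:
  assumes [measurable]: "f \<in> borel_measurable borel" "S \<in> borel_measurable M" "X \<in> borel_measurable M"
  shows "(\<lambda>\<omega>. heat_nn f (S \<omega>) (X \<omega>)) \<in> borel_measurable M"
  unfolding heat_nn_def by measurable

text \<open>Cells are open on the left and closed on the right, matching differences of
  \<open>hits\<close>. The ceiling is the index of the right end, at least 1 because \<theta> is
  positive, so \<open>k\<close> is that index minus 1.\<close>

lemma grid_index_unique:
  fixes \<theta> T :: real
  assumes \<theta>: "0 < \<theta>" "\<theta> \<le> T"
  obtains k where "k < Suc m" "T * real (Suc k) / real (Suc m) = T * of_int \<lceil>\<theta> * real (Suc m) / T\<rceil> / real (Suc m)"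
    "\<And>j. (T * real j / real (Suc m) < \<theta> \<and> \<theta> \<le> T * real (Suc j) / real (Suc m)) \<longleftrightarrow> j = k"
proof -
  define N where "N = real (Suc m)"
  have N: "0 < N" by (simp add: N_def)
  define c where "c = \<lceil>\<theta> * N / T\<rceil>"
  have T: "0 < T" using \<theta> by simp
  have "0 < \<theta> * N / T" "\<theta> * N / T \<le> N" using \<theta> T N by (auto simp: pos_divide_le_eq mult.commute[of \<theta>])
  hence c: "0 < c" "c \<le> int (Suc m)" unfolding c_def by (simp_all add: ceiling_le_iff N_def)
  define k where "k = nat c - 1"
  have ck: "c = int (Suc k)" using c by (simp add: k_def)
  have "(T * real j / N < \<theta> \<and> \<theta> \<le> T * real (Suc j) / N) \<longleftrightarrow> j = k" for j
  proof -
    have "(T * real j / N < \<theta> \<and> \<theta> \<le> T * real (Suc j) / N) \<longleftrightarrow> (of_int (int j) < \<theta> * N / T \<and> \<theta> * N / T \<le> of_int (int (Suc j)))"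
      using T N by (simp add: field_simps)
    also have "\<dots> \<longleftrightarrow> c = int (Suc j)" unfolding c_def by (simp add: ceiling_eq_iff)
    also have "\<dots> \<longleftrightarrow> j = k" using ck by auto
    finally show ?thesis .
  qed
  moreover have "k < Suc m" using ck c by simp
  moreover have "T * real (Suc k) / N = T * of_int c / N" using ck by simp
  ultimately show ?thesis using that unfolding N_def c_def by blast
qed

lemma grid_approx_tendsto:
  fixes \<theta> T :: real
  assumes T: "0 < T"
  shows "(\<lambda>m. T * of_int \<lceil>\<theta> * real (Suc m) / T\<rceil> / real (Suc m)) \<longlonglongrightarrow> \<theta>"
proof (rule tendsto_sandwich)
  have "\<theta> \<le> T * of_int \<lceil>\<theta> * real (Suc m) / T\<rceil> / real (Suc m)" for m
  proof -
    have "\<theta> * real (Suc m) / T \<le> of_int \<lceil>\<theta> * real (Suc m) / T\<rceil>" by (rule le_of_int_ceiling)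
    hence "T * (\<theta> * real (Suc m) / T) \<le> T * of_int \<lceil>\<theta> * real (Suc m) / T\<rceil>"
      using T by (intro mult_left_mono) auto
    hence "\<theta> * real (Suc m) \<le> T * of_int \<lceil>\<theta> * real (Suc m) / T\<rceil>" using T by simp
    thus ?thesis by (subst pos_le_divide_eq) auto
  qed
  thus "eventually (\<lambda>m. \<theta> \<le> T * of_int \<lceil>\<theta> * real (Suc m) / T\<rceil> / real (Suc m)) sequentially" by simp
  have "T * of_int \<lceil>\<theta> * real (Suc m) / T\<rceil> / real (Suc m) \<le> \<theta> + T * inverse (real (Suc m))" for m
  proof -
    have "of_int \<lceil>\<theta> * real (Suc m) / T\<rceil> \<le> \<theta> * real (Suc m) / T + 1" using of_int_ceiling_le_add_one by blast
    hence "T * of_int \<lceil>\<theta> * real (Suc m) / T\<rceil> / real (Suc m) \<le> T * (\<theta> * real (Suc m) / T + 1) / real (Suc m)"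
      using T by (intro divide_right_mono mult_left_mono) auto
    also have "T * (\<theta> * real (Suc m) / T + 1) = \<theta> * real (Suc m) + T" using T by (simp add: distrib_left del: of_nat_Suc)
    also have "(\<theta> * real (Suc m) + T) / real (Suc m) = \<theta> + T * inverse (real (Suc m))"
      by (subst add_divide_distrib) (simp add: inverse_eq_divide del: of_nat_Suc)
    finally show ?thesis .
  qed
  thus "eventually (\<lambda>m. T * of_int \<lceil>\<theta> * real (Suc m) / T\<rceil> / real (Suc m) \<le> \<theta> + T * inverse (real (Suc m))) sequentially" by simp
  show "(\<lambda>m. \<theta> + T * inverse (real (Suc m))) \<longlonglongrightarrow> \<theta>"
    using tendsto_add[OF tendsto_const tendsto_mult[OF tendsto_const LIMSEQ_inverse_real_of_nat], of \<theta> T] by simp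
qed simp


context standard_brownian_motion begin

text \<open>Restricts the identity to first contact in \<open>(r', r]\<close>; subtraction is
  legitimate because \<open>g\<close> is bounded. At \<open>r = T\<close> no increment is left and
  \<open>heat_nn g 0\<close> is evaluation.\<close>

lemma markov_hits_diff:
  assumes b: "continuous_on {0<..} b" and r: "0 \<le> r'" "r' \<le> r" "0 < r" "r \<le> T"
    and g[measurable]: "g \<in> borel_measurable borel" and g0: "\<And>z. 0 \<le> g z" and gB: "\<And>z. g z \<le> B"
  shows "(\<integral>\<^sup>+\<omega>. indicator (hits b r - hits b r') \<omega> * ennreal (g (y - W T \<omega>)) \<partial>M) =
    (\<integral>\<^sup>+\<omega>. indicator (hits b r - hits b r') \<omega> * heat_nn g (T - r) (y - W r \<omega>) \<partial>M)"
proof (cases "r = T")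
  case True
  thus ?thesis by (simp add: heat_nn_0)
next
  case False
  have [measurable]: "W T \<in> borel_measurable M" "W r \<in> borel_measurable M" using measurable_W r by auto
  have [measurable]: "(\<lambda>x. heat_nn g (T - r) x) \<in> borel_measurable borel" by (rule borel_measurable_heat_nn) measurable
  note [measurable] = hits_sets[OF b]
  let ?f1 = "\<lambda>\<omega>. ennreal (g (y - W T \<omega>))" and ?f2 = "\<lambda>\<omega>. heat_nn g (T - r) (y - W r \<omega>)"
  let ?m1 = "density M ?f1" and ?m2 = "density M ?f2"
  have eq: "emeasure ?m1 (hits b s) = emeasure ?m2 (hits b s)" if "0 \<le> s" "s \<le> r" for s
  proof (cases "s = 0")
    case True
    hence "hits b s = {}" by (auto simp: hits_def)
    thus ?thesis by simp
  next
    case s: False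
    show ?thesis by (rule markov_hits[OF b _ that(2) _ g g0 gB]) (use s that False r in auto)
  qed
  have sub: "hits b r' \<subseteq> hits b r" using r by (force simp: hits_def)
  have fin: "emeasure ?m1 (hits b r') \<noteq> \<infinity>"
  proof -
    have "emeasure ?m1 (hits b r') = (\<integral>\<^sup>+\<omega>. ?f1 \<omega> * indicator (hits b r') \<omega> \<partial>M)" by (rule emeasure_density) measurable
    also have "\<dots> \<le> (\<integral>\<^sup>+\<omega>. ennreal B \<partial>M)"
      using gB by (intro nn_integral_mono) (auto simp: indicator_def intro: ennreal_leI)
    also have "\<dots> < \<infinity>" by (simp add: emeasure_space_1)
    finally show ?thesis by simp
  qed
  have "emeasure ?m1 (hits b r - hits b r') = emeasure ?m2 (hits b r - hits b r')"
    using eq[of r] eq[of r'] r fin sub hits_sets[OF b] by (simp add: emeasure_Diff)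
  thus ?thesis using hits_sets[OF b] by (simp add: emeasure_density mult.commute)
qed

text \<open>The passage time is approximated from above on a uniform grid; boundedness of \<open>g\<close> permits dominated convergence.\<close>

lemma stopped_bounded:
  assumes b: "continuous_on {0<..} b" and pos: "AE \<omega> in M. 0 < passage_time W b \<omega>" and T: "0 < T"
    and g: "continuous_on UNIV g" and g0: "\<And>z. 0 \<le> g z" and gB: "\<And>z. g z \<le> B"
  shows "(\<integral>\<^sup>+\<omega>. indicator (hits b T) \<omega> * ennreal (g (y - W T \<omega>)) \<partial>M) =
    (\<integral>\<^sup>+\<omega>. indicator (hits b T) \<omega> * heat_nn g (T - passage_real b \<omega>) (y - indicator {0<..} (passage_real b \<omega>) * b (passage_real b \<omega>)) \<partial>M)"
proof -
  \<comment> \<open>\<open>b\<close> is arbitrary on non-positive times; the indicator makes it measurable.\<close>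
  have gm[measurable]: "g \<in> borel_measurable borel" using g by (rule borel_measurable_continuous_onI)
  note [measurable] = hits_sets[OF b] passage_real_measurable[OF b]
  let ?\<theta> = "passage_real b"
  define b' where "b' = (\<lambda>s. indicator {0<..} s * b s :: real)"
  have [measurable]: "b' \<in> borel_measurable borel"
    unfolding b'_def using borel_measurable_continuous_on_indicator[OF _ b] by simp
  define r where "r = (\<lambda>m k :: nat. T * real k / real (Suc m))"
  have r: "0 \<le> r m k" "r m k \<le> r m (Suc k)" "0 < r m (Suc k)" for m k using T by (auto simp: r_def divide_simps add_pos_nonneg)
  have rT: "r m k \<le> T" if "k \<le> Suc m" for m k
  proof -
    have "T * real k \<le> T * real (Suc m)" using that T by (intro mult_left_mono) auto
    thus ?thesis unfolding r_def by (subst pos_divide_le_eq) auto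
  qed
  define \<rho> where "\<rho> = (\<lambda>m \<omega>. T * of_int \<lceil>?\<theta> \<omega> * real (Suc m) / T\<rceil> / real (Suc m))"
  let ?D = "\<lambda>m k. hits b (r m (Suc k)) - hits b (r m k)"
  \<comment> \<open>\<open>Sg m \<omega> c\<close> is the value of \<open>c\<close> at the cell
    containing the passage time, and 0 without a hit. It writes evaluation at a random grid time as
    a finite sum that can be integrated term by term.\<close>
  define Sg :: "nat \<Rightarrow> 'a \<Rightarrow> (nat \<Rightarrow> ennreal) \<Rightarrow> ennreal"
    where "Sg = (\<lambda>m \<omega> c. \<Sum>j<Suc m. indicator (?D m j) \<omega> * c j)"
  have hit_grid: "\<exists>k. r m (Suc k) = \<rho> m \<omega> \<and> (\<forall>c. Sg m \<omega> c = c k)"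
    if "\<omega> \<in> hits b T" "0 < passage_time W b \<omega>" "\<omega> \<in> space M" for \<omega> m
  proof -
    note hit = hits_iff_passage_real[OF b that(3,2)]
    have fin: "passage_time W b \<omega> < \<infinity>" "?\<theta> \<omega> \<le> T" using hit[of T] T that(1) by auto
    have \<theta>: "0 < ?\<theta> \<omega>" using passage_real_pos[OF that(2) fin(1)] by simp
    obtain k where k: "k < Suc m" "r m (Suc k) = \<rho> m \<omega>" "\<And>j. (r m j < ?\<theta> \<omega> \<and> ?\<theta> \<omega> \<le> r m (Suc j)) \<longleftrightarrow> j = k"
      using grid_index_unique[OF \<theta> fin(2), of m] unfolding r_def \<rho>_def by blast
    have "\<omega> \<in> ?D m j \<longleftrightarrow> j = k" for j
      unfolding Diff_iff hit[OF r(1)] using fin(1) k(3)[of j] by (metis not_le)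
    hence ind: "indicator (?D m j) \<omega> = (if j = k then 1 else 0 :: ennreal)" for j by (simp add: indicator_def)
    have "Sg m \<omega> c = c k" for c
    proof -
      have "Sg m \<omega> c = (\<Sum>j<Suc m. if j = k then c j else 0)"
        unfolding Sg_def ind by (intro sum.cong) auto
      also have "\<dots> = c k" using k(1) by (subst sum.delta) auto
      finally show ?thesis .
    qed
    thus ?thesis using k(2) by blast
  qed
  have no_hit_grid: "Sg m \<omega> c = 0" if "\<omega> \<notin> hits b T" for \<omega> m c
    unfolding Sg_def
  proof (intro sum.neutral ballI)
    fix j assume "j \<in> {..<Suc m}"
    hence "r m (Suc j) \<le> T" by (intro rT) simp
    hence "hits b (r m (Suc j)) \<subseteq> hits b T" by (force simp: hits_def)
    hence "\<omega> \<notin> ?D m j" using that by blast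
    thus "indicator (?D m j) \<omega> * c j = 0" by (simp add: indicator_def)
  qed
  let ?c = "\<lambda>m \<omega> j. heat_nn g (T - r m (Suc j)) (y - W (r m (Suc j)) \<omega>)"
  let ?\<Phi> = "\<lambda>m \<omega>. Sg m \<omega> (?c m \<omega>)"
  have Wm[measurable]: "W T \<in> borel_measurable M" "W (r m k) \<in> borel_measurable M" for m k using measurable_W T r by auto
  have hm[measurable]: "(\<lambda>x. heat_nn g s x) \<in> borel_measurable borel" for s by (rule borel_measurable_heat_nn) measurable
  \<comment> \<open>The left side does not depend on \<open>m\<close>, so the limit over grids
    identifies it.\<close>
  have eq: "(\<integral>\<^sup>+\<omega>. indicator (hits b T) \<omega> * ennreal (g (y - W T \<omega>)) \<partial>M) = (\<integral>\<^sup>+\<omega>. ?\<Phi> m \<omega> \<partial>M)" for m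
  proof -
    have "(\<integral>\<^sup>+\<omega>. indicator (hits b T) \<omega> * ennreal (g (y - W T \<omega>)) \<partial>M)
      = (\<integral>\<^sup>+\<omega>. Sg m \<omega> (\<lambda>_. ennreal (g (y - W T \<omega>))) \<partial>M)"
    proof (rule nn_integral_cong_AE)
      show "AE \<omega> in M. indicator (hits b T) \<omega> * ennreal (g (y - W T \<omega>)) = Sg m \<omega> (\<lambda>_. ennreal (g (y - W T \<omega>)))"
        using pos AE_space
      proof eventually_elim
        case (elim \<omega>)
        show ?case
        proof (cases "\<omega> \<in> hits b T")
          case True
          then obtain k where "\<forall>c. Sg m \<omega> c = c k" using hit_grid[OF _ elim, of m] by blast
          thus ?thesis using True by simp
        qed (simp add: no_hit_grid)
      qed
    qed
    also have "\<dots> = (\<Sum>j<Suc m. \<integral>\<^sup>+\<omega>. indicator (?D m j) \<omega> * ennreal (g (y - W T \<omega>)) \<partial>M)"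
      unfolding Sg_def by (rule nn_integral_sum) measurable
    also have "\<dots> = (\<Sum>j<Suc m. \<integral>\<^sup>+\<omega>. indicator (?D m j) \<omega> * heat_nn g (T - r m (Suc j)) (y - W (r m (Suc j)) \<omega>) \<partial>M)"
      by (intro sum.cong refl markov_hits_diff[OF b _ _ _ _ gm g0 gB]) (use r rT in auto)
    also have "\<dots> = (\<integral>\<^sup>+\<omega>. ?\<Phi> m \<omega> \<partial>M)"
      unfolding Sg_def by (rule nn_integral_sum[symmetric]) measurable
    finally show ?thesis .
  qed
  have heat_B: "heat_nn g s x \<le> ennreal B" for s x
    using heat_le[OF gm g0 gB] by (subst heat_nn_eq_heat[OF gm g0 gB]) (auto intro: ennreal_leI)
  let ?L = "\<lambda>\<omega>. indicator (hits b T) \<omega> * heat_nn g (T - ?\<theta> \<omega>) (y - b' (?\<theta> \<omega>))"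
  have "(\<lambda>m. \<integral>\<^sup>+\<omega>. ?\<Phi> m \<omega> \<partial>M) \<longlonglongrightarrow> (\<integral>\<^sup>+\<omega>. ?L \<omega> \<partial>M)"
  proof (rule nn_integral_dominated_convergence[where w="\<lambda>_. ennreal B"])
    show "?\<Phi> m \<in> borel_measurable M" for m unfolding Sg_def by measurable
    show "?L \<in> borel_measurable M"
      by (intro borel_measurable_times_ennreal borel_measurable_heat_nn_pair) measurable
    show "AE \<omega> in M. ?\<Phi> m \<omega> \<le> ennreal B" for m
      using pos AE_space
    proof eventually_elim
      case (elim \<omega>)
      show ?case
      proof (cases "\<omega> \<in> hits b T")
        case True
        then obtain k where "\<forall>c. Sg m \<omega> c = c k" using hit_grid[OF _ elim, of m] by blast
        thus ?thesis using heat_B by simp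
      qed (simp add: no_hit_grid)
    qed
    show "(\<integral>\<^sup>+\<omega>. ennreal B \<partial>M) < \<infinity>" by (simp add: emeasure_space_1)
    show "AE \<omega> in M. (\<lambda>m. ?\<Phi> m \<omega>) \<longlonglongrightarrow> ?L \<omega>"
      using pos AE_space
    proof eventually_elim
      case (elim \<omega>)
      show ?case
      proof (cases "\<omega> \<in> hits b T")
        case False
        thus ?thesis by (simp add: no_hit_grid)
      next
        case True
        hence fin: "passage_time W b \<omega> < \<infinity>" "?\<theta> \<omega> \<le> T" using hits_iff_passage_real[OF b elim(2,1), of T] T by auto
        have \<theta>: "0 < ?\<theta> \<omega>" "passage_time W b \<omega> = ereal (?\<theta> \<omega>)" using passage_real_pos[OF elim(1) fin(1)] by simp_all
        have W\<theta>: "W (?\<theta> \<omega>) \<omega> = b' (?\<theta> \<omega>)" using at_passage_time[OF b elim(2) \<theta>] \<theta>(1) by (simp add: b'_def)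
        have \<Phi>: "?\<Phi> m \<omega> = heat_nn g (T - \<rho> m \<omega>) (y - W (\<rho> m \<omega>) \<omega>)" for m
        proof -
          obtain k where k: "r m (Suc k) = \<rho> m \<omega>" "\<And>c. Sg m \<omega> c = c k"
            using hit_grid[OF True elim] by blast
          show ?thesis unfolding k ..
        qed
        have lim: "(\<lambda>m. \<rho> m \<omega>) \<longlonglongrightarrow> ?\<theta> \<omega>" unfolding \<rho>_def using T by (rule grid_approx_tendsto)
        have "0 \<le> ?\<theta> \<omega> * real (Suc m) / T" for m using \<theta> T by simp
        hence "(0::real) \<le> of_int \<lceil>?\<theta> \<omega> * real (Suc m) / T\<rceil>" for m using le_of_int_ceiling order_trans by blast
        hence \<rho>0: "0 \<le> \<rho> m \<omega>" for m unfolding \<rho>_def using T by (intro divide_nonneg_nonneg mult_nonneg_nonneg) auto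
        have limW: "(\<lambda>m. W (\<rho> m \<omega>) \<omega>) \<longlonglongrightarrow> b' (?\<theta> \<omega>)"
          unfolding W\<theta>[symmetric]
          by (rule continuous_on_tendsto_compose[OF continuous_paths[OF elim(2)] lim]) (use \<theta> \<rho>0 in auto)
        \<comment> \<open>Continuity down to time 0 is essential, as the passage time may equal
          \<open>T\<close>.\<close>
        have "continuous_on UNIV (\<lambda>(s,x). heat g s x)"
          by (rule continuous_on_heat[OF g, of B]) (use g0 gB in auto)
        hence "(\<lambda>m. (\<lambda>(s,x). heat g s x) (T - \<rho> m \<omega>, y - W (\<rho> m \<omega>) \<omega>)) \<longlonglongrightarrow> (\<lambda>(s,x). heat g s x) (T - ?\<theta> \<omega>, y - b' (?\<theta> \<omega>))"
          by (rule continuous_on_tendsto_compose) (auto intro!: tendsto_intros lim limW)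
        hence "(\<lambda>m. ennreal (heat g (T - \<rho> m \<omega>) (y - W (\<rho> m \<omega>) \<omega>))) \<longlonglongrightarrow> ennreal (heat g (T - ?\<theta> \<omega>) (y - b' (?\<theta> \<omega>)))"
          by (intro tendsto_ennrealI) simp
        thus ?thesis unfolding \<Phi> using True by (simp add: heat_nn_eq_heat[OF gm g0 gB])
      qed
    qed
  qed auto
  hence "(\<lambda>m::nat. (\<integral>\<^sup>+\<omega>. indicator (hits b T) \<omega> * ennreal (g (y - W T \<omega>)) \<partial>M)) \<longlonglongrightarrow> (\<integral>\<^sup>+\<omega>. ?L \<omega> \<partial>M)"
    unfolding eq[symmetric] .
  thus ?thesis unfolding b'_def by (rule LIMSEQ_const_iff[THEN iffD1])
qed

lemma nn_integral_marginal:
  assumes T: "0 < T" and g[measurable]: "g \<in> borel_measurable borel" and g0: "\<And>z. 0 \<le> g z"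
  shows "(\<integral>\<^sup>+\<omega>. ennreal (g (y - W T \<omega>)) \<partial>M) = heat_nn g T y"
proof -
  have [measurable]: "W T \<in> borel_measurable M" "W 0 \<in> borel_measurable M" using measurable_W T by auto
  have "(\<integral>\<^sup>+\<omega>. ennreal (g (y - W T \<omega>)) \<partial>M) = (\<integral>\<^sup>+\<omega>. ennreal (g (y - (W T \<omega> - W 0 \<omega>))) \<partial>M)"
    using start_zero by (intro nn_integral_cong) simp
  also have "\<dots> = (\<integral>\<^sup>+z. ennreal (g (y - z)) \<partial>distr M borel (\<lambda>\<omega>. W T \<omega> - W 0 \<omega>))"
    by (rule nn_integral_distr[symmetric]) measurable
  also have "\<dots> = heat_nn g T y" using nn_integral_increment[of 0 T g y] T g0 by simp
  finally show ?thesis .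
qed

text \<open>Truncation at \<open>n\<close> and monotone convergence remove the bound on
  \<open>g\<close>. All terms are non-negative, so no integrability has to be known in
  advance.\<close>

lemma stopped_identity:
  assumes b: "continuous_on {0<..} b" and pos: "AE \<omega> in M. 0 < passage_time W b \<omega>" and T: "0 < T"
    and f: "continuous_on UNIV f" and f0: "\<And>z. 0 \<le> f z"
  shows "heat_nn f T y =
    (\<integral>\<^sup>+\<omega>. indicator (hits b T) \<omega> * heat_nn f (T - passage_real b \<omega>) (y - indicator {0<..} (passage_real b \<omega>) * b (passage_real b \<omega>)) \<partial>M) +
    (\<integral>\<^sup>+\<omega>. indicator (space M - hits b T) \<omega> * ennreal (f (y - W T \<omega>)) \<partial>M)"
proof -
  let ?g = "\<lambda>n::nat. \<lambda>z. min (f z) (real n)"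
  have fm[measurable]: "f \<in> borel_measurable borel" using f by (rule borel_measurable_continuous_onI)
  have cg: "continuous_on UNIV (?g n)" for n using f by (intro continuous_intros)
  note [measurable] = hits_sets[OF b] passage_real_measurable[OF b]
  have Wm[measurable]: "W T \<in> borel_measurable M" using measurable_W T by auto
  define b' where "b' = (\<lambda>s. indicator {0<..} s * b s :: real)"
  have [measurable]: "b' \<in> borel_measurable borel"
    unfolding b'_def using borel_measurable_continuous_on_indicator[OF _ b] by simp
  have heat_SUP: "heat_nn f s x = (SUP n. heat_nn (?g n) s x)" for s x
  proof (rule heat_nn_SUP)
    show "(\<lambda>n. ?g n z) \<longlonglongrightarrow> f z" for z
    proof (rule tendsto_eventually)
      show "eventually (\<lambda>n. ?g n z = f z) sequentially"
        using eventually_ge_at_top[of "nat \<lceil>f z\<rceil>"] by eventually_elim (simp add: nat_ceiling_le_eq)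
    qed
  qed auto
  have heat_inc: "incseq (\<lambda>n. heat_nn (?g n) s x)" for s x
    by (intro incseq_SucI heat_nn_mono) auto
  let ?H = "indicator (hits b T) :: 'a \<Rightarrow> ennreal"
  have 1: "(\<integral>\<^sup>+\<omega>. ?H \<omega> * ennreal (f (y - W T \<omega>)) \<partial>M) = (\<integral>\<^sup>+\<omega>. ?H \<omega> * heat_nn f (T - passage_real b \<omega>) (y - b' (passage_real b \<omega>)) \<partial>M)"
  proof -
    have "(\<integral>\<^sup>+\<omega>. ?H \<omega> * heat_nn f (T - passage_real b \<omega>) (y - b' (passage_real b \<omega>)) \<partial>M)
      = (\<integral>\<^sup>+\<omega>. (SUP n. ?H \<omega> * heat_nn (?g n) (T - passage_real b \<omega>) (y - b' (passage_real b \<omega>))) \<partial>M)"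
      by (simp add: heat_SUP SUP_mult_left_ennreal)
    also have "\<dots> = (SUP n. \<integral>\<^sup>+\<omega>. ?H \<omega> * heat_nn (?g n) (T - passage_real b \<omega>) (y - b' (passage_real b \<omega>)) \<partial>M)"
    proof (rule nn_integral_monotone_convergence_SUP)
      show "(\<lambda>\<omega>. ?H \<omega> * heat_nn (?g n) (T - passage_real b \<omega>) (y - b' (passage_real b \<omega>))) \<in> borel_measurable M" for n
        by (intro borel_measurable_times_ennreal borel_measurable_heat_nn_pair) measurable
      show "incseq (\<lambda>n \<omega>. ?H \<omega> * heat_nn (?g n) (T - passage_real b \<omega>) (y - b' (passage_real b \<omega>)))"
        by (intro incseq_SucI le_funI mult_left_mono incseq_SucD[OF heat_inc]) auto
    qed
    also have "\<dots> = (SUP n. \<integral>\<^sup>+\<omega>. ?H \<omega> * ennreal (?g n (y - W T \<omega>)) \<partial>M)"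
    proof (rule SUP_cong[OF refl])
      fix n
      show "(\<integral>\<^sup>+\<omega>. ?H \<omega> * heat_nn (?g n) (T - passage_real b \<omega>) (y - b' (passage_real b \<omega>)) \<partial>M)
        = (\<integral>\<^sup>+\<omega>. ?H \<omega> * ennreal (?g n (y - W T \<omega>)) \<partial>M)"
        unfolding b'_def by (rule stopped_bounded[OF b pos T cg, where B="real n", symmetric]) (use f0 in auto)
    qed
    also have "\<dots> = (\<integral>\<^sup>+\<omega>. (SUP n. ?H \<omega> * ennreal (?g n (y - W T \<omega>))) \<partial>M)"
      by (intro nn_integral_monotone_convergence_SUP[symmetric] incseq_SucI le_funI mult_left_mono ennreal_leI) auto
    also have "\<dots> = (\<integral>\<^sup>+\<omega>. ?H \<omega> * ennreal (f (y - W T \<omega>)) \<partial>M)"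
      \<comment> \<open>At time 0 the semigroup is evaluation, so the same supremum formula serves
        for \<open>f\<close> itself.\<close>
      using heat_SUP[of 0] by (simp add: heat_nn_0 SUP_mult_left_ennreal[symmetric])
    finally show ?thesis by simp
  qed
  have "heat_nn f T y = (\<integral>\<^sup>+\<omega>. ennreal (f (y - W T \<omega>)) \<partial>M)" by (rule nn_integral_marginal[OF T fm f0, symmetric])
  also have "\<dots> = (\<integral>\<^sup>+\<omega>. ?H \<omega> * ennreal (f (y - W T \<omega>)) + indicator (space M - hits b T) \<omega> * ennreal (f (y - W T \<omega>)) \<partial>M)"
    by (intro nn_integral_cong) (auto simp: indicator_def)
  also have "\<dots> = (\<integral>\<^sup>+\<omega>. ?H \<omega> * ennreal (f (y - W T \<omega>)) \<partial>M) + (\<integral>\<^sup>+\<omega>. indicator (space M - hits b T) \<omega> * ennreal (f (y - W T \<omega>)) \<partial>M)"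
    by (rule nn_integral_add) measurable
  finally show ?thesis unfolding 1 b'_def .
qed

end


section \<open>The integral equation\<close>

lemma interval_measure_cdf:
  assumes "finite_borel_measure N"
  shows "interval_measure (cdf N) = N"
proof -
  interpret finite_borel_measure N by fact
  have top: "((cdf N) \<longlongrightarrow> measure N (space N)) at_top" by (rule cdf_lim_at_top)
  have fb: "finite_borel_measure (interval_measure (cdf N))"
    by (rule finite_borel_measure_interval_measure[OF cdf_nondecreasing cdf_is_right_cont cdf_lim_at_bot top]) auto
  have "cdf (interval_measure (cdf N)) = cdf N"
    unfolding cdf_def[of "interval_measure (cdf N)"]
    using measure_interval_measure_Iic[OF cdf_nondecreasing cdf_is_right_cont cdf_lim_at_bot] by auto
  thus ?thesis by (intro cdf_unique'[OF fb assms])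
qed

text \<open>The Stieltjes measure of \<open>passage_cdf\<close> is the law of the passage time on
  the event that it is finite, because a finite Borel measure is determined by its distribution
  function. Its total mass may be less than 1.\<close>

lemma (in standard_brownian_motion) nn_integral_passage_cdf:
  assumes b: "continuous_on {0<..} b" and h[measurable]: "h \<in> borel_measurable borel"
  shows "(\<integral>\<^sup>+s. h s \<partial>interval_measure (passage_cdf M W b)) =
    (\<integral>\<^sup>+\<omega>. indicator {\<omega> \<in> space M. passage_time W b \<omega> < \<infinity>} \<omega> * h (passage_real b \<omega>) \<partial>M)"
proof -
  note [measurable] = passage_time_measurable[OF b] passage_real_measurable[OF b]
  define A where "A = {\<omega> \<in> space M. passage_time W b \<omega> < \<infinity>}"
  have A[measurable]: "A \<in> sets M" unfolding A_def by measurable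
  \<comment> \<open>Without the restriction to \<open>A\<close>, paths that never hit would put an
    atom at the default value 0 of \<open>passage_real\<close>.\<close>
  define N where "N = distr (density M (indicator A)) borel (passage_real b)"
  have eN: "emeasure N B = emeasure M (A \<inter> (passage_real b -` B \<inter> space M))" if "B \<in> sets borel" for B
    unfolding N_def using that
    by (subst emeasure_distr) (auto simp: emeasure_density indicator_inter_arith[symmetric] intro!: measurable_sets[OF passage_real_measurable[OF b]])
  have "finite_measure N" using eN[of UNIV] by (intro finite_measureI) (simp add: N_def)
  hence fN: "finite_borel_measure N" by (simp add: finite_borel_measure_def finite_borel_measure_axioms_def N_def)
  have "cdf N a = passage_cdf M W b a" for a
  proof -
    have "A \<inter> (passage_real b -` {..a} \<inter> space M) = {\<omega> \<in> space M. passage_time W b \<omega> \<le> ereal a}"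
    proof -
      have "passage_time W b \<omega> < \<infinity> \<and> passage_real b \<omega> \<le> a \<longleftrightarrow> passage_time W b \<omega> \<le> ereal a" for \<omega>
        using passage_time_nonneg[of b \<omega>] by (cases "passage_time W b \<omega>") (auto simp: passage_real_def)
      thus ?thesis by (auto simp: A_def)
    qed
    thus ?thesis using eN[of "{..a}"] by (simp add: cdf_def passage_cdf_def measure_def)
  qed
  hence "cdf N = passage_cdf M W b" by (rule ext)
  hence "interval_measure (passage_cdf M W b) = N"
    using interval_measure_cdf[OF fN] by simp
  thus ?thesis unfolding A_def[symmetric]
    by (simp add: N_def nn_integral_distr nn_integral_density)
qed

lemma heat_at_of_solves:
  assumes u: "solves_heat_equation \<delta> u" and s: "0 < s" "ereal s < \<delta>"
  shows "heat_at u s x"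
proof -
  have *: "(\<lambda>r. u r x) field_differentiable at s" "u s field_differentiable at x"
    "deriv (u s) field_differentiable at x" "deriv (\<lambda>r. u r x) s = 1 / 2 * deriv (deriv (u s)) x" for x
    using u s unfolding solves_heat_equation_def time_strip_def by auto
  show ?thesis
  proof (rule heat_atI)
    show "(u s has_real_derivative deriv (u s) z) (at z)" for z using *(2) by (simp add: field_differentiable_derivI)
    show "(deriv (u s) has_real_derivative deriv (deriv (u s)) x) (at x)" using *(3) by (simp add: field_differentiable_derivI)
    show "((\<lambda>r. u r x) has_real_derivative deriv (deriv (u s)) x / 2) (at s)"
      using field_differentiable_derivI[OF *(1)[of x]] *(4)[of x] by simp
  qed
qed

text \<open>Trading the kernel at \<open>t - \<epsilon>\<close> for the wider one at
  \<open>t' - \<epsilon>\<close> gains a Gaussian factor. The constants are uniform in \<epsilon>: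
  variances are bounded by \<open>t\<close> and \<open>t'\<close> in the exponent, and the smaller
  one is at least \<open>t / 2\<close> in the prefactor.\<close>

lemma normal_density_ratio:
  fixes t t' \<epsilon> y z :: real
  assumes t: "0 < \<epsilon>" "\<epsilon> \<le> t / 2" "t < t'"
  shows "normal_density y (sqrt (t - \<epsilon>)) z \<le>
    sqrt (2 * t' / t) * exp (- ((t' - t) / (2 * t * t') * (z - y)\<^sup>2)) * normal_density y (sqrt (t' - \<epsilon>)) z"
proof -
  let ?p = "t - \<epsilon>" and ?q = "t' - \<epsilon>"
  have p: "0 < ?p" "t / 2 \<le> ?p" "?p \<le> t" "0 < ?q" "?q \<le> t'" using t by auto
  have tt: "0 < t" using t by simp
  have "1 / sqrt (2 * pi * ?p) = sqrt (?q / ?p) * (1 / sqrt (2 * pi * ?q))"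
    using p by (simp add: real_sqrt_divide real_sqrt_mult)
  also have "\<dots> \<le> sqrt (2 * t' / t) * (1 / sqrt (2 * pi * ?q))"
  proof -
    have "?q / ?p \<le> t' / (t / 2)" using p tt by (intro frac_le) auto
    thus ?thesis using p by (intro mult_right_mono) (auto simp: mult.commute)
  qed
  finally have 1: "1 / sqrt (2 * pi * ?p) \<le> sqrt (2 * t' / t) * (1 / sqrt (2 * pi * ?q))" .
  have "(t' - t) / (2 * t * t') \<le> 1 / (2 * ?p) - 1 / (2 * ?q)"
  proof -
    have "(t' - t) / (2 * (t * t')) \<le> (t' - t) / (2 * (?p * ?q))"
      using p t tt by (intro divide_left_mono mult_left_mono mult_mono mult_pos_pos) auto
    also have "\<dots> = 1 / (2 * ?p) - 1 / (2 * ?q)" using p by (simp add: divide_simps) (simp add: algebra_simps)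
    finally show ?thesis by (simp add: mult.assoc)
  qed
  from mult_right_mono[OF this, of "(z - y)\<^sup>2"]
  have "- (z - y)\<^sup>2 / (2 * ?p) \<le> - ((t' - t) / (2 * t * t') * (z - y)\<^sup>2) + - (z - y)\<^sup>2 / (2 * ?q)"
    by (simp add: left_diff_distrib)
  hence 2: "exp (- (z - y)\<^sup>2 / (2 * ?p)) \<le> exp (- ((t' - t) / (2 * t * t') * (z - y)\<^sup>2)) * exp (- (z - y)\<^sup>2 / (2 * ?q))"
    by (simp only: exp_add[symmetric] exp_le_cancel_iff)
  have "1 / sqrt (2 * pi * ?p) * exp (- (z - y)\<^sup>2 / (2 * ?p)) \<le>
    (sqrt (2 * t' / t) * (1 / sqrt (2 * pi * ?q))) * (exp (- ((t' - t) / (2 * t * t') * (z - y)\<^sup>2)) * exp (- (z - y)\<^sup>2 / (2 * ?q)))"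
    by (rule mult_mono[OF 1 2]) (use p t tt in auto)
  thus ?thesis using p by (simp add: normal_density_def mult_ac)
qed

section \<open>Solutions on the time strip and their behaviour near time 0\<close>

locale positive_heat_solution =
  fixes \<delta> :: ereal and u :: "real \<Rightarrow> real \<Rightarrow> real"
  assumes cont: "continuous_on (time_strip \<delta>) (\<lambda>(s, x). u s x)"
    and nonneg: "\<And>s x. (s, x) \<in> time_strip \<delta> \<Longrightarrow> 0 \<le> u s x"
    and heat: "solves_heat_equation \<delta> u"
begin

lemma continuous_slice:
  assumes "0 < s" "ereal s < \<delta>"
  shows "continuous_on UNIV (u s)"
proof -
  have "continuous_on UNIV (\<lambda>x. (\<lambda>(s, x). u s x) (s, x))"
    by (rule continuous_on_compose2[OF cont]) (use assms in \<open>auto simp: time_strip_def intro!: continuous_intros\<close>)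
  thus ?thesis by simp
qed

lemma nonneg_slice: "0 < s \<Longrightarrow> ereal s < \<delta> \<Longrightarrow> 0 \<le> u s x"
  using nonneg by (simp add: time_strip_def)

lemma representation:
  assumes s: "0 < \<epsilon>" "\<epsilon> \<le> s" "ereal s < \<delta>"
  shows "ennreal (u s x) = heat_nn (u \<epsilon>) (s - \<epsilon>) x"
proof (cases "s = \<epsilon>")
  case True
  thus ?thesis by (simp add: heat_nn_0)
next
  case False
  \<comment> \<open>The representation needs room beyond \<open>s\<close>; it exists because the
    strip is open at \<delta>.\<close>
  obtain T where T: "ereal s < ereal T" "ereal T < \<delta>" using ereal_dense2[OF s(3)] by blast
  have lt: "ereal r < \<delta>" if "r \<le> T" for r using T(2) that by (metis ereal_less_eq(3) order_le_less_trans)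
  have "positive_caloric (T - \<epsilon>) (\<lambda>s. u (s + \<epsilon>))"
    unfolding positive_caloric_def
  proof (intro conjI allI impI)
    have "continuous_on ({0..T - \<epsilon>} \<times> UNIV) (\<lambda>p. (\<lambda>(s, x). u s x) (fst p + \<epsilon>, snd p))"
      by (rule continuous_on_compose2[OF cont]) (use s lt in \<open>auto simp: time_strip_def intro!: continuous_intros\<close>)
    thus "continuous_on ({0..T - \<epsilon>} \<times> UNIV) (\<lambda>(r, x). u (r + \<epsilon>) x)" by (simp add: case_prod_unfold)
    show "0 \<le> u (r + \<epsilon>) z" if "0 \<le> r" "r \<le> T - \<epsilon>" for r z using that s lt[of "r + \<epsilon>"] by (intro nonneg_slice) auto
    show "heat_at (\<lambda>s. u (s + \<epsilon>)) r z" if "0 < r" "r \<le> T - \<epsilon>" for r z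
      using heat_at_translate[of u r \<epsilon> z 0] heat_at_of_solves[OF heat, of "r + \<epsilon>" z] that s lt[of "r + \<epsilon>"] by simp
  qed
  from positive_caloric_representation[OF this, of "s - \<epsilon>" x] show ?thesis using s False T by simp
qed

text \<open>Compactness of \<open>[a, -c]\<close>: counterexamples at times tending to 0 would
  cluster at some \<open>(0, e)\<close> with \<open>e < 0\<close>, where the joint limit is
  0.\<close>

lemma uniform_small:
  assumes zero: "\<And>e. e < 0 \<Longrightarrow> ((\<lambda>(s, x). u s x) \<longlongrightarrow> 0) (at (0, e) within time_strip \<delta>)"
    and c: "0 < c" and \<eta>: "0 < \<eta>"
  shows "\<exists>d>0. \<forall>s z. 0 < s \<longrightarrow> s < d \<longrightarrow> ereal s < \<delta> \<longrightarrow> a \<le> z \<longrightarrow> z \<le> -c \<longrightarrow> u s z \<le> \<eta>"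
proof (rule ccontr)
  assume "\<not> ?thesis"
  hence H: "\<forall>d>0. \<exists>s z. 0 < s \<and> s < d \<and> ereal s < \<delta> \<and> a \<le> z \<and> z \<le> -c \<and> \<eta> < u s z" by (meson not_le)
  have "\<forall>n. \<exists>s z. 0 < s \<and> s < inverse (real (Suc n)) \<and> ereal s < \<delta> \<and> a \<le> z \<and> z \<le> -c \<and> \<eta> < u s z"
    using H by (intro allI) (meson inverse_positive_iff_positive of_nat_0_less_iff zero_less_Suc)
  then obtain s z where sz: "\<And>n. 0 < s n" "\<And>n. s n < inverse (real (Suc n))" "\<And>n. ereal (s n) < \<delta>"
    "\<And>n. a \<le> z n" "\<And>n. z n \<le> -c" "\<And>n. \<eta> < u (s n) (z n)" by metis
  have "seq_compact {a..-c}" by (simp add: compact_imp_seq_compact)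
  then obtain e k where e: "e \<in> {a..-c}" "strict_mono (k :: nat \<Rightarrow> nat)" "(z \<circ> k) \<longlonglongrightarrow> e"
    using sz(4,5) unfolding seq_compact_def by (metis atLeastAtMost_iff)
  have "s \<longlonglongrightarrow> 0"
    by (rule tendsto_sandwich[OF _ _ tendsto_const LIMSEQ_inverse_real_of_nat])
       (use sz in \<open>auto intro!: always_eventually less_imp_le\<close>)
  hence "(s \<circ> k) \<longlonglongrightarrow> 0" using e(2) by (rule LIMSEQ_subseq_LIMSEQ)
  hence X: "(\<lambda>n. (s (k n), z (k n))) \<longlonglongrightarrow> (0, e)" using tendsto_Pair[of "s \<circ> k"] e(3) by (simp add: comp_def)
  have "e < 0" using e c by simp
  from zero[OF this] have "((\<lambda>(s, x). u s x) \<circ> (\<lambda>n. (s (k n), z (k n)))) \<longlonglongrightarrow> 0"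
    unfolding tendsto_at_iff_sequentially using X sz by (auto simp: time_strip_def less_imp_neq[symmetric])
  hence "(\<lambda>n. u (s (k n)) (z (k n))) \<longlonglongrightarrow> 0" by (simp add: comp_def)
  hence "\<eta> \<le> 0" by (rule LIMSEQ_le_const) (use sz(6) in \<open>auto intro: less_imp_le\<close>)
  thus False using \<eta> by simp
qed

text \<open>The value at a time \<open>t' > t\<close> dominates the far tail; on compact parts of the negative half line the convergence is uniform.\<close>

lemma left_tail_vanishes:
  assumes zero: "\<And>e. e < 0 \<Longrightarrow> ((\<lambda>(s, x). u s x) \<longlongrightarrow> 0) (at (0, e) within time_strip \<delta>)"
    and c: "0 < c" and e: "0 < e" and t: "0 < t" "ereal t < \<delta>"
  shows "\<exists>d>0. \<forall>\<epsilon>. 0 < \<epsilon> \<longrightarrow> \<epsilon> < d \<longrightarrow> heat_nn (\<lambda>z. indicator {..< -c} z * u \<epsilon> z) (t - \<epsilon>) y \<le> ennreal e"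
proof -
  obtain t' where t': "t < t'" "ereal t' < \<delta>" using ereal_dense2[OF t(2)] by auto
  define U where "U = u t' y"
  have U: "0 \<le> U" unfolding U_def using t t' by (intro nonneg_slice) auto
  define K where "K = sqrt (2 * t' / t)"
  define \<kappa> where "\<kappa> = (t' - t) / (2 * t * t')"
  have K: "0 \<le> K" and \<kappa>: "0 < \<kappa>" using t t' by (auto simp: K_def \<kappa>_def)
  have "((\<lambda>R. K * exp (0 * R - \<kappa> * R\<^sup>2) * U) \<longlongrightarrow> K * 0 * U) at_top"
    by (intro tendsto_intros gaussian_decay \<kappa>)
  hence "eventually (\<lambda>R. K * exp (0 * R - \<kappa> * R\<^sup>2) * U < e / 2) at_top"
    using e by (intro order_tendstoD(2)[where y="K * 0 * U"]) auto
  hence "eventually (\<lambda>R. 0 \<le> R \<and> K * exp (0 * R - \<kappa> * R\<^sup>2) * U < e / 2) at_top"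
    using eventually_ge_at_top[of "0::real"] by eventually_elim simp
  \<comment> \<open>\<open>R\<close> is fixed before \<open>d0\<close>: the tail bound does not
    depend on \<epsilon>, and smallness near time 0 is then needed only on
    \<open>[y - R, -c]\<close>.\<close>
  then obtain R where R: "0 \<le> R" "K * exp (- (\<kappa> * R\<^sup>2)) * U < e / 2" by (auto simp: eventually_at_top_linorder)
  obtain d0 where d0: "d0 > 0" "\<And>s z. 0 < s \<Longrightarrow> s < d0 \<Longrightarrow> ereal s < \<delta> \<Longrightarrow> y - R \<le> z \<Longrightarrow> z \<le> -c \<Longrightarrow> u s z \<le> e / 2"
    using uniform_small[OF zero c, of "e / 2" "y - R"] e by auto
  define C where "C = K * exp (- (\<kappa> * R\<^sup>2))"
  have C: "0 \<le> C" using K by (simp add: C_def)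
  show ?thesis
  \<comment> \<open>The bound \<open>t / 2\<close> is what \<open>normal_density_ratio\<close> asks
    of \<epsilon>.\<close>
  proof (intro exI[of _ "min d0 (t / 2)"] conjI allI impI)
    show "0 < min d0 (t / 2)" using d0 t by simp
    fix \<epsilon> assume \<epsilon>: "0 < \<epsilon>" "\<epsilon> < min d0 (t / 2)"
    have "ereal \<epsilon> < ereal t" using \<epsilon> t by simp
    hence \<epsilon>\<delta>: "ereal \<epsilon> < \<delta>" using t(2) by (rule less_trans)
    have um[measurable]: "u \<epsilon> \<in> borel_measurable borel" using continuous_slice[OF \<epsilon>(1) \<epsilon>\<delta>] by (rule borel_measurable_continuous_onI)
    have u0: "0 \<le> u \<epsilon> z" for z using nonneg_slice[OF \<epsilon>(1) \<epsilon>\<delta>] .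
    have pt: "indicator {..< -c} z * u \<epsilon> z * normal_density y (sqrt (t - \<epsilon>)) z \<le>
        e / 2 * normal_density y (sqrt (t - \<epsilon>)) z + C * (u \<epsilon> z * normal_density y (sqrt (t' - \<epsilon>)) z)" for z
    proof (cases "z < -c")
      case False
      thus ?thesis using e C u0 by simp
    next
      case True
      show ?thesis
      proof (cases "y - R \<le> z")
        case near: True
        have "u \<epsilon> z \<le> e / 2" using d0(2)[of \<epsilon> z] \<epsilon> \<epsilon>\<delta> near True by simp
        hence "u \<epsilon> z * normal_density y (sqrt (t - \<epsilon>)) z \<le> e / 2 * normal_density y (sqrt (t - \<epsilon>)) z"
          by (intro mult_right_mono) auto
        moreover have "0 \<le> C * (u \<epsilon> z * normal_density y (sqrt (t' - \<epsilon>)) z)" using C u0 by simp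
        ultimately show ?thesis using True by simp
      next
        case far: False
        hence "R\<^sup>2 \<le> (z - y)\<^sup>2" using R(1) by (subst abs_le_square_iff[symmetric]) auto
        hence "K * exp (- (\<kappa> * (z - y)\<^sup>2)) \<le> C" unfolding C_def using K \<kappa> by (intro mult_left_mono) auto
        hence "normal_density y (sqrt (t - \<epsilon>)) z \<le> C * normal_density y (sqrt (t' - \<epsilon>)) z"
          using normal_density_ratio[of \<epsilon> t t' y z] \<epsilon> t'(1) unfolding K_def \<kappa>_def
          by (meson mult_right_mono normal_density_nonneg order_trans less_imp_le min_less_iff_conj)
        from mult_left_mono[OF this u0[of z]]
        have "u \<epsilon> z * normal_density y (sqrt (t - \<epsilon>)) z \<le> C * (u \<epsilon> z * normal_density y (sqrt (t' - \<epsilon>)) z)"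
          by (simp add: mult.left_commute)
        moreover have "0 \<le> e / 2 * normal_density y (sqrt (t - \<epsilon>)) z" using e by simp
        ultimately show ?thesis using True by simp
      qed
    qed
    have te: "0 < t - \<epsilon>" "0 < t' - \<epsilon>" using \<epsilon> t t' by auto
    have "heat_nn (\<lambda>z. indicator {..< -c} z * u \<epsilon> z) (t - \<epsilon>) y
      = (\<integral>\<^sup>+z. ennreal (indicator {..< -c} z * u \<epsilon> z * normal_density y (sqrt (t - \<epsilon>)) z) \<partial>lborel)"
      by (rule heat_nn_density[OF te(1)]) measurable
    also have "\<dots> \<le> (\<integral>\<^sup>+z. ennreal (e / 2) * ennreal (normal_density y (sqrt (t - \<epsilon>)) z) + ennreal C * ennreal (u \<epsilon> z * normal_density y (sqrt (t' - \<epsilon>)) z) \<partial>lborel)"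
    proof (rule nn_integral_mono)
      fix z
      show "ennreal (indicator {..< -c} z * u \<epsilon> z * normal_density y (sqrt (t - \<epsilon>)) z) \<le>
        ennreal (e / 2) * ennreal (normal_density y (sqrt (t - \<epsilon>)) z) + ennreal C * ennreal (u \<epsilon> z * normal_density y (sqrt (t' - \<epsilon>)) z)"
        using ennreal_leI[OF pt[of z]] e C u0 by (simp add: ennreal_mult ennreal_plus del: times_divide_eq_left)
    qed
    also have "\<dots> = ennreal (e / 2) * (\<integral>\<^sup>+z. ennreal (normal_density y (sqrt (t - \<epsilon>)) z) \<partial>lborel) + ennreal C * (\<integral>\<^sup>+z. ennreal (u \<epsilon> z * normal_density y (sqrt (t' - \<epsilon>)) z) \<partial>lborel)"
      by (subst nn_integral_add) (auto simp: nn_integral_cmult)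
    also have "(\<integral>\<^sup>+z. ennreal (normal_density y (sqrt (t - \<epsilon>)) z) \<partial>lborel) = 1"
      using nn_integral_eq_integral[of lborel "normal_density y (sqrt (t - \<epsilon>))"] te by (simp add: integrable_normal_density integral_normal_density)
    also have "(\<integral>\<^sup>+z. ennreal (u \<epsilon> z * normal_density y (sqrt (t' - \<epsilon>)) z) \<partial>lborel) = ennreal U"
      unfolding U_def using representation[of \<epsilon> t' y] heat_nn_density[OF te(2) um, of y] \<epsilon> t' te by simp
    also have "ennreal (e / 2) * 1 + ennreal C * ennreal U = ennreal (e / 2 + C * U)"
      using e C U by (simp add: ennreal_mult ennreal_plus)
    also have "\<dots> \<le> ennreal e" using R(2) by (intro ennreal_leI) (simp add: C_def)
    finally show "heat_nn (\<lambda>z. indicator {..< -c} z * u \<epsilon> z) (t - \<epsilon>) y \<le> ennreal e" .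
  qed
qed

end


text \<open>Integrability is part of the conclusion because the Lebesgue integral of a
  non-integrable function is 0 by convention, so the equation alone would say less.\<close>

theorem mainTheorem6:
  fixes M :: "'a measure" and W :: "real \<Rightarrow> 'a \<Rightarrow> real"
    and b :: "real \<Rightarrow> real" and b0 :: ereal
    and \<delta> :: ereal and u :: "real \<Rightarrow> real \<Rightarrow> real"
    and t y :: real
  assumes "standard_brownian_motion M W"
    and "continuous_on {0<..} b"
    and "((\<lambda>t. ereal (b t)) \<longlongrightarrow> b0) (at_right 0)"
    and "b0 \<le> 0"
    and "measure M {\<omega> \<in> space M. passage_time W b \<omega> = 0} = 0"
    and "b0 = -\<infinity> \<Longrightarrow> \<exists>\<epsilon>>0. mono_on {0<..\<epsilon>} b"
    and "0 < \<delta>"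
    and "continuous_on (time_strip \<delta>) (\<lambda>(s, x). u s x)"
    and "\<And>s x. (s, x) \<in> time_strip \<delta> \<Longrightarrow> 0 \<le> u s x"
    and "solves_heat_equation \<delta> u"
    and "\<And>e. e < 0 \<Longrightarrow> ((\<lambda>(s, x). u s x) \<longlongrightarrow> 0) (at (0, e) within time_strip \<delta>)"
    and "0 < t" and "ereal t < \<delta>" and "y < b t"
  shows "set_integrable (interval_measure (passage_cdf M W b)) {0<..t}
           (\<lambda>s. if s < t then u (t - s) (y - b s) else 0) \<and>
         u t y = (LINT s:{0<..t}|interval_measure (passage_cdf M W b).
           (if s < t then u (t - s) (y - b s) else 0))"
proof -
  interpret standard_brownian_motion M W by fact
  interpret positive_heat_solution \<delta> u by standard fact+
  note b = assms(2) and zero = assms(11) and t = assms(12,13) and y = assms(14)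
  note [measurable] = passage_time_measurable[OF b] passage_real_measurable[OF b] hits_sets[OF b]
  let ?\<theta> = "passage_real b"
  have lt\<delta>: "ereal s < \<delta>" if "s \<le> t" for s using t(2) that by (metis ereal_less_eq(3) order_le_less_trans)
  have pos: "AE \<omega> in M. 0 < passage_time W b \<omega>"
  proof -
    have "{\<omega> \<in> space M. passage_time W b \<omega> = 0} \<in> null_sets M"
      using assms(5) by (intro null_setsI) (auto simp: emeasure_eq_measure)
    hence "AE \<omega> in M. \<omega> \<notin> {\<omega> \<in> space M. passage_time W b \<omega> = 0}" by (rule AE_not_in)
    thus ?thesis using AE_space by eventually_elim (use passage_time_nonneg[of b] in \<open>auto simp: order_less_le\<close>)
  qed
  \<comment> \<open>The open interval builds in the value 0 at \<open>s = t\<close> and hides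
    \<open>b\<close> at non-positive times.\<close>
  define \<psi> where "\<psi> = (\<lambda>s. indicator {0<..<t} s * u (t - s) (y - b s))"
  have [measurable]: "\<psi> \<in> borel_measurable borel"
  proof -
    have "continuous_on {0<..<t} (\<lambda>s. (\<lambda>(s, x). u s x) (t - s, y - b s))"
      by (rule continuous_on_compose2[OF cont])
         (use lt\<delta> in \<open>auto simp: time_strip_def intro!: continuous_intros continuous_on_subset[OF b]\<close>)
    hence "continuous_on {0<..<t} (\<lambda>s. u (t - s) (y - b s))" by simp
    from borel_measurable_continuous_on_indicator[OF _ this] show ?thesis unfolding \<psi>_def by simp
  qed
  have \<psi>0: "0 \<le> \<psi> s" for s unfolding \<psi>_def using lt\<delta>[of "t - s"] nonneg_slice[of "t - s"] by (auto simp: indicator_def)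
  define J where "J = (\<integral>\<^sup>+\<omega>. indicator {\<omega> \<in> space M. passage_time W b \<omega> < \<infinity>} \<omega> * ennreal (\<psi> (?\<theta> \<omega>)) \<partial>M)"
  let ?I = "\<lambda>\<epsilon>. \<integral>\<^sup>+\<omega>. indicator (hits b (t - \<epsilon>)) \<omega> * ennreal (\<psi> (?\<theta> \<omega>)) \<partial>M"
  let ?E = "\<lambda>\<epsilon>. \<integral>\<^sup>+\<omega>. indicator (space M - hits b (t - \<epsilon>)) \<omega> * ennreal (u \<epsilon> (y - W (t - \<epsilon>) \<omega>)) \<partial>M"
  have split: "ennreal (u t y) = ?I \<epsilon> + ?E \<epsilon>" if \<epsilon>: "0 < \<epsilon>" "\<epsilon> < t" for \<epsilon>
  proof -
    have \<epsilon>\<delta>: "ereal \<epsilon> < \<delta>" using lt\<delta> \<epsilon> by simp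
    have "ennreal (u t y) = heat_nn (u \<epsilon>) (t - \<epsilon>) y" using \<epsilon> t by (intro representation) auto
    also have "\<dots> = (\<integral>\<^sup>+\<omega>. indicator (hits b (t - \<epsilon>)) \<omega> * heat_nn (u \<epsilon>) (t - \<epsilon> - ?\<theta> \<omega>) (y - indicator {0<..} (?\<theta> \<omega>) * b (?\<theta> \<omega>)) \<partial>M) + ?E \<epsilon>"
      by (rule stopped_identity[OF b pos _ continuous_slice[OF \<epsilon>(1) \<epsilon>\<delta>] nonneg_slice[OF \<epsilon>(1) \<epsilon>\<delta>]]) (use \<epsilon> in simp)
    also have "(\<integral>\<^sup>+\<omega>. indicator (hits b (t - \<epsilon>)) \<omega> * heat_nn (u \<epsilon>) (t - \<epsilon> - ?\<theta> \<omega>) (y - indicator {0<..} (?\<theta> \<omega>) * b (?\<theta> \<omega>)) \<partial>M) = ?I \<epsilon>"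
    proof (rule nn_integral_cong_AE)
      show "AE \<omega> in M. indicator (hits b (t - \<epsilon>)) \<omega> * heat_nn (u \<epsilon>) (t - \<epsilon> - ?\<theta> \<omega>) (y - indicator {0<..} (?\<theta> \<omega>) * b (?\<theta> \<omega>))
        = indicator (hits b (t - \<epsilon>)) \<omega> * ennreal (\<psi> (?\<theta> \<omega>))"
        using pos AE_space
      proof eventually_elim
        case (elim \<omega>)
        show ?case
        proof (cases "\<omega> \<in> hits b (t - \<epsilon>)")
          case True
          hence h: "passage_time W b \<omega> < \<infinity>" "?\<theta> \<omega> \<le> t - \<epsilon>"
            using hits_iff_passage_real[OF b elim(2,1), of "t - \<epsilon>"] \<epsilon> by auto
          have \<theta>: "0 < ?\<theta> \<omega>" using passage_real_pos[OF elim(1) h(1)] by simp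
          \<comment> \<open>The representation read backwards: propagating
            \<open>u \<epsilon>\<close> for the remaining time gives \<open>u\<close> at time
            \<open>t - ?\<theta> \<omega>\<close>, so the integrand no longer depends on
            \<epsilon>.\<close>
          have "ennreal (u (t - ?\<theta> \<omega>) (y - b (?\<theta> \<omega>))) = heat_nn (u \<epsilon>) (t - ?\<theta> \<omega> - \<epsilon>) (y - b (?\<theta> \<omega>))"
            using h \<theta> \<epsilon> lt\<delta>[of "t - ?\<theta> \<omega>"] by (intro representation) auto
          moreover have "t - ?\<theta> \<omega> - \<epsilon> = t - \<epsilon> - ?\<theta> \<omega>" by simp
          moreover have "?\<theta> \<omega> < t" using h \<epsilon> by simp
          ultimately show ?thesis using \<theta> by (simp add: \<psi>_def)
        qed simp
      qed
    qed
    finally show ?thesis .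
  qed
  \<comment> \<open>With \<epsilon> equal to \<open>t / (n + 2)\<close>, which is below
    \<open>t\<close> for every \<open>n\<close>, the events increase to a hit before
    \<open>t\<close>. Later hits contribute nothing since \<psi> vanishes there.\<close>
  have J_SUP: "J = (SUP n::nat. ?I (t / real (n + 2)))"
  proof -
    have \<epsilon>: "0 < t / real (n + 2)" "t / real (n + 2) < t" for n using t by (auto simp: field_simps add_pos_nonneg)
    have dec: "t / real (n + 2) \<le> t / real (m + 2)" if "m \<le> n" for m n
      using t that by (intro divide_left_mono) auto
    have sub: "hits b (t - t / real (m + 2)) \<subseteq> hits b (t - t / real (n + 2))" if "m \<le> n" for m n
      using dec[OF that] by (force simp: hits_def)
    have "J = (\<integral>\<^sup>+\<omega>. (SUP n. indicator (hits b (t - t / real (n + 2))) \<omega> * ennreal (\<psi> (?\<theta> \<omega>))) \<partial>M)"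
      unfolding J_def
    proof (rule nn_integral_cong_AE)
      show "AE \<omega> in M. indicator {\<omega> \<in> space M. passage_time W b \<omega> < \<infinity>} \<omega> * ennreal (\<psi> (?\<theta> \<omega>)) =
         (SUP n. indicator (hits b (t - t / real (n + 2))) \<omega> * ennreal (\<psi> (?\<theta> \<omega>)))"
        using pos AE_space
      proof eventually_elim
        case (elim \<omega>)
        have hit: "\<omega> \<in> hits b (t - t / real (n + 2)) \<longleftrightarrow> passage_time W b \<omega> < \<infinity> \<and> ?\<theta> \<omega> \<le> t - t / real (n + 2)" for n
          using hits_iff_passage_real[OF b elim(2,1)] \<epsilon>(2)[of n] by simp
        show ?case
        proof (cases "passage_time W b \<omega> < \<infinity> \<and> ?\<theta> \<omega> < t")
          case True
          obtain n where n: "t / (t - ?\<theta> \<omega>) < real n" using reals_Archimedean2 by blast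
          have "t < real n * (t - ?\<theta> \<omega>)" using n True by (simp add: pos_divide_less_eq)
          also have "\<dots> \<le> real (n + 2) * (t - ?\<theta> \<omega>)" using True by (intro mult_right_mono) auto
          finally have "t / real (n + 2) \<le> t - ?\<theta> \<omega>" by (subst pos_divide_le_eq) (auto simp: mult.commute)
          hence n: "\<omega> \<in> hits b (t - t / real (n + 2))" using hit[of n] True by simp
          have "(SUP n. indicator (hits b (t - t / real (n + 2))) \<omega> * ennreal (\<psi> (?\<theta> \<omega>))) = ennreal (\<psi> (?\<theta> \<omega>))"
          proof (rule antisym)
            show "(SUP n. indicator (hits b (t - t / real (n + 2))) \<omega> * ennreal (\<psi> (?\<theta> \<omega>))) \<le> ennreal (\<psi> (?\<theta> \<omega>))"
              by (rule SUP_least) (simp add: indicator_def)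
            show "ennreal (\<psi> (?\<theta> \<omega>)) \<le> (SUP n. indicator (hits b (t - t / real (n + 2))) \<omega> * ennreal (\<psi> (?\<theta> \<omega>)))"
              by (rule SUP_upper2[of n]) (use n in simp_all)
          qed
          thus ?thesis using True elim by simp
        next
          case False
          have "?\<theta> \<omega> < t" if "\<omega> \<in> hits b (t - t / real (n + 2))" for n using that hit[of n] \<epsilon>(1)[of n] by linarith
          hence "\<omega> \<notin> hits b (t - t / real (n + 2))" for n using False hit[of n] by blast
          moreover have "indicator {\<omega> \<in> space M. passage_time W b \<omega> < \<infinity>} \<omega> * ennreal (\<psi> (?\<theta> \<omega>)) = 0"
            using False by (auto simp: \<psi>_def indicator_def)
          ultimately show ?thesis by simp
        qed
      qed
    qed
    also have "\<dots> = (SUP n::nat. ?I (t / real (n + 2)))"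
    proof (rule nn_integral_monotone_convergence_SUP)
      show "incseq (\<lambda>n \<omega>. indicator (hits b (t - t / real (n + 2))) \<omega> * ennreal (\<psi> (?\<theta> \<omega>)))"
      proof (intro incseq_SucI le_funI mult_right_mono)
        show "indicator (hits b (t - t / real (n + 2))) \<omega> \<le> (indicator (hits b (t - t / real (Suc n + 2))) \<omega> :: ennreal)" for n \<omega>
          using subsetD[OF sub[of n "Suc n"], of \<omega>] by (auto simp: indicator_def)
      qed simp
    qed measurable
    finally show ?thesis .
  qed
  have \<epsilon>n: "0 < t / real (n + 2)" "t / real (n + 2) < t" for n using t by (auto simp: field_simps add_pos_nonneg)
  have "J \<le> ennreal (u t y)"
    unfolding J_SUP
  proof (rule SUP_least)
    fix n
    show "?I (t / real (n + 2)) \<le> ennreal (u t y)" unfolding split[OF \<epsilon>n[of n]] by simp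
  qed
  moreover have "ennreal (u t y) \<le> J"
  proof (rule ennreal_le_epsilon)
    fix e :: real assume e: "0 < e"
    \<comment> \<open>Half the gap: continuity of \<open>b\<close> at \<open>t\<close> leaves
      \<open>y + c < b (t - \<epsilon>)\<close> for small \<epsilon>, so on paths without a hit
      \<open>y - W (t - \<epsilon>)\<close> lies below \<open>-c\<close>.\<close>
    define c where "c = (b t - y) / 2"
    have c: "0 < c" using y by (simp add: c_def)
    obtain d1 where d1: "d1 > 0" "\<And>\<epsilon>. 0 < \<epsilon> \<Longrightarrow> \<epsilon> < d1 \<Longrightarrow> heat_nn (\<lambda>z. indicator {..< -c} z * u \<epsilon> z) (t - \<epsilon>) y \<le> ennreal e"
      using left_tail_vanishes[OF zero c e t, of y] by blast
    have "isCont b t" using b t by (simp add: continuous_on_eq_continuous_at)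
    hence "eventually (\<lambda>s. y + c < b s) (at t)"
      using y by (intro order_tendstoD(1)[of _ "b t"]) (auto simp: isCont_def c_def field_simps)
    then obtain d2 where d2: "d2 > 0" "\<And>s. s \<noteq> t \<Longrightarrow> dist s t < d2 \<Longrightarrow> y + c < b s" by (auto simp: eventually_at)
    obtain n where n: "t / min d1 d2 < real n" using reals_Archimedean2 by blast
    define \<epsilon> where "\<epsilon> = t / real (n + 2)"
    have \<epsilon>: "0 < \<epsilon>" "\<epsilon> < t" unfolding \<epsilon>_def by (rule \<epsilon>n)+
    have "\<epsilon> < min d1 d2"
    proof -
      have "t < real n * min d1 d2" using n d1 d2 by (simp add: pos_divide_less_eq)
      also have "\<dots> \<le> real (n + 2) * min d1 d2" using d1 d2 by (intro mult_right_mono) auto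
      finally show ?thesis unfolding \<epsilon>_def by (subst pos_divide_less_eq) (auto simp: mult.commute)
    qed
    hence \<epsilon>d: "\<epsilon> < d1" "\<epsilon> < d2" by auto
    have \<epsilon>\<delta>: "ereal \<epsilon> < \<delta>" using lt\<delta> \<epsilon> by simp
    have [measurable]: "u \<epsilon> \<in> borel_measurable borel" using continuous_slice[OF \<epsilon>(1) \<epsilon>\<delta>] by (rule borel_measurable_continuous_onI)
    have bT: "y + c < b (t - \<epsilon>)" using d2(2)[of "t - \<epsilon>"] \<epsilon> \<epsilon>d by (simp add: dist_real_def)
    have "?E \<epsilon> \<le> (\<integral>\<^sup>+\<omega>. ennreal ((\<lambda>z. indicator {..< -c} z * u \<epsilon> z) (y - W (t - \<epsilon>) \<omega>)) \<partial>M)"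
    proof (rule nn_integral_mono)
      fix \<omega> assume \<omega>: "\<omega> \<in> space M"
      show "indicator (space M - hits b (t - \<epsilon>)) \<omega> * ennreal (u \<epsilon> (y - W (t - \<epsilon>) \<omega>)) \<le> ennreal ((\<lambda>z. indicator {..< -c} z * u \<epsilon> z) (y - W (t - \<epsilon>) \<omega>))"
      proof (cases "\<omega> \<in> hits b (t - \<epsilon>)")
        case False
        hence "\<not> W (t - \<epsilon>) \<omega> \<le> b (t - \<epsilon>)" using \<omega> \<epsilon> by (auto simp: hits_def)
        hence "y - W (t - \<epsilon>) \<omega> < - c" using bT by linarith
        thus ?thesis using False \<omega> by simp
      qed simp
    qed
    also have "\<dots> = heat_nn (\<lambda>z. indicator {..< -c} z * u \<epsilon> z) (t - \<epsilon>) y"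
      by (rule nn_integral_marginal) (use \<epsilon> nonneg_slice[OF \<epsilon>(1) \<epsilon>\<delta>] in auto)
    also have "\<dots> \<le> ennreal e" using d1(2) \<epsilon> \<epsilon>d by blast
    finally have E: "?E \<epsilon> \<le> ennreal e" .
    have I: "?I \<epsilon> \<le> J" unfolding J_SUP \<epsilon>_def by (rule SUP_upper) simp
    show "ennreal (u t y) \<le> J + ennreal e" unfolding split[OF \<epsilon>] by (rule add_mono[OF I E])
  qed
  ultimately have J: "J = ennreal (u t y)" by (rule antisym)
  have "(\<integral>\<^sup>+s. ennreal (\<psi> s) \<partial>interval_measure (passage_cdf M W b)) = ennreal (u t y)"
    unfolding J[symmetric] J_def by (rule nn_integral_passage_cdf[OF b]) measurable
  hence "integrable (interval_measure (passage_cdf M W b)) \<psi> \<and> integral\<^sup>L (interval_measure (passage_cdf M W b)) \<psi> = u t y"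
    by (subst (asm) nn_integral_eq_integrable) (use \<psi>0 nonneg_slice[OF t] in auto)
  moreover have "\<psi> = (\<lambda>s. indicator {0<..t} s *\<^sub>R (if s < t then u (t - s) (y - b s) else 0))"
    by (auto simp: \<psi>_def indicator_def)
  ultimately show ?thesis unfolding set_integrable_def set_lebesgue_integral_def by simp
qed

end
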